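(* Let $\mathbb{K}$ be a field of characteristic not $2$ and let $V$ be a finite-dimensional $\mathbb{K}$-vector space equipped with a nondegenerate symmetric bilinear form of maximal Witt index $p=\lfloor\frac{\dim V}{2}\rfloor$. For any $\omega\in\bigwedge^pV$, it holds that $\omega\in\hat{Gr}_{\mathrm{iso}}(p,V)$ if and only if - (if $\dim V=2p+1$) every isotropic Grassmann cone preserving linear map $\bigwedge^pV\to\bigwedge^3\mathbb{K}^7$ maps $\omega$ into $\hat{Gr}_{\mathrm{iso}}(3,\mathbb{K}^7)$; - (if $\dim V=2p$) every isotropic Grassmann cone preserving linear map $\bigwedge^pV\to\bigwedge^4\mathbb{K}^8$ maps $\omega$ into $\hat{Gr}_{\mathrm{iso}}(4,\mathbb{K}^8)$.
   Context: $\mathbb{K}^7$ and $\mathbb{K}^8$ are equipped with nondegenerate symmetric bilinear forms of maximal Witt index ($3$ and $4$ respectively). The Witt index is the common dimension of all maximal isotropic subspaces (a subspace $L$ is isotropic if $\langle u,w\rangle=0$ for all $u,w\in L$). For a space $U$ with a nondegenerate symmetric bilinear form, the isotropic Grassmann cone is $$\hat{Gr}_{\mathrm{iso}}(k,U)=\{v_1\wedge\cdots\wedge v_k\mid v_i\in U,\ \langle v_i,v_j\rangle=0\text{ for all }i,j\}\subset\bigwedge\nolimits^kU.$$ A linear map $\Phi:\bigwedge^kU\to\bigwedge^qW$ is isotropic Grassmann cone preserving (IGCP) if $\Phi(\hat{Gr}_{\mathrm{iso}}(k,U))\subseteq\hat{Gr}_{\mathrm{iso}}(q,W)$. *)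

theory Defs
  imports "HOL-Analysis.Cartesian_Space" "HOL-Library.Poly_Mapping" "HOL-Library.Numeral_Type"
begin

section \<open>The free vector space on a set of symbols\<close>

definition free_scale :: "'k::field \<Rightarrow> ('a \<Rightarrow>\<^sub>0 'k) \<Rightarrow> ('a \<Rightarrow>\<^sub>0 'k)" where
  "free_scale c x = Poly_Mapping.map ((*) c) x"

lemma lookup_free_scale [simp]:
  "Poly_Mapping.lookup (free_scale c x) a = c * Poly_Mapping.lookup x a"
  by (simp add: free_scale_def Poly_Mapping.map.rep_eq when_def)

interpretation free_vs: vector_space "free_scale :: 'k::field \<Rightarrow> ('a \<Rightarrow>\<^sub>0 'k) \<Rightarrow> _"
  by unfold_locales (auto intro!: poly_mapping_eqI simp: lookup_add algebra_simps)


section \<open>Exterior powers\<close>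

text \<open>
  For a vector space \<open>V\<close> (the whole type \<open>'v\<close>, with scalar multiplication \<open>s\<close>), the \<open>k\<close>-th
  exterior power is the quotient of the free vector space on the \<open>k\<close>-tuples of vectors (lists of
  length \<open>k\<close>) by the relations making the class of a tuple multilinear and alternating in its
  entries. Its elements are cosets, so it is a set, and not a type; the operations
  below are meaningful only on elements of that set.
\<close>

definition ext_free :: "nat \<Rightarrow> ('v list \<Rightarrow>\<^sub>0 'k::field) set" where
  "ext_free k = {x. \<forall>vs \<in> Poly_Mapping.keys x. length vs = k}"

definition ext_relators ::
  "('k::field \<Rightarrow> 'v::ab_group_add \<Rightarrow> 'v) \<Rightarrow> nat \<Rightarrow> ('v list \<Rightarrow>\<^sub>0 'k) set" where
  "ext_relators s k =
     {Poly_Mapping.single (xs @ (u + v) # ys) 1 - Poly_Mapping.single (xs @ u # ys) 1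
        - Poly_Mapping.single (xs @ v # ys) 1 | xs u v ys. length xs + 1 + length ys = k}
   \<union> {Poly_Mapping.single (xs @ s c u # ys) 1 - free_scale c (Poly_Mapping.single (xs @ u # ys) 1)
        | xs c u ys. length xs + 1 + length ys = k}
   \<union> {Poly_Mapping.single vs 1 | vs. length vs = k \<and> \<not> distinct vs}"

definition ext_null ::
  "('k::field \<Rightarrow> 'v::ab_group_add \<Rightarrow> 'v) \<Rightarrow> nat \<Rightarrow> ('v list \<Rightarrow>\<^sub>0 'k) set" where
  "ext_null s k = module.span free_scale (ext_relators s k)"

definition ext_class ::
  "('k::field \<Rightarrow> 'v::ab_group_add \<Rightarrow> 'v) \<Rightarrow> nat \<Rightarrow> ('v list \<Rightarrow>\<^sub>0 'k) \<Rightarrow> ('v list \<Rightarrow>\<^sub>0 'k) set" where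
  "ext_class s k x = {x + n | n. n \<in> ext_null s k}"

definition ext_power ::
  "('k::field \<Rightarrow> 'v::ab_group_add \<Rightarrow> 'v) \<Rightarrow> nat \<Rightarrow> ('v list \<Rightarrow>\<^sub>0 'k) set set" where
  "ext_power s k = ext_class s k ` ext_free k"

definition ext_add ::
  "('v list \<Rightarrow>\<^sub>0 'k::field) set \<Rightarrow> ('v list \<Rightarrow>\<^sub>0 'k) set \<Rightarrow> ('v list \<Rightarrow>\<^sub>0 'k) set" where
  "ext_add X Y = {x + y | x y. x \<in> X \<and> y \<in> Y}"

text \<open>Adding \<open>ext_null\<close> matters only for \<open>c = 0\<close>, where \<open>{c x | x \<in> X}\<close> is not a coset.\<close>

definition ext_scale ::
  "('k::field \<Rightarrow> 'v::ab_group_add \<Rightarrow> 'v) \<Rightarrow> nat \<Rightarrow> 'k \<Rightarrow> ('v list \<Rightarrow>\<^sub>0 'k) set \<Rightarrow> ('v list \<Rightarrow>\<^sub>0 'k) set"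
  where
  "ext_scale s k c X = {free_scale c x + n | x n. x \<in> X \<and> n \<in> ext_null s k}"

definition wedge ::
  "('k::field \<Rightarrow> 'v::ab_group_add \<Rightarrow> 'v) \<Rightarrow> 'v list \<Rightarrow> ('v list \<Rightarrow>\<^sub>0 'k) set" where
  "wedge s vs = ext_class s (length vs) (Poly_Mapping.single vs 1)"

definition ext_linear ::
  "('k::field \<Rightarrow> 'u::ab_group_add \<Rightarrow> 'u) \<Rightarrow> nat \<Rightarrow> ('k \<Rightarrow> 'w::ab_group_add \<Rightarrow> 'w) \<Rightarrow> nat \<Rightarrow>
   (('u list \<Rightarrow>\<^sub>0 'k) set \<Rightarrow> ('w list \<Rightarrow>\<^sub>0 'k) set) \<Rightarrow> bool" where
  "ext_linear s k t q \<Phi> \<longleftrightarrow>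
     \<Phi> ` ext_power s k \<subseteq> ext_power t q \<and>
     (\<forall>X \<in> ext_power s k. \<forall>Y \<in> ext_power s k. \<Phi> (ext_add X Y) = ext_add (\<Phi> X) (\<Phi> Y)) \<and>
     (\<forall>c. \<forall>X \<in> ext_power s k. \<Phi> (ext_scale s k c X) = ext_scale t q c (\<Phi> X))"

lemma ext_null_closed:
  shows "0 \<in> ext_null s k"
    and "x \<in> ext_null s k \<Longrightarrow> y \<in> ext_null s k \<Longrightarrow> x + y \<in> ext_null s k"
    and "x \<in> ext_null s k \<Longrightarrow> y \<in> ext_null s k \<Longrightarrow> x - y \<in> ext_null s k"
    and "x \<in> ext_null s k \<Longrightarrow> free_scale c x \<in> ext_null s k"
  unfolding ext_null_def
  by (auto intro: free_vs.span_zero free_vs.span_add free_vs.span_diff free_vs.span_scale)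

lemma mem_ext_class_iff: "y \<in> ext_class s k x \<longleftrightarrow> y - x \<in> ext_null s k"
  unfolding ext_class_def by (auto simp: algebra_simps intro!: exI[of _ "y - x"])

lemma ext_class_eq_iff: "ext_class s k x = ext_class s k y \<longleftrightarrow> x - y \<in> ext_null s k"
proof
  assume "ext_class s k x = ext_class s k y"
  moreover have "x \<in> ext_class s k x"
    by (simp add: mem_ext_class_iff ext_null_closed)
  ultimately show "x - y \<in> ext_null s k"
    by (simp add: mem_ext_class_iff)
next
  assume d: "x - y \<in> ext_null s k"
  have "z - x \<in> ext_null s k \<longleftrightarrow> z - y \<in> ext_null s k" for z
    using ext_null_closed(2)[OF _ d, of "z - x"] ext_null_closed(3)[OF _ d, of "z - y"] by auto
  then show "ext_class s k x = ext_class s k y"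
    by (auto simp: mem_ext_class_iff)
qed

lemma ext_add_class: "ext_add (ext_class s k x) (ext_class s k y) = ext_class s k (x + y)"
proof (intro set_eqI iffI)
  fix z assume "z \<in> ext_add (ext_class s k x) (ext_class s k y)"
  then obtain m n where "m \<in> ext_null s k" "n \<in> ext_null s k" "z = (x + m) + (y + n)"
    by (auto simp: ext_add_def ext_class_def)
  then show "z \<in> ext_class s k (x + y)"
    using ext_null_closed(2)[of m s k n] by (simp add: mem_ext_class_iff algebra_simps)
next
  fix z assume "z \<in> ext_class s k (x + y)"
  then have "x \<in> ext_class s k x" "z - x \<in> ext_class s k y"
    by (simp_all add: mem_ext_class_iff ext_null_closed algebra_simps)
  then show "z \<in> ext_add (ext_class s k x) (ext_class s k y)"
    unfolding ext_add_def by (intro CollectI exI[of _ x] exI[of _ "z - x"]) simp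
qed

lemma ext_scale_class: "ext_scale s k c (ext_class s k x) = ext_class s k (free_scale c x)"
proof (intro set_eqI iffI)
  fix z assume "z \<in> ext_scale s k c (ext_class s k x)"
  then obtain m n where "m \<in> ext_null s k" "n \<in> ext_null s k" "z = free_scale c (x + m) + n"
    by (auto simp: ext_scale_def ext_class_def)
  then show "z \<in> ext_class s k (free_scale c x)"
    using ext_null_closed(2)[OF ext_null_closed(4)[of m s k c], of n]
    by (simp add: mem_ext_class_iff free_vs.scale_right_distrib algebra_simps)
next
  fix z assume "z \<in> ext_class s k (free_scale c x)"
  moreover have "x \<in> ext_class s k x"
    by (simp add: mem_ext_class_iff ext_null_closed)
  ultimately show "z \<in> ext_scale s k c (ext_class s k x)"
    unfolding ext_scale_def
    by (intro CollectI exI[of _ x] exI[of _ "z - free_scale c x"]) (simp add: mem_ext_class_iff)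
qed

lemma wedge_scale: "ext_scale s (Suc (length vs)) c (wedge s (v # vs)) = wedge s (s c v # vs)"
proof -
  have "Poly_Mapping.single ([] @ s c v # vs) 1 - free_scale c (Poly_Mapping.single ([] @ v # vs) 1)
          \<in> ext_relators s (Suc (length vs))"
    unfolding ext_relators_def
    by (rule UnI1, rule UnI2, rule CollectI, intro exI conjI) (rule refl, simp)
  then have "Poly_Mapping.single (s c v # vs) 1 - free_scale c (Poly_Mapping.single (v # vs) 1)
          \<in> ext_null s (Suc (length vs))"
    unfolding ext_null_def by (auto intro: free_vs.span_base)
  then have "ext_class s (Suc (length vs)) (Poly_Mapping.single (s c v # vs) 1) =
      ext_class s (Suc (length vs)) (free_scale c (Poly_Mapping.single (v # vs) 1))"
    by (simp only: ext_class_eq_iff)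
  then show ?thesis
    by (simp add: wedge_def ext_scale_class)
qed


section \<open>Symmetric bilinear forms and the isotropic Grassmann cone\<close>

definition nondegenerate_symmetric_form ::
  "('k::field \<Rightarrow> 'v::ab_group_add \<Rightarrow> 'v) \<Rightarrow> ('v \<Rightarrow> 'v \<Rightarrow> 'k) \<Rightarrow> bool" where
  "nondegenerate_symmetric_form s B \<longleftrightarrow>
     (\<forall>u. Vector_Spaces.linear s (*) (\<lambda>w. B u w)) \<and>
     (\<forall>w. Vector_Spaces.linear s (*) (\<lambda>u. B u w)) \<and>
     (\<forall>u w. B u w = B w u) \<and>
     (\<forall>u. (\<forall>w. B u w = 0) \<longrightarrow> u = 0)"

definition isotropic :: "('v \<Rightarrow> 'v \<Rightarrow> 'k::zero) \<Rightarrow> 'v set \<Rightarrow> bool" where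
  "isotropic B L \<longleftrightarrow> (\<forall>u \<in> L. \<forall>w \<in> L. B u w = 0)"

definition maximal_isotropic_subspace ::
  "('k::field \<Rightarrow> 'v::ab_group_add \<Rightarrow> 'v) \<Rightarrow> ('v \<Rightarrow> 'v \<Rightarrow> 'k) \<Rightarrow> 'v set \<Rightarrow> bool" where
  "maximal_isotropic_subspace s B L \<longleftrightarrow>
     module.subspace s L \<and> isotropic B L \<and>
     (\<forall>M. module.subspace s M \<and> isotropic B M \<and> L \<subseteq> M \<longrightarrow> M = L)"

definition has_witt_index ::
  "('k::field \<Rightarrow> 'v::ab_group_add \<Rightarrow> 'v) \<Rightarrow> ('v \<Rightarrow> 'v \<Rightarrow> 'k) \<Rightarrow> nat \<Rightarrow> bool" where
  "has_witt_index s B p \<longleftrightarrow>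
     {vector_space.dim s L | L. maximal_isotropic_subspace s B L} = {p}"

text \<open>
  The scalar \<open>c\<close> is redundant for \<open>k > 0\<close> (lemma \<open>iso_grassmann_cone_pos\<close>). It only serves to make
  the set a cone for \<open>k = 0\<close> as well, where the empty wedge product alone would give just \<open>{1}\<close>.
\<close>

definition iso_grassmann_cone ::
  "('k::field \<Rightarrow> 'v::ab_group_add \<Rightarrow> 'v) \<Rightarrow> ('v \<Rightarrow> 'v \<Rightarrow> 'k) \<Rightarrow> nat \<Rightarrow> ('v list \<Rightarrow>\<^sub>0 'k) set set" where
  "iso_grassmann_cone s B k =
     {ext_scale s k c (wedge s vs) | c vs. length vs = k \<and> isotropic B (set vs)}"

lemma iso_grassmann_cone_pos:
  assumes "vector_space s" "nondegenerate_symmetric_form s B" "k > 0"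
  shows "iso_grassmann_cone s B k = {wedge s vs | vs. length vs = k \<and> isotropic B (set vs)}"
proof (intro equalityI subsetI)
  fix X assume "X \<in> iso_grassmann_cone s B k"
  then obtain c vs where X: "X = ext_scale s k c (wedge s vs)" "length vs = k" "isotropic B (set vs)"
    by (auto simp: iso_grassmann_cone_def)
  obtain v ws where vs: "vs = v # ws"
    using X(2) assms(3) by (cases vs) auto
  have "B u (s c w) = c * B u w" "B (s c u) w = c * B u w" for u w
    using assms(2) by (auto simp: nondegenerate_symmetric_form_def Vector_Spaces.linear_iff)
  then have "isotropic B (set (s c v # ws))"
    using X(3) by (auto simp: isotropic_def vs)
  moreover have "X = wedge s (s c v # ws)"
    using wedge_scale[of s ws c v] X(1,2) by (auto simp: vs)
  ultimately show "X \<in> {wedge s vs | vs. length vs = k \<and> isotropic B (set vs)}"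
    using X(2) vs by (auto intro!: exI[of _ "s c v # ws"])
next
  fix X assume "X \<in> {wedge s vs | vs. length vs = k \<and> isotropic B (set vs)}"
  then obtain vs where X: "X = wedge s vs" "length vs = k" "isotropic B (set vs)"
    by auto
  have "X = ext_scale s k 1 (wedge s vs)"
    using X by (auto simp: wedge_def ext_scale_class)
  then show "X \<in> iso_grassmann_cone s B k"
    using X unfolding iso_grassmann_cone_def by blast
qed

definition igcp ::
  "('k::field \<Rightarrow> 'u::ab_group_add \<Rightarrow> 'u) \<Rightarrow> ('u \<Rightarrow> 'u \<Rightarrow> 'k) \<Rightarrow> nat \<Rightarrow>
   ('k \<Rightarrow> 'w::ab_group_add \<Rightarrow> 'w) \<Rightarrow> ('w \<Rightarrow> 'w \<Rightarrow> 'k) \<Rightarrow> nat \<Rightarrow>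
   (('u list \<Rightarrow>\<^sub>0 'k) set \<Rightarrow> ('w list \<Rightarrow>\<^sub>0 'k) set) \<Rightarrow> bool" where
  "igcp s B k t C q \<Phi> \<longleftrightarrow>
     ext_linear s k t q \<Phi> \<and> \<Phi> ` iso_grassmann_cone s B k \<subseteq> iso_grassmann_cone t C q"

end

theory Submission
  imports Defs "Jordan_Normal_Form.Determinant"
begin

text \<open>
  View \<open>\<omega>\<close> as the alternating form \<open>\<alpha>\<close> of degree \<open>p\<close> that sends \<open>y\<^sub>1, \<dots>, y\<^sub>p\<close> to the pairing of \<open>\<omega>\<close>
  with \<open>y\<^sub>1 \<and> \<dots> \<and> y\<^sub>p\<close>; the cone consists of the forms \<open>det (B (l\<^sub>i, y\<^sub>j))\<close> with isotropic
  \<open>l\<^sub>1, \<dots>, l\<^sub>p\<close>. Contracting \<open>\<alpha>\<close> with pairwise orthogonal isotropic vectors and restricting it to the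
  span of a complementary hyperbolic system is an IGCP map, so it suffices that \<open>\<alpha>\<close> lies in the
  cone as soon as all its contractions with one isotropic vector do, for \<open>p \<ge> 4\<close> in odd and
  \<open>p \<ge> 5\<close> in even dimension. A form that vanishes on every Lagrangian frame is zero. Otherwise take
  a hyperbolic basis \<open>e\<^sub>i, f\<^sub>i (, g)\<close> with \<open>\<alpha> (f\<^sub>1, \<dots>, f\<^sub>p) \<noteq> 0\<close>; the contractions allow one to change the
  \<open>e\<^sub>i\<close> and \<open>g\<close> so that all coordinates of \<open>\<alpha>\<close> vanish that contain some \<open>f\<^sub>k\<close> without \<open>e\<^sub>k\<close>, except
  \<open>\<alpha> (f\<^sub>1, \<dots>, f\<^sub>p)\<close>. If few enough indices are affected, this persists when \<open>f\<^sub>i\<close> is replaced by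
  \<open>f\<^sub>i + t g - (B (g, g) t\<^sup>2 / 2) e\<^sub>i\<close>, \<open>f\<^sub>i + t e\<^sub>j\<close> or \<open>f\<^sub>i + f\<^sub>j\<close>, and comparing \<open>t = 1\<close> with \<open>t = -1\<close> kills
  the remaining coordinates since \<open>2 \<noteq> 0\<close>. For \<open>p\<close> below 3 or 4, a hyperbolic system of the target
  is split off instead: \<open>v\<^sub>1 \<and> \<dots> \<and> v\<^sub>p\<close> is sent to its wedge product with a fixed isotropic frame.
\<close>

section \<open>Alternating forms\<close>

text \<open>The bounds come from counting indices. A change of basis that touches the indices in
  \<open>J\<close> is shown to preserve the normal form when some index outside \<open>J\<close>
  stays free; since a coordinate to be killed brings in at most two more indices, this asks for
  \<open>card J + 3 <= card I\<close>. With g at hand, one index is enough for a move, so the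
  inductive step works from p = 4 on and 3 is the base. Without g, the vector f_i + t e_i is
  isotropic only for t = 0, so a move needs two indices, the step starts at p = 5 and the base is 4.
  Hence the targets of dimension 2 * 3 + 1 and 2 * 4. Passing from \<omega> to \<alpha> loses
  nothing, because the pairing induced on the exterior power is nondegenerate as well
  (\<open>ext_null_if_gram_0\<close>). In odd dimension the norm of g may differ between V and the
  target. Rescaling a form by a nonzero factor does not change its cone, so the target form is
  rescaled until both norms are equal; after that a hyperbolic system of the smaller space embeds
  isometrically in the larger one.\<close>

definition alt_form :: "('k::field \<Rightarrow> 'v::ab_group_add \<Rightarrow> 'v) \<Rightarrow> nat \<Rightarrow> ('v list \<Rightarrow> 'k) \<Rightarrow> bool" where
  "alt_form s n \<phi> \<longleftrightarrow>
     (\<forall>xs u v ys. length xs + 1 + length ys = n \<longrightarrow>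
        \<phi> (xs @ (u + v) # ys) = \<phi> (xs @ u # ys) + \<phi> (xs @ v # ys)) \<and>
     (\<forall>xs c u ys. length xs + 1 + length ys = n \<longrightarrow> \<phi> (xs @ s c u # ys) = c * \<phi> (xs @ u # ys)) \<and>
     (\<forall>vs. length vs = n \<longrightarrow> \<not> distinct vs \<longrightarrow> \<phi> vs = 0)"

lemma alt_form_add:
  "alt_form s n \<phi> \<Longrightarrow> length xs + 1 + length ys = n \<Longrightarrow>
    \<phi> (xs @ (u + v) # ys) = \<phi> (xs @ u # ys) + \<phi> (xs @ v # ys)"
  unfolding alt_form_def by blast

lemma alt_form_scale:
  "alt_form s n \<phi> \<Longrightarrow> length xs + 1 + length ys = n \<Longrightarrow> \<phi> (xs @ s c u # ys) = c * \<phi> (xs @ u # ys)"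
  unfolding alt_form_def by blast

lemma alt_form_not_distinct:
  "alt_form s n \<phi> \<Longrightarrow> length vs = n \<Longrightarrow> \<not> distinct vs \<Longrightarrow> \<phi> vs = 0"
  unfolding alt_form_def by blast

lemma alt_form_Cons:
  assumes "alt_form s (Suc n) \<phi>"
  shows "alt_form s n (\<lambda>ys. \<phi> (x # ys))"
proof -
  have "\<phi> ((x # xs) @ (u + v) # ys) = \<phi> ((x # xs) @ u # ys) + \<phi> ((x # xs) @ v # ys)"
    if "length xs + 1 + length ys = n" for xs u v ys
    using that by (intro alt_form_add[OF assms]) auto
  moreover have "\<phi> ((x # xs) @ s c u # ys) = c * \<phi> ((x # xs) @ u # ys)"
    if "length xs + 1 + length ys = n" for xs c u ys
    using that by (intro alt_form_scale[OF assms]) auto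
  moreover have "\<phi> (x # vs) = 0" if "length vs = n" "\<not> distinct vs" for vs
    using that by (intro alt_form_not_distinct[OF assms]) auto
  ultimately show ?thesis
    unfolding alt_form_def by simp
qed

lemma alt_form_append:
  "alt_form s (length xs + n) \<phi> \<Longrightarrow> alt_form s n (\<lambda>ys. \<phi> (xs @ ys))"
proof (induction xs arbitrary: \<phi>)
  case (Cons x xs)
  then show ?case using Cons.IH[OF alt_form_Cons[of s _ \<phi> x]] by simp
qed simp

lemma alt_formI:
  assumes "\<And>xs u v ys. length xs + 1 + length ys = n \<Longrightarrow>
        \<phi> (xs @ (u + v) # ys) = \<phi> (xs @ u # ys) + \<phi> (xs @ v # ys)"
    and "\<And>xs c u ys. length xs + 1 + length ys = n \<Longrightarrow> \<phi> (xs @ s c u # ys) = c * \<phi> (xs @ u # ys)"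
    and "\<And>vs. length vs = n \<Longrightarrow> \<not> distinct vs \<Longrightarrow> \<phi> vs = 0"
  shows "alt_form s n \<phi>"
  using assms unfolding alt_form_def by blast

lemma alt_form_cong:
  assumes "\<And>ys. length ys = n \<Longrightarrow> \<phi> ys = \<psi> ys" "alt_form s n \<psi>"
  shows "alt_form s n \<phi>"
proof (rule alt_formI)
  show "\<phi> (xs @ (u + v) # ys) = \<phi> (xs @ u # ys) + \<phi> (xs @ v # ys)"
    if "length xs + 1 + length ys = n" for xs u v ys
    using alt_form_add[OF assms(2) that] assms(1) that by simp
  show "\<phi> (xs @ s c u # ys) = c * \<phi> (xs @ u # ys)"
    if "length xs + 1 + length ys = n" for xs c u ys
    using alt_form_scale[OF assms(2) that] assms(1) that by simp
  show "\<phi> vs = 0" if "length vs = n" "\<not> distinct vs" for vs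
    using alt_form_not_distinct[OF assms(2) that] assms(1) that by simp
qed

lemma alt_form_diff:
  assumes "alt_form s n \<phi>" "alt_form s n \<psi>"
  shows "alt_form s n (\<lambda>ys. \<phi> ys - \<psi> ys)"
  by (rule alt_formI; simp add: assms[THEN alt_form_add] assms[THEN alt_form_scale]
      assms[THEN alt_form_not_distinct] right_diff_distrib)

lemma alt_form_cmult:
  assumes "alt_form s n \<phi>"
  shows "alt_form s n (\<lambda>ys. c * \<phi> ys)"
  by (rule alt_formI; simp add: assms[THEN alt_form_add] assms[THEN alt_form_scale]
      assms[THEN alt_form_not_distinct] distrib_left mult.left_commute)

lemma alt_form_sum:
  assumes "\<And>a. a \<in> A \<Longrightarrow> alt_form s n (\<phi> a)"
  shows "alt_form s n (\<lambda>ys. \<Sum>a\<in>A. \<phi> a ys)"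
  by (rule alt_formI; simp add: assms[THEN alt_form_add] assms[THEN alt_form_scale]
      assms[THEN alt_form_not_distinct] sum.distrib sum_distrib_left)

lemma alt_form_swap_adj:
  assumes "alt_form s n \<phi>" "length xs + 2 + length ys = n"
  shows "\<phi> (xs @ u # v # ys) = - \<phi> (xs @ v # u # ys)"
proof -
  have a: "\<phi> (xs @ (x + y) # z # ys) = \<phi> (xs @ x # z # ys) + \<phi> (xs @ y # z # ys)" for x y z
    using alt_form_add[OF assms(1), of xs "z # ys"] assms(2) by simp
  have b: "\<phi> (xs @ z # (x + y) # ys) = \<phi> (xs @ z # x # ys) + \<phi> (xs @ z # y # ys)" for x y z
    using alt_form_add[OF assms(1), of "xs @ [z]" ys] assms(2) by simp
  have c: "\<phi> (xs @ x # x # ys) = 0" for x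
    using assms(2) by (intro alt_form_not_distinct[OF assms(1)]) auto
  have "0 = \<phi> (xs @ (u + v) # (u + v) # ys)"
    by (simp only: c)
  also have "\<dots> = \<phi> (xs @ u # v # ys) + \<phi> (xs @ v # u # ys)"
    by (simp only: a b) (simp only: c add_0_left add_0_right add.commute)
  finally have "\<phi> (xs @ u # v # ys) + \<phi> (xs @ v # u # ys) = 0" by (rule sym)
  then show ?thesis by (rule eq_neg_iff_add_eq_0[THEN iffD2])
qed

text \<open>Adjacent transpositions give the sign (-1)^(length xs). Only its independence of
  \<open>\<phi>\<close> is kept: it lets the same sign be cancelled between the values of two
  forms.\<close>

lemma alt_form_move_front:
  "\<exists>\<epsilon>\<in>{1,-1}. \<forall>\<phi>. alt_form s n \<phi> \<longrightarrow> length xs + 1 + length ys = n \<longrightarrow>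
     \<phi> (xs @ u # ys) = \<epsilon> * \<phi> (u # xs @ ys)"
proof (induction xs arbitrary: n)
  case Nil
  show ?case by (rule bexI[of _ 1]) auto
next
  case (Cons x xs)
  obtain \<epsilon> where \<epsilon>: "\<epsilon> \<in> {1,-1}" and e: "\<And>\<phi>. alt_form s (n - 1) \<phi> \<Longrightarrow> length xs + 1 + length ys = n - 1 \<Longrightarrow>
     \<phi> (xs @ u # ys) = \<epsilon> * \<phi> (u # xs @ ys)" using Cons[of "n - 1"] by blast
  show ?case
  proof (rule bexI[of _ "-\<epsilon>"], intro allI impI)
    fix \<phi> assume p: "alt_form s n \<phi>" and l: "length (x # xs) + 1 + length ys = n"
    have "Suc (n - 1) = n" using l by auto
    then have "alt_form s (n - 1) (\<lambda>ys. \<phi> (x # ys))"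
      using p by (metis alt_form_Cons)
    then have "\<phi> (x # xs @ u # ys) = \<epsilon> * \<phi> (x # u # xs @ ys)"
      using l by (intro e) auto
    also have "\<phi> (x # u # xs @ ys) = - \<phi> (u # x # xs @ ys)"
      using alt_form_swap_adj[OF p, of "[]" "xs @ ys" x u] l by simp
    finally show "\<phi> ((x # xs) @ u # ys) = -\<epsilon> * \<phi> (u # (x # xs) @ ys)" by simp
  qed (use \<epsilon> in auto)
qed

text \<open>The sign is chosen before the form: it depends on the two lists only.\<close>

lemma alt_form_perm:
  "mset xs = mset ys \<Longrightarrow> length xs = n \<Longrightarrow>
    \<exists>\<epsilon>\<in>{1,-1}. \<forall>\<phi>. alt_form s n \<phi> \<longrightarrow> \<phi> xs = \<epsilon> * \<phi> ys"
proof (induction xs arbitrary: ys n)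
  case Nil
  then show ?case by (intro bexI[of _ 1]) auto
next
  case (Cons x xs)
  have "x \<in> set ys" using Cons.prems(1) by (metis list.set_intros(1) set_mset_mset)
  then obtain as bs where ys: "ys = as @ x # bs" by (meson split_list)
  then have m: "mset xs = mset (as @ bs)" using Cons.prems by simp
  obtain m where n: "n = Suc m" "length xs = m" using Cons.prems by auto
  obtain \<epsilon> where e: "\<epsilon> \<in> {1,-1}" "\<And>\<phi>. alt_form s m \<phi> \<Longrightarrow> \<phi> xs = \<epsilon> * \<phi> (as @ bs)"
    using Cons.IH[OF m n(2)] by blast
  have "length xs = length (as @ bs)" using m by (rule mset_eq_length)
  then have l: "length as + 1 + length bs = n" using n by simp
  obtain \<delta> where d: "\<delta> \<in> {1,-1}" "\<And>\<phi>. alt_form s n \<phi> \<Longrightarrow> \<phi> (as @ x # bs) = \<delta> * \<phi> (x # as @ bs)"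
    using alt_form_move_front[of s n as bs x] l by blast
  show ?case
  proof (rule bexI[of _ "\<epsilon> * \<delta>"], intro allI impI)
    fix \<phi> assume p: "alt_form s n \<phi>"
    have "\<phi> (x # xs) = \<epsilon> * \<phi> (x # as @ bs)"
      using e(2)[OF alt_form_Cons[of s m \<phi> x]] p n by simp
    moreover have "\<delta> * \<delta> = 1" using d(1) by auto
    ultimately show "\<phi> (x # xs) = \<epsilon> * \<delta> * \<phi> ys"
      using d(2)[OF p] ys by (simp add: mult.assoc[symmetric])
  qed (use e(1) d(1) in auto)
qed

lemma alt_form_perm_eq_0:
  assumes "alt_form s n \<phi>" "\<phi> ys = 0" "mset xs = mset ys" "length xs = n"
  shows "\<phi> xs = 0"
proof -
  obtain \<epsilon> where "\<phi> xs = \<epsilon> * \<phi> ys"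
    using alt_form_perm[OF assms(3,4), of s] assms(1) by blast
  then show ?thesis using assms(2) by simp
qed

context vector_space
begin

lemma alt_form_zero:
  assumes "alt_form scale n \<phi>" "length xs + 1 + length ys = n"
  shows "\<phi> (xs @ 0 # ys) = 0"
  using alt_form_scale[OF assms, of 0 0] by simp

lemma alt_form_span_nth:
  assumes "alt_form scale n \<phi>" "length xs + 1 + length ys = n"
    and "\<And>u. u \<in> A \<Longrightarrow> \<phi> (xs @ u # ys) = 0" "x \<in> span A"
  shows "\<phi> (xs @ x # ys) = 0"
  using assms(4)
proof (induction rule: span_induct)
  case base
  show ?case
    by (rule subspaceI)
      (auto simp: alt_form_zero[OF assms(1,2)] alt_form_add[OF assms(1,2)] alt_form_scale[OF assms(1,2)])
qed (use assms(3) in auto)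

lemma alt_form_eq_0_on_span:
  assumes "alt_form scale n \<phi>"
    and "\<And>is. distinct is \<Longrightarrow> set is \<subseteq> J \<Longrightarrow> length is = n \<Longrightarrow> \<phi> (map b is) = 0"
    and "set ys \<subseteq> span (b ` J)" "length ys = n"
  shows "\<phi> ys = 0"
proof -
  \<comment> \<open>Generalized to a prefix of basis vectors, which absorbs the entries of
    \<open>ys\<close> one at a time.\<close>
  have "set is \<subseteq> J \<Longrightarrow> set ys \<subseteq> span (b ` J) \<Longrightarrow> length is + length ys = n \<Longrightarrow> \<phi> (map b is @ ys) = 0" for "is"
  proof (induction ys arbitrary: "is")
    case Nil
    show ?case
    proof (cases "distinct is")
      case True
      with Nil assms(2) show ?thesis by simp
    next
      case False
      then have "\<not> distinct (map b is)" by (simp add: distinct_map)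
      with Nil alt_form_not_distinct[OF assms(1)] show ?thesis by simp
    qed
  next
    case (Cons y ys)
    show ?case
    proof (rule alt_form_span_nth[OF assms(1)])
      fix u assume "u \<in> b ` J"
      then obtain i where "i \<in> J" "u = b i" by auto
      then show "\<phi> (map b is @ u # ys) = 0"
        using Cons.IH[of "is @ [i]"] Cons.prems by simp
    qed (use Cons.prems in auto)
  qed
  from this[of "[]"] assms(3,4) show ?thesis by simp
qed

lemma alt_form_Cons_linear:
  assumes "alt_form scale (Suc n) \<phi>" "length ys = n"
  shows "Vector_Spaces.linear scale (*) (\<lambda>x. \<phi> (x # ys))"
proof -
  have "\<phi> ((u + v) # ys) = \<phi> (u # ys) + \<phi> (v # ys)" "\<phi> (scale c u # ys) = c * \<phi> (u # ys)" for u v c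
    using alt_form_add[OF assms(1), of "[]"] alt_form_scale[OF assms(1), of "[]"] assms(2) by auto
  then show ?thesis
    by unfold_locales (simp_all add: distrib_left distrib_right)
qed

end

section \<open>Gram determinants\<close>

text \<open>The pairing of two wedge products that is induced by a bilinear form.\<close>

definition gram :: "('v \<Rightarrow> 'w \<Rightarrow> 'k::comm_ring_1) \<Rightarrow> 'v list \<Rightarrow> 'w list \<Rightarrow> 'k" where
  "gram B vs ys = Determinant.det (Matrix.mat (length vs) (length vs) (\<lambda>(i,j). B (vs ! i) (ys ! j)))"

lemma gram_Nil [simp]: "gram B [] ys = 1"
  by (simp add: gram_def)

lemma gram_transpose: "length vs = length ys \<Longrightarrow> gram B vs ys = gram (\<lambda>x y. B y x) ys vs"
  unfolding gram_def
  by (subst det_transpose[symmetric, where n = "length vs"])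
    (auto intro!: arg_cong[where f = Determinant.det])

lemma gram_map:
  assumes "\<And>v y. v \<in> set vs \<Longrightarrow> y \<in> set ys \<Longrightarrow> B (f v) (g y) = C (f' v) (g' y)" "length vs = length ys"
  shows "gram B (map f vs) (map g ys) = gram C (map f' vs) (map g' ys)"
  unfolding gram_def using assms by (auto intro!: arg_cong[where f = Determinant.det] eq_matI)

lemma gram_eq_0_row:
  assumes "v \<in> set vs" "\<And>y. y \<in> set ys \<Longrightarrow> B v y = 0" "length vs = length ys"
  shows "gram B vs ys = 0"
proof -
  obtain k where k: "k < length vs" "v = vs ! k" using assms(1) by (metis in_set_conv_nth)
  have "Determinant.det (Matrix.mat (length vs) (length vs) (\<lambda>(i,j). B (vs ! i) (ys ! j))) =
     Determinant.det (Matrix.mat_of_row_fun (length vs) (length vs) (\<lambda>i. if i = k then 0\<^sub>v (length vs) else Matrix.vec (length vs) (\<lambda>j. B (vs ! i) (ys ! j))))"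
    using k assms by (intro arg_cong[where f = Determinant.det] eq_matI) (auto simp:)
  also have "\<dots> = 0" by (rule det_row_0[OF k(1)]) auto
  finally show ?thesis by (simp add: gram_def)
qed

text \<open>Laplace expansion along the first column, which is the one that belongs to
  \<open>y\<close>.\<close>

lemma gram_Cons_right:
  assumes "length ys = n" "length vs = Suc n"
  shows "gram B vs (y # ys) = (\<Sum>i<Suc n. B (vs ! i) y *
    ((-1) ^ i * gram B (take i vs @ drop (Suc i) vs) ys))"
proof -
  let ?A = "Matrix.mat (Suc n) (Suc n) (\<lambda>(i,j). B (vs ! i) ((y # ys) ! j))"
  have "gram B vs (y # ys) = (\<Sum>i<Suc n. ?A $$ (i,0) * cofactor ?A i 0)"
    unfolding gram_def assms(2) by (rule laplace_expansion_column) auto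
  also have "\<dots> = (\<Sum>i<Suc n. B (vs ! i) y * ((-1) ^ i * gram B (take i vs @ drop (Suc i) vs) ys))"
  proof (rule sum.cong[OF refl])
    fix i assume i: "i \<in> {..<Suc n}"
    have "mat_delete ?A i 0 = Matrix.mat n n (\<lambda>(k,j). B ((take i vs @ drop (Suc i) vs) ! k) (ys ! j))"
      using i assms by (intro eq_matI) (auto simp: mat_delete_def nth_append)
    moreover have "length (take i vs @ drop (Suc i) vs) = n" using i assms by auto
    ultimately show "?A $$ (i,0) * cofactor ?A i 0 = B (vs ! i) y * ((-1) ^ i * gram B (take i vs @ drop (Suc i) vs) ys)"
      using i by (simp only: cofactor_def gram_def) simp
  qed
  finally show ?thesis .
qed

lemma gram_Cons_Cons:
  assumes "length ys = length vs" "\<And>w. w \<in> set vs \<Longrightarrow> B w y = 0"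
  shows "gram B (v # vs) (y # ys) = B v y * gram B vs ys"
proof -
  have "gram B (v # vs) (y # ys) = (\<Sum>i<Suc (length vs). if i = 0 then B v y * gram B vs ys else 0)"
    unfolding gram_Cons_right[OF assms(1), of "v # vs", OF length_Cons]
  proof (rule sum.cong[OF refl])
    fix i assume "i \<in> {..<Suc (length vs)}"
    then show "B ((v # vs) ! i) y * ((- 1) ^ i * gram B (take i (v # vs) @ drop (Suc i) (v # vs)) ys) =
      (if i = 0 then B v y * gram B vs ys else 0)"
      using assms(2) by (cases i) auto
  qed
  then show ?thesis by simp
qed

section \<open>Spaces with a symmetric bilinear form\<close>

locale sym_form = vector_space s
  for s :: "'k::field \<Rightarrow> 'v::ab_group_add \<Rightarrow> 'v" +
  fixes B :: "'v \<Rightarrow> 'v \<Rightarrow> 'k"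
  assumes B_add_left: "B (u + v) w = B u w + B v w"
    and B_scale_left: "B (s c u) w = c * B u w"
    and B_sym: "B u w = B w u"
begin

lemma B_add_right: "B w (u + v) = B w u + B w v"
  by (metis B_add_left B_sym)

lemma B_scale_right: "B w (s c u) = c * B w u"
  by (metis B_scale_left B_sym)

lemma B_zero_left [simp]: "B 0 w = 0"
  using B_scale_left[of 0 0 w] by simp

lemma B_zero_right [simp]: "B w 0 = 0"
  by (metis B_zero_left B_sym)

lemma B_minus_left: "B (- u) w = - B u w"
  by (metis B_add_left B_zero_left add.left_inverse eq_neg_iff_add_eq_0)

lemma B_minus_right: "B w (- u) = - B w u"
  by (metis B_minus_left B_sym)

lemma B_diff_left: "B (u - v) w = B u w - B v w"
  by (metis B_add_left B_minus_left diff_conv_add_uminus)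

lemma B_diff_right: "B w (u - v) = B w u - B w v"
  by (metis B_diff_left B_sym)

lemma B_sum_left: "B (\<Sum>i\<in>A. f i) w = (\<Sum>i\<in>A. B (f i) w)"
  by (induction A rule: infinite_finite_induct) (simp_all add: B_add_left)

lemma B_sum_right: "B w (\<Sum>i\<in>A. f i) = (\<Sum>i\<in>A. B w (f i))"
  by (induction A rule: infinite_finite_induct) (simp_all add: B_add_right)

lemmas B_simps = B_add_left B_add_right B_scale_left B_scale_right B_minus_left B_minus_right
  B_diff_left B_diff_right B_sum_left B_sum_right

lemma B_span_eq_0: "x \<in> span A \<Longrightarrow> (\<And>a. a \<in> A \<Longrightarrow> B a w = 0) \<Longrightarrow> B x w = 0"
  by (induction rule: span_induct) (auto intro!: subspaceI simp: B_simps)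

lemma B_span_eq_0': "x \<in> span A \<Longrightarrow> (\<And>a. a \<in> A \<Longrightarrow> B w a = 0) \<Longrightarrow> B w x = 0"
  using B_span_eq_0 B_sym by metis

lemma isotropic_span: "isotropic B A \<Longrightarrow> isotropic B (span A)"
  unfolding isotropic_def by (intro ballI) (rule B_span_eq_0, assumption, rule B_span_eq_0', auto)

lemma gram_sym: "length vs = length ys \<Longrightarrow> gram B vs ys = gram B ys vs"
  using gram_transpose[of vs ys B] B_sym by simp

lemma alt_form_gram_left: "alt_form s (length ys) (\<lambda>vs. gram B vs ys)"
proof -
  define n where "n = length ys"
  define r where "r x = Matrix.vec n (\<lambda>j. B x (ys ! j))" for x
  have g: "gram B vs ys = Determinant.det (Matrix.mat_of_row_fun n n (\<lambda>i. r (vs ! i)))" if "length vs = n" for vs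
    unfolding gram_def that
    by (intro arg_cong[where f = Determinant.det] eq_matI) (auto simp: r_def)
  have rc: "r x \<in> carrier_vec n" for x by (simp add: r_def)
  have radd: "r (u + v) = r u + r v" and rsc: "r (s c u) = c \<cdot>\<^sub>v r u" for u v c
    by (auto simp: r_def B_simps)
  \<comment> \<open>The row of \<open>u\<close> is singled out, with 0 as a dummy in its place, to
    fit the shape of \<open>det_row_add\<close>.\<close>
  have nth: "r ((xs @ u # zs) ! i) = (if i = length xs then r u else r ((xs @ 0 # zs) ! i))"
    for xs zs i and u :: 'v by (auto simp: nth_append nth_Cons')
  have "gram B (xs @ (u + v) # zs) ys = gram B (xs @ u # zs) ys + gram B (xs @ v # zs) ys"
    if "length xs + 1 + length zs = n" for xs u v zs
  proof -
    have "Determinant.det (Matrix.mat_of_row_fun n n (\<lambda>i. if i = length xs then r u + r v else r ((xs @ 0 # zs) ! i))) =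
      Determinant.det (Matrix.mat_of_row_fun n n (\<lambda>i. if i = length xs then r u else r ((xs @ 0 # zs) ! i))) +
      Determinant.det (Matrix.mat_of_row_fun n n (\<lambda>i. if i = length xs then r v else r ((xs @ 0 # zs) ! i)))"
      by (rule det_row_add) (use that rc in auto)
    moreover have "gram B (xs @ x # zs) ys = Determinant.det (Matrix.mat_of_row_fun n n
        (\<lambda>i. if i = length xs then r x else r ((xs @ 0 # zs) ! i)))" for x
      using g[of "xs @ x # zs"] that nth[of xs x zs] by simp
    ultimately show ?thesis by (simp only: radd)
  qed
  moreover have "gram B (xs @ s c u # zs) ys = c * gram B (xs @ u # zs) ys"
    if "length xs + 1 + length zs = n" for xs c u zs
  proof -
    let ?A = "Matrix.mat_of_row_fun n n (\<lambda>i. r ((xs @ u # zs) ! i))"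
    have "Determinant.det (multrow (length xs) c ?A) = c * Determinant.det ?A"
      by (rule det_multrow[where n = n]) (use that in auto)
    moreover have "multrow (length xs) c ?A = Matrix.mat_of_row_fun n n (\<lambda>i. r ((xs @ s c u # zs) ! i))"
      by (rule eq_matI) (use that rc in \<open>auto simp: nth_append rsc r_def B_simps\<close>)
    ultimately show ?thesis
      using g[of "xs @ u # zs"] g[of "xs @ s c u # zs"] that by simp
  qed
  moreover have "gram B vs ys = 0" if l: "length vs = n" and d: "\<not> distinct vs" for vs
  proof -
    obtain i j where "i < n" "j < n" "i \<noteq> j" "vs ! i = vs ! j"
      using l d unfolding distinct_conv_nth by metis
    then show ?thesis
      unfolding g[OF l] by (intro det_identical_rows[of _ n i j]) (auto simp: rc)
  qed
  ultimately show ?thesis unfolding alt_form_def n_def by blast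
qed

lemma alt_form_gram: "alt_form s (length vs) (gram B vs)"
proof -
  have "gram B vs ys = gram B ys vs" if "length ys = length vs" for ys
    using that gram_sym by metis
  then show ?thesis
    using alt_form_gram_left[of vs] by (rule alt_form_cong)
qed

lemma gram_eq_0_col:
  assumes "y \<in> set ys" "\<And>v. v \<in> set vs \<Longrightarrow> B v y = 0" "length vs = length ys"
  shows "gram B vs ys = 0"
proof -
  have "gram B ys vs = 0"
    using assms by (intro gram_eq_0_row[of y]) (auto simp: B_sym[of y])
  then show ?thesis using gram_sym[OF assms(3)] by simp
qed

end

section \<open>Hyperbolic systems\<close>

text \<open>
  \<open>Ev i\<close> and \<open>Fv i\<close> index the vectors \<open>e\<^sub>i\<close> and \<open>f\<^sub>i\<close> of the \<open>i\<close>-th hyperbolic pair, \<open>Gv\<close> the anisotropic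
  vector \<open>g\<close> orthogonal to all of them in odd dimension.
\<close>

datatype hyp_index = Ev nat | Fv nat | Gv

text \<open>\<open>Gv\<close> is always included: in even dimension its vector is 0, which changes
  no span, and both parities can share the proofs.\<close>

definition hix :: "nat set \<Rightarrow> hyp_index set" where
  "hix I = Ev ` I \<union> Fv ` I \<union> {Gv}"

definition F_list :: "(hyp_index \<Rightarrow> 'v) \<Rightarrow> nat set \<Rightarrow> 'v list" where
  "F_list h I = map (\<lambda>i. h (Fv i)) (sorted_list_of_set I)"

lemma hix_mono: "I \<subseteq> J \<Longrightarrow> hix I \<subseteq> hix J"
  by (auto simp: hix_def)

lemma length_F_list [simp]: "length (F_list h I) = card I"
  by (simp add: F_list_def)

lemma set_F_list [simp]: "finite I \<Longrightarrow> set (F_list h I) = (\<lambda>i. h (Fv i)) ` I"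
  by (simp add: F_list_def)

lemma F_list_cong: "(\<And>i. i \<in> I \<Longrightarrow> h (Fv i) = h' (Fv i)) \<Longrightarrow> F_list h I = F_list h' I"
  unfolding F_list_def
  by (cases "finite I") (auto intro!: map_cong)

lemma mset_F_list: "finite I \<Longrightarrow> mset (F_list h I) = image_mset (\<lambda>i. h (Fv i)) (mset_set I)"
  unfolding F_list_def by (metis mset_map mset_sorted_list_of_multiset sorted_list_of_mset_set)

lemma mset_F_list_remove:
  "finite I \<Longrightarrow> i \<in> I \<Longrightarrow> mset (F_list h I) = mset (h (Fv i) # F_list h (I - {i}))"
  by (simp add: mset_F_list mset_set.remove)

locale quad_space = sym_form s B + finite_dimensional_vector_space s Basis
  for s :: "'k::field \<Rightarrow> 'v::ab_group_add \<Rightarrow> 'v" and B :: "'v \<Rightarrow> 'v \<Rightarrow> 'k" and Basis +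
  assumes two_neq_0: "(2::'k) \<noteq> 0"
    and nondegenerate: "(\<And>w. B u w = 0) \<Longrightarrow> u = 0"
begin

text \<open>The value \<open>\<gamma> = 0\<close> stands for even dimension: then the vector at \<open>Gv\<close> is \<open>0\<close>.\<close>

definition hyperbolic :: "nat set \<Rightarrow> 'k \<Rightarrow> (hyp_index \<Rightarrow> 'v) \<Rightarrow> bool" where
  "hyperbolic I \<gamma> h \<longleftrightarrow>
     (\<forall>i\<in>I. \<forall>j\<in>I. B (h (Ev i)) (h (Ev j)) = 0 \<and> B (h (Fv i)) (h (Fv j)) = 0 \<and>
        B (h (Ev i)) (h (Fv j)) = (if i = j then 1 else 0)) \<and>
     (\<forall>i\<in>I. B (h (Ev i)) (h Gv) = 0 \<and> B (h (Fv i)) (h Gv) = 0) \<and>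
     B (h Gv) (h Gv) = \<gamma> \<and> (\<gamma> = 0 \<longrightarrow> h Gv = 0)"

definition hspan :: "nat set \<Rightarrow> (hyp_index \<Rightarrow> 'v) \<Rightarrow> 'v set" where
  "hspan I h = span (h ` hix I)"

text \<open>For a hyperbolic system this is the orthogonal complement of the Lagrangian span of the
  e_i inside \<open>hspan I h\<close>. A wedge of the e_i pairs to 0 with any list that has an entry
  here.\<close>

definition EG_span :: "nat set \<Rightarrow> (hyp_index \<Rightarrow> 'v) \<Rightarrow> 'v set" where
  "EG_span I h = span (h ` (Ev ` I \<union> {Gv}))"

lemma hypD:
  assumes "hyperbolic I \<gamma> h" "i \<in> I" "j \<in> I"
  shows "B (h (Ev i)) (h (Ev j)) = 0" "B (h (Fv i)) (h (Fv j)) = 0"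
    "B (h (Ev i)) (h (Fv j)) = (if i = j then 1 else 0)"
    "B (h (Fv i)) (h (Ev j)) = (if i = j then 1 else 0)"
  using assms by (simp_all add: hyperbolic_def B_sym[of "h (Fv i)" "h (Ev j)"])

lemma hypD_G:
  assumes "hyperbolic I \<gamma> h"
  shows "i \<in> I \<Longrightarrow> B (h (Ev i)) (h Gv) = 0" "i \<in> I \<Longrightarrow> B (h (Fv i)) (h Gv) = 0"
    "i \<in> I \<Longrightarrow> B (h Gv) (h (Ev i)) = 0" "i \<in> I \<Longrightarrow> B (h Gv) (h (Fv i)) = 0"
    "B (h Gv) (h Gv) = \<gamma>"
  using assms by (simp_all add: hyperbolic_def B_sym[of "h Gv" "h (Ev i)"] B_sym[of "h Gv" "h (Fv i)"])

lemma hyp_G_eq_0: "hyperbolic I 0 h \<Longrightarrow> h Gv = 0"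
  by (simp add: hyperbolic_def)

lemma hyp_mono: "hyperbolic I \<gamma> h \<Longrightarrow> J \<subseteq> I \<Longrightarrow> hyperbolic J \<gamma> h"
  unfolding hyperbolic_def by blast

lemma hspan_mono: "I \<subseteq> J \<Longrightarrow> hspan I h \<subseteq> hspan J h"
  unfolding hspan_def by (intro span_mono image_mono hix_mono)

lemma hspan_cong: "(\<And>a. a \<in> hix I \<Longrightarrow> h a = h' a) \<Longrightarrow> hspan I h = hspan I h'"
  unfolding hspan_def by (metis image_cong)

lemma mem_hspan: "i \<in> I \<Longrightarrow> h (Ev i) \<in> hspan I h" "i \<in> I \<Longrightarrow> h (Fv i) \<in> hspan I h" "h Gv \<in> hspan I h"
  unfolding hspan_def hix_def by (auto intro: span_base)

lemma mem_EG_span: "i \<in> I \<Longrightarrow> h (Ev i) \<in> EG_span I h" "h Gv \<in> EG_span I h"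
  unfolding EG_span_def by (auto intro: span_base)

lemma subspace_hspan: "subspace (hspan I h)" and subspace_EG_span: "subspace (EG_span I h)"
  unfolding hspan_def EG_span_def by (rule subspace_span)+

lemmas hspan_closed = subspace_add[OF subspace_hspan] subspace_diff[OF subspace_hspan]
  subspace_scale[OF subspace_hspan] subspace_0[OF subspace_hspan] subspace_neg[OF subspace_hspan]
lemmas EG_span_closed = subspace_add[OF subspace_EG_span] subspace_diff[OF subspace_EG_span]
  subspace_scale[OF subspace_EG_span] subspace_0[OF subspace_EG_span] subspace_neg[OF subspace_EG_span]

lemma hspan_subsetI: "(\<And>a. a \<in> hix I \<Longrightarrow> h a \<in> hspan J h') \<Longrightarrow> hspan I h \<subseteq> hspan J h'"
  unfolding hspan_def by (rule span_minimal) (auto simp: subspace_span)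

lemma hix_cases:
  assumes "a \<in> hix I"
  obtains i where "i \<in> I" "a = Ev i" | i where "i \<in> I" "a = Fv i" | "a = Gv"
  using assms by (auto simp: hix_def)

text \<open>
  Coordinates with respect to \<open>h\<close> are transported to the system \<open>b\<close> of a possibly different space;
  for \<open>b = h\<close> this is the orthogonal projection. For \<open>\<gamma> = 0\<close> the last summand is \<open>0\<close> because \<open>x / 0 = 0\<close>.
\<close>

definition hproj :: "nat set \<Rightarrow> 'k \<Rightarrow> (hyp_index \<Rightarrow> 'v) \<Rightarrow> (hyp_index \<Rightarrow> 'w::ab_group_add)
    \<Rightarrow> ('k \<Rightarrow> 'w \<Rightarrow> 'w) \<Rightarrow> 'v \<Rightarrow> 'w" where
  "hproj I \<gamma> h b t x = (\<Sum>i\<in>I. t (B x (h (Fv i))) (b (Ev i)) + t (B x (h (Ev i))) (b (Fv i)))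
     + t (B x (h Gv) / \<gamma>) (b Gv)"

lemma hproj_add:
  "vector_space t \<Longrightarrow> hproj I \<gamma> h b t (x + y) = hproj I \<gamma> h b t x + hproj I \<gamma> h b t y"
  unfolding hproj_def
  by (simp add: B_simps vector_space.vector_space_assms(2) sum.distrib add_divide_distrib algebra_simps)

lemma hproj_scale:
  assumes "vector_space t"
  shows "hproj I \<gamma> h b t (s c x) = t c (hproj I \<gamma> h b t x)"
proof -
  interpret W: vector_space t by fact
  show ?thesis unfolding hproj_def
    by (simp add: B_simps W.scale_right_distrib W.scale_sum_right)
qed

lemma hproj_basis:
  assumes "hyperbolic I \<gamma> h" "finite I" "vector_space t" "\<gamma> = 0 \<Longrightarrow> b Gv = 0" "a \<in> hix I"
  shows "hproj I \<gamma> h b t (h a) = b a"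
proof -
  interpret W: vector_space t by fact
  show ?thesis using assms(5)
  proof (cases rule: hix_cases)
    case (1 i)
    then have "(\<Sum>j\<in>I. t (B (h (Ev i)) (h (Fv j))) (b (Ev j)) + t (B (h (Ev i)) (h (Ev j))) (b (Fv j))) =
      (\<Sum>j\<in>I. if i = j then b (Ev j) else 0)"
      using hypD[OF assms(1)] by (intro sum.cong) auto
    with 1 show ?thesis using assms(2) hypD_G[OF assms(1)] by (simp add: hproj_def)
  next
    case (2 i)
    then have "(\<Sum>j\<in>I. t (B (h (Fv i)) (h (Fv j))) (b (Ev j)) + t (B (h (Fv i)) (h (Ev j))) (b (Fv j))) =
      (\<Sum>j\<in>I. if i = j then b (Fv j) else 0)"
      using hypD[OF assms(1)] by (intro sum.cong) auto
    with 2 show ?thesis using assms(2) hypD_G[OF assms(1)] by (simp add: hproj_def)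
  next
    case 3
    then show ?thesis using assms hypD_G[OF assms(1)] by (auto simp: hproj_def)
  qed
qed

lemma hproj_id:
  assumes "hyperbolic I \<gamma> h" "finite I" "x \<in> hspan I h"
  shows "hproj I \<gamma> h h s x = x"
  using assms(3) unfolding hspan_def
proof (induction rule: span_induct)
  case base
  show ?case
  proof (rule subspaceI)
    show "0 \<in> {x. hproj I \<gamma> h h s x = x}" by (simp add: hproj_def)
  qed (auto simp: hproj_add[OF vector_space_axioms] hproj_scale[OF vector_space_axioms])
next
  case (step x)
  then show ?case
    using hproj_basis[OF assms(1,2) vector_space_axioms] hyp_G_eq_0 assms(1) by blast
qed

lemma B_hproj:
  assumes "hyperbolic I \<gamma> h" "finite I" "y \<in> hspan I h"
  shows "B (hproj I \<gamma> h h s x) y = B x y"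
proof -
  have "B (hproj I \<gamma> h h s x) y = B x (hproj I \<gamma> h h s y)"
    unfolding hproj_def by (simp add: B_simps B_sym[of y] mult.commute sum.distrib add.commute)
  then show ?thesis using hproj_id[OF assms] by simp
qed

lemma hproj_in_hspan: "hproj I \<gamma> h h s x \<in> hspan I h"
  unfolding hproj_def by (intro hspan_closed subspace_sum[OF subspace_hspan] mem_hspan)

lemma riesz_hspan:
  assumes "hyperbolic I \<gamma> h" "finite I" "Vector_Spaces.linear s (*) \<phi>"
  obtains r where "r \<in> hspan I h" "\<And>x. x \<in> hspan I h \<Longrightarrow> B r x = \<phi> x"
proof
  interpret L: Vector_Spaces.linear s "(*)" \<phi> by fact
  \<comment> \<open>The expansion of \<open>\<phi>\<close> in the dual basis: e_i and f_i exchange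
    their coefficients, that of g is divided by its norm.\<close>
  let ?r = "(\<Sum>i\<in>I. s (\<phi> (h (Fv i))) (h (Ev i)) + s (\<phi> (h (Ev i))) (h (Fv i))) + s (\<phi> (h Gv) / \<gamma>) (h Gv)"
  show "?r \<in> hspan I h" by (intro hspan_closed subspace_sum[OF subspace_hspan] mem_hspan)
  fix x assume "x \<in> hspan I h"
  then have "\<phi> x = \<phi> (hproj I \<gamma> h h s x)" by (simp add: hproj_id[OF assms(1,2)])
  also have "\<dots> = B ?r x"
    unfolding hproj_def by (simp add: L.add L.sum L.scale B_simps B_sym[of x] mult.commute add.commute)
  finally show "B ?r x = \<phi> x" by simp
qed

section \<open>Dual bases and dimension\<close>

lemma dual_independent:
  assumes "finite J" "\<And>i j. i \<in> J \<Longrightarrow> j \<in> J \<Longrightarrow> B (b i) (d j) = (if i = j then 1 else 0)"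
  shows "inj_on b J" "independent (b ` J)"
proof -
  show inj: "inj_on b J"
  proof (rule inj_onI)
    fix i j assume ij: "i \<in> J" "j \<in> J" "b i = b j"
    show "i = j"
    proof (rule ccontr)
      assume "i \<noteq> j"
      then have "B (b i) (d j) = 0" "B (b j) (d j) = 1" using ij(1,2) assms(2) by simp_all
      with ij(3) show False by simp
    qed
  qed
  show "independent (b ` J)"
    unfolding dependent_finite[OF finite_imageI[OF assms(1)]]
  proof (rule notI, elim exE conjE bexE)
    fix u v assume v: "v \<in> b ` J" "u v \<noteq> 0" and z: "(\<Sum>v\<in>b ` J. s (u v) v) = 0"
    then obtain j where j: "j \<in> J" "v = b j" by auto
    have "0 = B (\<Sum>v\<in>b ` J. s (u v) v) (d j)" using z by simp
    also have "\<dots> = (\<Sum>i\<in>J. u (b i) * B (b i) (d j))"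
      by (simp add: B_simps sum.reindex[OF inj])
    also have "\<dots> = (\<Sum>i\<in>J. if i = j then u (b i) else 0)"
      using assms(2) j by (intro sum.cong) auto
    also have "\<dots> = u v" using assms(1) j by simp
    finally show False using v by simp
  qed
qed

text \<open>The indices of an actual basis: in contrast to \<open>hix\<close>, \<open>Gv\<close> is
  left out when its vector is 0, so that cardinality counts dimension.\<close>

definition hixg :: "nat set \<Rightarrow> 'k \<Rightarrow> hyp_index set" where
  "hixg I \<gamma> = Ev ` I \<union> Fv ` I \<union> (if \<gamma> = 0 then {} else {Gv})"

definition hdual :: "'k \<Rightarrow> (hyp_index \<Rightarrow> 'v) \<Rightarrow> hyp_index \<Rightarrow> 'v" where
  "hdual \<gamma> h a = (case a of Ev i \<Rightarrow> h (Fv i) | Fv i \<Rightarrow> h (Ev i) | Gv \<Rightarrow> s (1 / \<gamma>) (h Gv))"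

lemma B_hdual:
  "hyperbolic I \<gamma> h \<Longrightarrow> a \<in> hixg I \<gamma> \<Longrightarrow> b \<in> hixg I \<gamma> \<Longrightarrow> B (h a) (hdual \<gamma> h b) = (if a = b then 1 else 0)"
  by (auto simp: hixg_def hdual_def hypD hypD_G B_simps split: if_splits)

lemma finite_hixg: "finite I \<Longrightarrow> finite (hixg I \<gamma>)"
  by (simp add: hixg_def)

lemma card_hixg: "finite I \<Longrightarrow> card (hixg I \<gamma>) = 2 * card I + (if \<gamma> = 0 then 0 else 1)"
proof -
  assume I: "finite I"
  have "card (Ev ` I \<union> Fv ` I) = card (Ev ` I) + card (Fv ` I)"
    by (rule card_Un_disjoint) (use I in auto)
  also have "\<dots> = 2 * card I" by (simp add: card_image inj_on_def)
  finally have c: "card (Ev ` I \<union> Fv ` I) = 2 * card I" .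
  have "card (insert Gv (Ev ` I \<union> Fv ` I)) = Suc (card (Ev ` I \<union> Fv ` I))"
    by (rule card_insert_disjoint) (use I in auto)
  with c show ?thesis by (auto simp: hixg_def)
qed

lemma hspan_hixg: "hyperbolic I \<gamma> h \<Longrightarrow> hspan I h = span (h ` hixg I \<gamma>)"
  unfolding hspan_def hix_def hixg_def
  using hyp_G_eq_0[of I h] by (auto simp: span_insert_0)

lemma dim_hspan:
  assumes "hyperbolic I \<gamma> h" "finite I"
  shows "dim (hspan I h) = 2 * card I + (if \<gamma> = 0 then 0 else 1)"
proof -
  note d = dual_independent[OF finite_hixg[OF assms(2)] B_hdual[OF assms(1)]]
  have "dim (hspan I h) = card (h ` hixg I \<gamma>)"
    unfolding hspan_hixg[OF assms(1)] by (rule dim_span_eq_card_independent) (rule d(2))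
  also have "\<dots> = card (hixg I \<gamma>)" by (rule card_image) (rule d(1))
  finally show ?thesis using card_hixg[OF assms(2)] by simp
qed

lemma hspan_eq:
  assumes "hyperbolic I \<gamma> h" "hyperbolic I \<gamma> h'" "finite I" "hspan I h' \<subseteq> hspan I h"
  shows "hspan I h' = hspan I h"
  using subspace_dim_equal[OF subspace_hspan subspace_hspan assms(4)] dim_hspan[OF assms(1,3)] dim_hspan[OF assms(2,3)]
  by simp

text \<open>On the span of the system, \<open>\<beta>\<close> is the pairing with an element of the isotropic Grassmann cone.\<close>

definition pure :: "nat set \<Rightarrow> (hyp_index \<Rightarrow> 'v) \<Rightarrow> ('v list \<Rightarrow> 'k) \<Rightarrow> bool" where
  "pure K h \<beta> \<longleftrightarrow> (\<exists>l. length l = card K \<and> set l \<subseteq> hspan K h \<and> isotropic B (set l) \<and>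
     (\<forall>y. length y = card K \<longrightarrow> set y \<subseteq> hspan K h \<longrightarrow> \<beta> y = gram B l y))"

lemma pure_cong:
  assumes "(\<And>a. a \<in> hix K \<Longrightarrow> h a = h' a)"
  shows "pure K h \<beta> = pure K h' \<beta>"
proof -
  have "hspan K h = hspan K h'" by (rule hspan_cong) (rule assms)
  then show ?thesis by (simp only: pure_def)
qed

section \<open>Frames of pure forms\<close>

text \<open>A generalized cross product: contracting the wedge of \<open>l\<close> with all but one
  argument leaves a vector of the span of \<open>l\<close>, whose coefficients are the signed minors
  of the Laplace expansion.\<close>

lemma gram_represent:
  assumes "length l = Suc (length ys)"
  obtains u where "u \<in> span (set l)" "\<And>x. gram B l (x # ys) = B u x"
proof
  let ?u = "\<Sum>i<Suc (length ys). s ((-1) ^ i * gram B (take i l @ drop (Suc i) l) ys) (l ! i)"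
  show "?u \<in> span (set l)"
    using assms by (intro span_sum span_scale span_base) auto
  show "gram B l (x # ys) = B ?u x" for x
    unfolding gram_Cons_right[OF refl assms] by (simp add: B_simps mult.commute)
qed

lemma F_list_front_neq_0:
  assumes "alt_form s (card K) \<beta>" "finite K" "\<beta> (F_list h K) \<noteq> 0" "i \<in> K"
  shows "\<beta> (h (Fv i) # F_list h (K - {i})) \<noteq> 0"
  using alt_form_perm_eq_0[OF assms(1) _ mset_F_list_remove[OF assms(2,4)]] assms(3) by auto

text \<open>
  By Cramer's rule the \<open>u i\<close> form the basis of the isotropic subspace of \<open>\<beta>\<close> that is dual to the \<open>f\<^sub>i\<close>.
\<close>

lemma pure_frame:
  assumes h: "hyperbolic K \<gamma> h" and fin: "finite K" and alt: "alt_form s (card K) \<beta>"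
    and pu: "pure K h \<beta>" and nz: "\<beta> (F_list h K) \<noteq> 0"
  obtains u where "\<And>i. i \<in> K \<Longrightarrow> u i \<in> hspan K h"
    "\<And>i x. i \<in> K \<Longrightarrow> x \<in> hspan K h \<Longrightarrow>
       \<beta> (x # F_list h (K - {i})) = \<beta> (h (Fv i) # F_list h (K - {i})) * B (u i) x"
    "\<And>i j. i \<in> K \<Longrightarrow> j \<in> K \<Longrightarrow> B (u i) (u j) = 0"
    "\<And>x S. x \<in> hspan K h \<Longrightarrow> (\<And>i. i \<in> K \<Longrightarrow> B (u i) x = 0) \<Longrightarrow> length S = card K \<Longrightarrow>
       set S \<subseteq> hspan K h \<Longrightarrow> x \<in> set S \<Longrightarrow> \<beta> S = 0"
proof -
  obtain l where l: "length l = card K" "set l \<subseteq> hspan K h" "isotropic B (set l)"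
    "\<And>y. length y = card K \<Longrightarrow> set y \<subseteq> hspan K h \<Longrightarrow> \<beta> y = gram B l y"
    using pu unfolding pure_def by blast
  define a where "a i = \<beta> (h (Fv i) # F_list h (K - {i}))" for i
  have a: "a i \<noteq> 0" if "i \<in> K" for i
    unfolding a_def by (rule F_list_front_neq_0[OF alt fin nz that])
  have ck: "Suc (card (K - {i})) = card K" if "i \<in> K" for i
    using that fin by (metis card.remove)
  have eq: "\<beta> (x # F_list h (K - {i})) = gram B l (x # F_list h (K - {i}))" if "i \<in> K" "x \<in> hspan K h" for i x
    using that fin ck by (intro l(4)) (auto simp: mem_hspan)
  have "\<exists>u. u \<in> span (set l) \<and> (\<forall>x. gram B l (x # F_list h (K - {i})) = a i * B u x)" if i: "i \<in> K" for i
  proof -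
    obtain u where u: "u \<in> span (set l)" "\<And>x. gram B l (x # F_list h (K - {i})) = B u x"
      using gram_represent[of l "F_list h (K - {i})"] l(1) ck[OF i] by auto
    then show ?thesis
      using a[OF i] by (intro exI[of _ "s (1 / a i) u"]) (auto simp: B_simps span_scale)
  qed
  then obtain u where u: "\<And>i. i \<in> K \<Longrightarrow> u i \<in> span (set l)"
    "\<And>i x. i \<in> K \<Longrightarrow> gram B l (x # F_list h (K - {i})) = a i * B (u i) x" by metis
  have uU: "u i \<in> hspan K h" if "i \<in> K" for i
    using u(1)[OF that] span_minimal[OF l(2) subspace_hspan] by auto
  have ux: "\<beta> (x # F_list h (K - {i})) = a i * B (u i) x" if "i \<in> K" "x \<in> hspan K h" for i x
    using eq[OF that] u(2)[OF that(1)] by simp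
  have uF: "B (u i) (h (Fv j)) = (if i = j then 1 else 0)" if "i \<in> K" "j \<in> K" for i j
  proof (cases "i = j")
    case True
    then show ?thesis using ux[OF that(1) mem_hspan(2)[OF that(2)]] a[OF that(1)] by (simp add: a_def)
  next
    case False
    have "\<beta> (h (Fv j) # F_list h (K - {i})) = 0"
      using that False fin ck by (intro alt_form_not_distinct[OF alt]) auto
    then show ?thesis using ux[OF that(1) mem_hspan(2)[OF that(2)]] a[OF that(1)] False by simp
  qed
  note d = dual_independent[of K u "\<lambda>i. h (Fv i)", OF fin uF]
  \<comment> \<open>Needed for the last claim: a vector orthogonal to all \<open>u i\<close> is then
    orthogonal to all of \<open>l\<close>, and the Gram matrix gets a zero column.\<close>
  have "span (u ` K) = span (set l)"
  proof (rule subspace_dim_equal[OF subspace_span subspace_span])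
    show "span (u ` K) \<subseteq> span (set l)"
      using u(1) by (intro span_minimal) (auto simp: subspace_span)
    have "dim (span (set l)) \<le> card (set l)" by (simp add: dim_le_card')
    also have "\<dots> \<le> card K" using l(1) card_length[of l] by simp
    also have "\<dots> = card (u ` K)" by (rule card_image[symmetric]) (rule d(1))
    also have "\<dots> = dim (span (u ` K))"
      by (rule dim_span_eq_card_independent[symmetric]) (rule d(2))
    finally show "dim (span (u ` K)) \<ge> dim (span (set l))" .
  qed
  then have lu: "v \<in> span (u ` K)" if "v \<in> set l" for v
    using that by (simp add: span_base)
  show ?thesis
  proof
    show "u i \<in> hspan K h" if "i \<in> K" for i by (rule uU[OF that])
    show "\<beta> (x # F_list h (K - {i})) = \<beta> (h (Fv i) # F_list h (K - {i})) * B (u i) x"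
      if "i \<in> K" "x \<in> hspan K h" for i x using ux[OF that] by (simp add: a_def)
    show "B (u i) (u j) = 0" if "i \<in> K" "j \<in> K" for i j
      using isotropic_span[OF l(3)] u(1) that by (simp add: isotropic_def)
    show "\<beta> S = 0" if "x \<in> hspan K h" "\<And>i. i \<in> K \<Longrightarrow> B (u i) x = 0" "length S = card K"
       "set S \<subseteq> hspan K h" "x \<in> set S" for x S
    proof -
      have "B v x = 0" if "v \<in> set l" for v
        using lu[OF that] by (rule B_span_eq_0) (use \<open>\<And>i. i \<in> K \<Longrightarrow> B (u i) x = 0\<close> in auto)
      then have "gram B l S = 0"
        using that l(1) by (intro gram_eq_0_col[of x]) auto
      then show ?thesis using l(4) that by simp
    qed
  qed
qed

section \<open>Forms with pure contractions\<close>

lemma alt_head: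
  assumes "alt_form s n \<phi>" "Suc (length ys) = n"
  shows "\<phi> ((u + v) # ys) = \<phi> (u # ys) + \<phi> (v # ys)" "\<phi> (s c u # ys) = c * \<phi> (u # ys)"
    "\<phi> ((u - v) # ys) = \<phi> (u # ys) - \<phi> (v # ys)" "\<phi> (0 # ys) = 0"
proof -
  have a: "\<phi> ((u + v) # ys) = \<phi> (u # ys) + \<phi> (v # ys)" for u v
    using alt_form_add[OF assms(1), of "[]" ys u v] assms(2) by simp
  then show "\<phi> ((u + v) # ys) = \<phi> (u # ys) + \<phi> (v # ys)" .
  show "\<phi> (s c u # ys) = c * \<phi> (u # ys)"
    using alt_form_scale[OF assms(1), of "[]" ys c u] assms(2) by simp
  show "\<phi> ((u - v) # ys) = \<phi> (u # ys) - \<phi> (v # ys)"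
    using a[of "u - v" v] by simp
  show "\<phi> (0 # ys) = 0" using alt_form_zero[OF assms(1), of "[]" ys] assms(2) by simp
qed

lemma alt_snd:
  assumes "alt_form s n \<phi>" "Suc (Suc (length ys)) = n"
  shows "\<phi> (x # (u + v) # ys) = \<phi> (x # u # ys) + \<phi> (x # v # ys)"
    "\<phi> (x # s c u # ys) = c * \<phi> (x # u # ys)"
    "\<phi> (x # (u - v) # ys) = \<phi> (x # u # ys) - \<phi> (x # v # ys)"
    "\<phi> (x # y # ys) = - \<phi> (y # x # ys)" "\<phi> (x # x # ys) = 0"
proof -
  have "alt_form s (Suc (length ys)) (\<lambda>zs. \<phi> (x # zs))"
    using assms by (intro alt_form_Cons) simp
  note h = alt_head[OF this refl]
  show "\<phi> (x # (u + v) # ys) = \<phi> (x # u # ys) + \<phi> (x # v # ys)" by (rule h(1))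
  show "\<phi> (x # s c u # ys) = c * \<phi> (x # u # ys)" by (rule h(2))
  show "\<phi> (x # (u - v) # ys) = \<phi> (x # u # ys) - \<phi> (x # v # ys)" by (rule h(3))
  show "\<phi> (x # y # ys) = - \<phi> (y # x # ys)"
    using alt_form_swap_adj[OF assms(1), of "[]" ys x y] assms(2) by simp
  show "\<phi> (x # x # ys) = 0" using assms by (intro alt_form_not_distinct[OF assms(1)]) auto
qed

lemma alt_map_front:
  assumes "alt_form s n \<phi>" "a \<in> set is" "length is = n" "\<phi> (h a # map h (remove1 a is)) = 0"
  shows "\<phi> (map h is) = 0"
proof (rule alt_form_perm_eq_0[OF assms(1,4)])
  have "mset is = mset (a # remove1 a is)" using assms(2) by simp
  then have "mset (map h is) = mset (map h (a # remove1 a is))" unfolding mset_map by simp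
  then show "mset (map h is) = mset (h a # map h (remove1 a is))" by simp
qed (use assms in simp)

lemma alt_map_front2:
  fixes "is" :: "hyp_index list"
  assumes "alt_form s n \<phi>" "a \<in> set is" "b \<in> set is" "a \<noteq> b" "length is = n"
    "\<phi> (h a # h b # map h (remove1 b (remove1 a is))) = 0"
  shows "\<phi> (map h is) = 0"
proof (rule alt_form_perm_eq_0[OF assms(1,6)])
  have m: "mset xs = mset (c # remove1 c xs)" if "c \<in> set xs" for c and xs :: "hyp_index list"
    using that by simp
  have "mset is = mset (a # remove1 a is)" by (rule m) (rule assms(2))
  moreover have "mset (remove1 a is) = mset (b # remove1 b (remove1 a is))"
    by (rule m) (use assms(3,4) in \<open>simp add: in_set_remove1\<close>)
  ultimately have "mset is = mset (a # b # remove1 b (remove1 a is))" by simp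
  then have "mset (map h is) = mset (map h (a # b # remove1 b (remove1 a is)))" unfolding mset_map by simp
  then show "mset (map h is) = mset (h a # h b # map h (remove1 b (remove1 a is)))" by simp
qed (use assms in simp)

text \<open>Pigeonhole on the pair numbers. The absent pair serves as the free partner of a shear;
  the value of \<open>idx\<close> at \<open>Gv\<close> is arbitrary.\<close>

lemma exists_missing_index:
  assumes "finite A" "card A < card I"
  shows "\<exists>j\<in>I. Ev j \<notin> A \<and> Fv j \<notin> A"
proof (rule ccontr)
  define idx where "idx a = (case a of Ev i \<Rightarrow> i | Fv i \<Rightarrow> i | Gv \<Rightarrow> 0)" for a
  assume "\<not> ?thesis"
  then have "j \<in> idx ` A" if "j \<in> I" for j
    using that by (cases "Ev j \<in> A") (auto simp: idx_def intro: image_eqI[of _ _ "Ev j"] image_eqI[of _ _ "Fv j"])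
  then have "card I \<le> card (idx ` A)" using assms(1) by (intro card_mono) auto
  also have "\<dots> \<le> card A" by (rule card_image_le[OF assms(1)])
  finally show False using assms(2) by simp
qed

lemma set_map_subset_hspan:
  assumes "set R \<subseteq> hix I" "\<And>i. i \<in> A \<Longrightarrow> Ev i \<notin> set R \<and> Fv i \<notin> set R"
  shows "set (map h R) \<subseteq> hspan (I - A) h"
proof -
  have "set R \<subseteq> hix (I - A)"
  proof
    fix a assume a: "a \<in> set R"
    then have "a \<in> hix I" using assms(1) by blast
    then show "a \<in> hix (I - A)" using a assms(2) by (cases rule: hix_cases) (auto simp: hix_def)
  qed
  then show ?thesis unfolding hspan_def by (auto intro: span_base)
qed

lemma hspan_perp:
  assumes "hyperbolic I \<gamma> h" "k \<in> I" "x \<in> hspan (I - {k}) h"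
  shows "B (h (Ev k)) x = 0" "B (h (Fv k)) x = 0" "B x (h (Ev k)) = 0" "B x (h (Fv k)) = 0"
proof -
  show e: "B (h (Ev k)) x = 0"
    using assms(3) unfolding hspan_def
    by (rule B_span_eq_0') (use assms(2) in \<open>auto simp: hix_def hypD[OF assms(1)] hypD_G[OF assms(1)] split: if_splits\<close>)
  show f: "B (h (Fv k)) x = 0"
    using assms(3) unfolding hspan_def
    by (rule B_span_eq_0') (use assms(2) in \<open>auto simp: hix_def hypD[OF assms(1)] hypD_G[OF assms(1)] split: if_splits\<close>)
  show "B x (h (Ev k)) = 0" "B x (h (Fv k)) = 0" using e f by (simp_all add: B_sym[of x])
qed

text \<open>Vectors of \<open>hspan (I - {k}) h\<close> are orthogonal to the pair \<open>k\<close>,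
  so any system there can be completed by that pair. This carries statements about all systems over
  to contractions.\<close>

lemma hyp_extend:
  assumes h: "hyperbolic I \<gamma> h" "k \<in> I" and h': "hyperbolic (I - {k}) \<gamma> h'" "hspan (I - {k}) h' \<subseteq> hspan (I - {k}) h"
  defines "h'' \<equiv> h'(Ev k := h (Ev k), Fv k := h (Fv k))"
  shows "hyperbolic I \<gamma> h''" "hspan I h'' \<subseteq> hspan I h" "\<And>a. a \<in> hix (I - {k}) \<Longrightarrow> h'' a = h' a"
proof -
  have z: "B (h (Ev k)) (h' a) = 0" "B (h (Fv k)) (h' a) = 0" "B (h' a) (h (Ev k)) = 0"
    "B (h' a) (h (Fv k)) = 0" if "a \<in> hix (I - {k})" for a
  proof -
    have "h' a \<in> hspan (I - {k}) h" using h'(2) that by (auto simp: hspan_def intro: span_base)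
    from hspan_perp[OF h this] show "B (h (Ev k)) (h' a) = 0" "B (h (Fv k)) (h' a) = 0"
      "B (h' a) (h (Ev k)) = 0" "B (h' a) (h (Fv k)) = 0" by auto
  qed
  have ix: "i \<in> I \<Longrightarrow> i \<noteq> k \<Longrightarrow> Ev i \<in> hix (I - {k})" "i \<in> I \<Longrightarrow> i \<noteq> k \<Longrightarrow> Fv i \<in> hix (I - {k})"
    "Gv \<in> hix (I - {k})" for i by (auto simp: hix_def)
  show "hyperbolic I \<gamma> h''"
    unfolding hyperbolic_def
  proof (intro conjI ballI)
    fix i j assume ij: "i \<in> I" "j \<in> I"
    show "B (h'' (Ev i)) (h'' (Ev j)) = 0" "B (h'' (Fv i)) (h'' (Fv j)) = 0"
      "B (h'' (Ev i)) (h'' (Fv j)) = (if i = j then 1 else 0)"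
      using ij h by (cases "i = k"; cases "j = k"; simp add: h''_def z ix hypD[OF h(1)] hypD[OF h'(1)])+
  next
    fix i assume "i \<in> I"
    then show "B (h'' (Ev i)) (h'' Gv) = 0" "B (h'' (Fv i)) (h'' Gv) = 0"
      by (cases "i = k"; simp add: h''_def z ix hypD_G[OF h'(1)])+
  next
    show "B (h'' Gv) (h'' Gv) = \<gamma>" "\<gamma> = 0 \<longrightarrow> h'' Gv = 0"
      using hypD_G[OF h'(1)] h'(1) by (auto simp: h''_def hyperbolic_def)
  qed
  show c: "h'' a = h' a" if "a \<in> hix (I - {k})" for a
    using that by (auto simp: h''_def hix_def)
  show "hspan I h'' \<subseteq> hspan I h"
  proof (rule hspan_subsetI)
    fix a assume a: "a \<in> hix I"
    show "h'' a \<in> hspan I h"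
    proof (cases "a \<in> hix (I - {k})")
      case True
      then have "h'' a \<in> hspan (I - {k}) h'" unfolding c[OF True] hspan_def by (auto intro: span_base)
      then show ?thesis using h'(2) hspan_mono[of "I - {k}" I h] by auto
    next
      case False
      with a have "a = Ev k \<or> a = Fv k" by (auto simp: hix_def)
      then show ?thesis using h(2) by (auto simp: h''_def mem_hspan)
    qed
  qed
qed

section \<open>Isometric changes of a hyperbolic system\<close>

text \<open>The image of \<open>h\<close> under the reflection in e_i - f_i.\<close>

definition flip :: "(hyp_index \<Rightarrow> 'v) \<Rightarrow> nat \<Rightarrow> hyp_index \<Rightarrow> 'v" where
  "flip h i = h(Ev i := h (Fv i), Fv i := h (Ev i))"

text \<open>A unipotent isometry attached to the isotropic plane of e_i and e_j. The correction of
  f_j keeps it orthogonal to the new f_i.\<close>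

definition shear_EF :: "(hyp_index \<Rightarrow> 'v) \<Rightarrow> nat \<Rightarrow> nat \<Rightarrow> 'k \<Rightarrow> hyp_index \<Rightarrow> 'v" where
  "shear_EF h i j t = h(Fv i := h (Fv i) + s t (h (Ev j)), Fv j := h (Fv j) - s t (h (Ev i)))"

text \<open>An elementary matrix on the f's together with the contragredient one on the e's.\<close>

definition shear_FF :: "(hyp_index \<Rightarrow> 'v) \<Rightarrow> nat \<Rightarrow> nat \<Rightarrow> hyp_index \<Rightarrow> 'v" where
  "shear_FF h i j = h(Fv i := h (Fv i) + h (Fv j), Ev j := h (Ev j) - h (Ev i))"

text \<open>A unipotent isometry attached to e_i and g: the quadratic term keeps f_i isotropic, the
  correction of g keeps it orthogonal to the new f_i.\<close>

definition shear_G :: "'k \<Rightarrow> (hyp_index \<Rightarrow> 'v) \<Rightarrow> nat \<Rightarrow> 'k \<Rightarrow> hyp_index \<Rightarrow> 'v" where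
  "shear_G \<gamma> h i t = h(Fv i := h (Fv i) + (s t (h Gv) - s (\<gamma> / 2 * t\<^sup>2) (h (Ev i))),
     Gv := h Gv - s (\<gamma> * t) (h (Ev i)))"

lemma hyp_flip:
  assumes h: "hyperbolic I \<gamma> h"
  shows "hyperbolic I \<gamma> (flip h i)"
  unfolding hyperbolic_def flip_def
  using hyp_G_eq_0[of I h] h by (auto simp: hypD[OF h] hypD_G[OF h])

lemma hspan_flip: "i \<in> I \<Longrightarrow> hspan I (flip h i) \<subseteq> hspan I h"
  by (rule hspan_subsetI) (auto simp: flip_def mem_hspan elim!: hix_cases)

lemma hyp_shear_EF:
  assumes h: "hyperbolic I \<gamma> h" and "i \<in> I" "j \<in> I" "i \<noteq> j"
  shows "hyperbolic I \<gamma> (shear_EF h i j t)"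
  unfolding hyperbolic_def shear_EF_def
  using hyp_G_eq_0[of I h] assms by (auto simp: hypD[OF h] hypD_G[OF h] B_simps)

lemma hspan_shear_EF: "i \<in> I \<Longrightarrow> j \<in> I \<Longrightarrow> hspan I (shear_EF h i j t) \<subseteq> hspan I h"
  by (rule hspan_subsetI) (auto simp: shear_EF_def mem_hspan intro!: hspan_closed elim!: hix_cases)

lemma hyp_shear_FF:
  assumes h: "hyperbolic I \<gamma> h" and "i \<in> I" "j \<in> I" "i \<noteq> j"
  shows "hyperbolic I \<gamma> (shear_FF h i j)"
  unfolding hyperbolic_def shear_FF_def
  using hyp_G_eq_0[of I h] assms by (auto simp: hypD[OF h] hypD_G[OF h] B_simps)

lemma hspan_shear_FF: "i \<in> I \<Longrightarrow> j \<in> I \<Longrightarrow> hspan I (shear_FF h i j) \<subseteq> hspan I h"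
  by (rule hspan_subsetI) (auto simp: shear_FF_def mem_hspan intro!: hspan_closed elim!: hix_cases)

lemma hyp_shear_G:
  assumes h: "hyperbolic I \<gamma> h" and "i \<in> I"
  shows "hyperbolic I \<gamma> (shear_G \<gamma> h i t)"
  unfolding hyperbolic_def shear_G_def
  using hyp_G_eq_0[of I h] assms two_neq_0
  by (auto simp: hypD[OF h] hypD_G[OF h] B_simps field_simps power2_eq_square)

lemma hspan_shear_G: "i \<in> I \<Longrightarrow> hspan I (shear_G \<gamma> h i t) \<subseteq> hspan I h"
  by (rule hspan_subsetI) (auto simp: shear_G_def mem_hspan intro!: hspan_closed elim!: hix_cases)

section \<open>Lagrangian frames detect zero\<close>

text \<open>Dually, the wedges of Lagrangian frames span the exterior power. Coordinates with
  exactly one vector of some pair reduce to a contraction, where the induction applies; the others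
  are reached by shears.\<close>

lemma alt_form_eq_0_if_frames:
  assumes "finite I" "hyperbolic I \<gamma> h" "alt_form s (card I) \<alpha>"
    and "\<And>h'. hyperbolic I \<gamma> h' \<Longrightarrow> hspan I h' \<subseteq> hspan I h \<Longrightarrow> \<alpha> (F_list h' I) = 0"
    and "length y = card I" "set y \<subseteq> hspan I h"
  shows "\<alpha> y = 0"
  using assms
proof (induction "card I" arbitrary: I h \<alpha> y)
  case 0
  then have "\<alpha> (F_list h I) = 0" by blast
  then show ?case using 0 by (simp add: F_list_def)
next
  case (Suc n)
  note fin = Suc.prems(1) and h = Suc.prems(2)
  have alt: "alt_form s (Suc n) \<alpha>" using Suc by simp
  have cI: "card (I - {k}) = n" if "k \<in> I" for k using that Suc.hyps(2) fin by simp
  \<comment> \<open>The contraction with f_k inherits the hypothesis on frames, since a frame of the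
    smaller system is completed by the pair \<open>k\<close>.\<close>
  have F: "\<alpha> (h' (Fv k) # S) = 0"
    if h': "hyperbolic I \<gamma> h'" "hspan I h' \<subseteq> hspan I h" and k: "k \<in> I" and S: "length S = n" "set S \<subseteq> hspan (I - {k}) h'" for h' k S
  proof (rule Suc.hyps(1)[of "I - {k}" h' "\<lambda>S. \<alpha> (h' (Fv k) # S)"])
    show "alt_form s (card (I - {k})) (\<lambda>S. \<alpha> (h' (Fv k) # S))"
      using alt cI[OF k] by (simp add: alt_form_Cons)
    fix h1 assume h1: "hyperbolic (I - {k}) \<gamma> h1" "hspan (I - {k}) h1 \<subseteq> hspan (I - {k}) h'"
    note e = hyp_extend[OF h'(1) k h1]
    let ?h2 = "h1(Ev k := h' (Ev k), Fv k := h' (Fv k))"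
    have "\<alpha> (F_list ?h2 I) = 0" using e(1,2) h'(2) by (intro Suc.prems(4)) auto
    then have "\<alpha> (?h2 (Fv k) # F_list ?h2 (I - {k})) = 0"
      by (rule alt_form_perm_eq_0[OF alt _ mset_F_list_remove[OF fin k, symmetric]]) (simp add: Suc.hyps(2)[symmetric] k)
    moreover have "F_list ?h2 (I - {k}) = F_list h1 (I - {k})" by (rule F_list_cong) auto
    ultimately show "\<alpha> (h' (Fv k) # F_list h1 (I - {k})) = 0" by simp
  qed (use that cI fin hyp_mono[OF h'(1), of "I - {k}"] in auto)
  \<comment> \<open>By \<open>flip\<close>, e_k plays the role of f_k in another system with the
    same remaining span.\<close>
  have E: "\<alpha> (h (Ev k) # S) = 0" if k: "k \<in> I" and S: "length S = n" "set S \<subseteq> hspan (I - {k}) h" for k S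
  proof -
    have "hspan (I - {k}) (flip h k) = hspan (I - {k}) h"
      by (rule hspan_cong) (auto simp: flip_def hix_def)
    then show ?thesis
      using F[OF hyp_flip[OF h] hspan_flip[OF k] k S(1)] S(2) by (simp add: flip_def)
  qed
  show ?case
  proof (rule alt_form_eq_0_on_span[where b = h and J = "hix I", OF alt])
    fix "is" assume d: "distinct is" and sub: "set is \<subseteq> hix I" and len: "length is = Suc n"
    have inU: "set (map h R) \<subseteq> hspan (I - A) h" if "set R \<subseteq> set is" "\<And>a. a \<in> A \<Longrightarrow> Ev a \<notin> set R \<and> Fv a \<notin> set R" for A R
      using that sub by (intro set_map_subset_hspan) auto
    consider (f) i where "i \<in> I" "Fv i \<in> set is" "Ev i \<notin> set is" | (e) i where "i \<in> I" "Ev i \<in> set is" "Fv i \<notin> set is"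
      | (b) i where "i \<in> I" "Ev i \<in> set is" "Fv i \<in> set is" | (g) "set is \<subseteq> {Gv}"
      using sub by (auto simp: hix_def) blast
    then show "\<alpha> (map h is) = 0"
    proof cases
      case f
      have "\<alpha> (h (Fv i) # map h (remove1 (Fv i) is)) = 0"
        using f d len by (intro F[OF h order_refl] inU) (auto simp: length_remove1 set_remove1_eq)
      then show ?thesis by (rule alt_map_front[OF alt f(2) len])
    next
      case e
      have "\<alpha> (h (Ev i) # map h (remove1 (Ev i) is)) = 0"
        using e d len by (intro E inU) (auto simp: length_remove1 set_remove1_eq)
      then show ?thesis by (rule alt_map_front[OF alt e(2) len])
    next
      case b
      \<comment> \<open>The list has \<open>card I\<close> entries, two of them from the pair
        \<open>i\<close>, so some other pair \<open>j\<close> does not occur at all.\<close>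
      have "card (set is - {Ev i}) < card I"
        using d len Suc.hyps(2) b(2) by (simp add: distinct_card)
      then obtain j where j: "j \<in> I" "Ev j \<notin> set is - {Ev i}" "Fv j \<notin> set is - {Ev i}"
        using exists_missing_index[of "set is - {Ev i}" I] by auto
      with b have ij: "i \<noteq> j" by auto
      define R where "R = map h (remove1 (Ev i) (remove1 (Fv i) is))"
      have R: "Suc (Suc (length R)) = Suc n" "set R \<subseteq> hspan (I - {i,j}) h"
      proof -
        show "Suc (Suc (length R)) = Suc n"
          using b d len length_pos_if_in_set[OF b(2)] length_pos_if_in_set[of "Ev i" "remove1 (Fv i) is"]
          by (simp add: R_def length_remove1)
        show "set R \<subseteq> hspan (I - {i,j}) h"
          unfolding R_def using d j ij by (intro inU) (auto simp: set_remove1_eq)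
      qed
      have RU: "set R \<subseteq> hspan (I - {i}) h" "set R \<subseteq> hspan (I - {j}) h"
        using R(2) hspan_mono[of "I - {i,j}" "I - {i}" h] hspan_mono[of "I - {i,j}" "I - {j}" h] by auto
      note A = alt_head[OF alt] alt_snd(1,2,3,5)[OF alt]
      have l: "length R = n - 1" "n > 0" using R(1) by auto
      let ?e = "\<lambda>i. h (Ev i)" and ?f = "\<lambda>i. h (Fv i)"
      have z: "\<alpha> (?f i # ?e j # R) = 0" "\<alpha> (?f j # ?e i # R) = 0" "\<alpha> (?f i # ?f j # R) = 0" "\<alpha> (?e j # ?e i # R) = 0"
        using RU l b(1) j(1) ij by (auto intro!: F[OF h order_refl] E mem_hspan)
      \<comment> \<open>The first shear gives the same value on (f_j, e_j) and (f_i, e_i), the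
        second the same value on (e_j, f_j) and (f_i, e_i). So this value is its own
        negative.\<close>
      have "\<alpha> (shear_FF h i j (Fv i) # shear_FF h i j (Ev j) # R) = 0"
      proof (rule F[OF hyp_shear_FF[OF h b(1) j(1) ij] hspan_shear_FF[OF b(1) j(1)] b(1)])
        have "hspan (I - {i,j}) (shear_FF h i j) = hspan (I - {i,j}) h"
          by (rule hspan_cong) (auto simp: shear_FF_def hix_def)
        then show "set (shear_FF h i j (Ev j) # R) \<subseteq> hspan (I - {i}) (shear_FF h i j)"
          using R(2) hspan_mono[of "I - {i,j}" "I - {i}" "shear_FF h i j"] mem_hspan(1)[of j "I - {i}" "shear_FF h i j"] j(1) ij by auto
      qed (use l in simp)
      then have "\<alpha> ((?f i + ?f j) # (?e j - ?e i) # R) = 0" by (simp add: shear_FF_def)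
      then have 1: "\<alpha> (?f j # ?e j # R) = \<alpha> (?f i # ?e i # R)" using R(1) z by (simp add: A)
      have "\<alpha> (shear_EF h i j 1 (Fv i) # shear_EF h i j 1 (Fv j) # R) = 0"
      proof (rule F[OF hyp_shear_EF[OF h b(1) j(1) ij] hspan_shear_EF[OF b(1) j(1)] b(1)])
        have "hspan (I - {i,j}) (shear_EF h i j 1) = hspan (I - {i,j}) h"
          by (rule hspan_cong) (auto simp: shear_EF_def hix_def)
        then show "set (shear_EF h i j 1 (Fv j) # R) \<subseteq> hspan (I - {i}) (shear_EF h i j 1)"
          using R(2) hspan_mono[of "I - {i,j}" "I - {i}" "shear_EF h i j 1"] mem_hspan(2)[of j "I - {i}" "shear_EF h i j 1"] j(1) ij by auto
      qed (use l in simp)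
      then have "\<alpha> ((?f i + ?e j) # (?f j - ?e i) # R) = 0" using ij by (simp add: shear_EF_def)
      then have "\<alpha> (?e j # ?f j # R) = \<alpha> (?f i # ?e i # R)" using R(1) z by (simp add: A)
      moreover have "\<alpha> (?e j # ?f j # R) = - \<alpha> (?f j # ?e j # R)" by (rule alt_snd(4)[OF alt R(1)])
      ultimately have "\<alpha> (?f i # ?e i # R) = - \<alpha> (?f i # ?e i # R)" using 1 by simp
      then have "\<alpha> (?f i # ?e i # R) + \<alpha> (?f i # ?e i # R) = 0" by (rule eq_neg_iff_add_eq_0[THEN iffD1])
      then have "2 * \<alpha> (?f i # ?e i # R) = 0" by (simp only: mult_2)
      then have z2: "\<alpha> (?f i # ?e i # R) = 0" using two_neq_0 by simp
      then show ?thesis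
        using b len unfolding R_def by (intro alt_map_front2[OF alt, of "Fv i" "is" "Ev i"]) auto
    next
      case g
      \<comment> \<open>There is only one pair here, so no partner \<open>j\<close> exists; g is
        reached as a component of the f of a sheared system.\<close>
      then have "length is = 1" "is = [Gv]"
        using d len by (cases "is"; cases "tl is"; auto)+
      then have n: "n = 0" using len by simp
      then have "card I = 1" using Suc.hyps(2) by simp
      then obtain i where i: "I = {i}" by (rule card_1_singletonE)
      have "\<alpha> [shear_G \<gamma> h i 1 (Fv i)] = 0"
        by (rule F[OF hyp_shear_G[OF h] hspan_shear_G]) (use i n in auto)
      then have "\<alpha> [h (Fv i) + (h Gv - s (\<gamma> / 2) (h (Ev i)))] = 0" by (simp add: shear_G_def)
      moreover have "\<alpha> [h (Fv i)] = 0" "\<alpha> [h (Ev i)] = 0"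
        using i n by (auto intro!: F[OF h order_refl] E)
      ultimately have "\<alpha> [h Gv] = 0" using n by (simp add: alt_head[OF alt])
      then show ?thesis using \<open>is = [Gv]\<close> by simp
    qed
  qed (use Suc in \<open>auto simp: hspan_def\<close>)
qed

text \<open>The contraction with \<open>f\<^sub>k\<close> is, up to a scalar, the wedge product of the \<open>e\<^sub>j\<close> with \<open>j \<noteq> k\<close>.\<close>

definition normal :: "nat set \<Rightarrow> (hyp_index \<Rightarrow> 'v) \<Rightarrow> ('v list \<Rightarrow> 'k) \<Rightarrow> bool" where
  "normal I h \<alpha> \<longleftrightarrow> (\<forall>k\<in>I. \<forall>S x. length S = card I - 1 \<longrightarrow> set S \<subseteq> hspan (I - {k}) h \<longrightarrow> x \<in> set S \<longrightarrow>
     x \<in> EG_span (I - {k}) h \<longrightarrow> \<alpha> (h (Fv k) # S) = 0)"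

lemma normalD:
  assumes "normal I h \<alpha>" "alt_form s (card I) \<alpha>" "mset L = mset (h (Fv k) # S)" "length L = card I"
    "k \<in> I" "set S \<subseteq> hspan (I - {k}) h" "x \<in> set S" "x \<in> EG_span (I - {k}) h"
  shows "\<alpha> L = 0"
proof (rule alt_form_perm_eq_0[OF assms(2) _ assms(3,4)])
  have "length L = Suc (length S)" using assms(3) by (metis length_Cons mset_eq_length)
  then show "\<alpha> (h (Fv k) # S) = 0" using assms unfolding normal_def by auto
qed

section \<open>The normal form\<close>

text \<open>Purity is asked for all systems in the span, since the contractions have to stay pure
  after each change of basis. The span of the other pairs is a model of the quotient of the
  orthogonal complement of f_k by f_k.\<close>

definition contractions_pure :: "nat set \<Rightarrow> 'k \<Rightarrow> (hyp_index \<Rightarrow> 'v) \<Rightarrow> ('v list \<Rightarrow> 'k) \<Rightarrow> bool" where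
  "contractions_pure I \<gamma> h \<alpha> \<longleftrightarrow> (\<forall>h' k. hyperbolic I \<gamma> h' \<longrightarrow> hspan I h' \<subseteq> hspan I h \<longrightarrow> k \<in> I \<longrightarrow>
     pure (I - {k}) h' (\<lambda>S. \<alpha> (h' (Fv k) # S)))"

lemma contractions_pure_mono:
  "contractions_pure I \<gamma> h \<alpha> \<Longrightarrow> hspan I h' \<subseteq> hspan I h \<Longrightarrow> contractions_pure I \<gamma> h' \<alpha>"
  unfolding contractions_pure_def by blast

text \<open>If the form were a wedge of vectors dual to the f_i, Cramer's rule would recover them
  from the values with a single f_i replaced. The formula makes sense for every form that is nonzero
  on the frame, and nondegeneracy turns it into a vector.\<close>

lemma F_list_frame_vector:
  fixes I \<gamma> h \<alpha>
  assumes fin: "finite I" and h: "hyperbolic I \<gamma> h" and alt: "alt_form s (card I) \<alpha>" and nz: "\<alpha> (F_list h I) \<noteq> 0"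
    and i: "i \<in> I"
  obtains e where "e \<in> hspan I h"
    "\<And>x. x \<in> hspan I h \<Longrightarrow> B e x = \<alpha> (x # F_list h (I - {i})) / \<alpha> (h (Fv i) # F_list h (I - {i}))"
proof -
  let ?a = "\<alpha> (h (Fv i) # F_list h (I - {i}))"
  have "Suc (card (I - {i})) = card I" using fin i by (metis card.remove)
  then have "Vector_Spaces.linear s (*) (\<lambda>x. \<alpha> (x # F_list h (I - {i})))"
    by (intro alt_form_Cons_linear[where n = "card (I - {i})"]) (use alt in auto)
  then obtain r where r: "r \<in> hspan I h" "\<And>x. x \<in> hspan I h \<Longrightarrow> B r x = \<alpha> (x # F_list h (I - {i}))"
    using riesz_hspan[OF h fin] by blast
  show ?thesis
    by (rule that[of "s (1 / ?a) r"]) (use r in \<open>auto simp: B_simps hspan_closed\<close>)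
qed

text \<open>The new e_i are forced by the form (\<open>F_list_frame_vector\<close>). What has to be
  shown is that they span an isotropic space and fit every contraction: on
  \<open>hspan (I - {k}) h\<close>, each e_i acts like the corresponding frame vector of the pure
  contraction with f_k.\<close>

lemma normalize:
  assumes fin: "finite I" and h: "hyperbolic I \<gamma> h" and c3: "card I \<ge> 3" and alt: "alt_form s (card I) \<alpha>"
    and pu: "contractions_pure I \<gamma> h \<alpha>" and nz: "\<alpha> (F_list h I) \<noteq> 0"
  obtains h' where "hyperbolic I \<gamma> h'" "hspan I h' = hspan I h" "F_list h' I = F_list h I" "normal I h' \<alpha>"
proof -
  define a where "a i = \<alpha> (h (Fv i) # F_list h (I - {i}))" for i
  have a: "a i \<noteq> 0" if "i \<in> I" for i
    unfolding a_def by (rule F_list_front_neq_0[OF alt fin nz that])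
  have "\<exists>e. e \<in> hspan I h \<and> (\<forall>x\<in>hspan I h. B e x = \<alpha> (x # F_list h (I - {i})) / a i)" if i: "i \<in> I" for i
  proof -
    obtain e where "e \<in> hspan I h"
      "\<And>x. x \<in> hspan I h \<Longrightarrow> B e x = \<alpha> (x # F_list h (I - {i})) / \<alpha> (h (Fv i) # F_list h (I - {i}))"
      by (rule F_list_frame_vector[OF fin h alt nz i]) auto
    then show ?thesis unfolding a_def by (intro exI[of _ e]) simp
  qed
  then obtain e where eU: "\<And>i. i \<in> I \<Longrightarrow> e i \<in> hspan I h"
    and e: "\<And>i x. i \<in> I \<Longrightarrow> x \<in> hspan I h \<Longrightarrow> B (e i) x = \<alpha> (x # F_list h (I - {i})) / a i"
    by metis
  have ck: "Suc (card (I - {k})) = card I" if "k \<in> I" for k using fin that by (metis card.remove)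
  have eF: "B (e i) (h (Fv j)) = (if i = j then 1 else 0)" if "i \<in> I" "j \<in> I" for i j
  proof (cases "i = j")
    case True
    then show ?thesis using e[OF that(1) mem_hspan(2)[OF that(2)]] a[OF that(1)] by (simp add: a_def)
  next
    case False
    have "\<alpha> (h (Fv j) # F_list h (I - {i})) = 0"
      using that False fin ck by (intro alt_form_not_distinct[OF alt]) auto
    then show ?thesis using e[OF that(1) mem_hspan(2)[OF that(2)]] False by simp
  qed
  \<comment> \<open>Stated for any system with the same f_i, because it is applied to
    \<open>h\<close> to prove isotropy and to the final system to prove normality.\<close>
  have frame: "\<exists>u. (\<forall>i\<in>I - {k}. u i \<in> hspan (I - {k}) h2 \<and> (\<forall>x\<in>hspan (I - {k}) h2. B (u i) x = B (e i) x)) \<and>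
     (\<forall>i\<in>I - {k}. \<forall>j\<in>I - {k}. B (u i) (u j) = 0) \<and>
     (\<forall>x S. x \<in> hspan (I - {k}) h2 \<longrightarrow> (\<forall>i\<in>I - {k}. B (e i) x = 0) \<longrightarrow> length S = card (I - {k}) \<longrightarrow>
        set S \<subseteq> hspan (I - {k}) h2 \<longrightarrow> x \<in> set S \<longrightarrow> \<alpha> (h (Fv k) # S) = 0)"
    if h2: "hyperbolic I \<gamma> h2" "hspan I h2 \<subseteq> hspan I h" "\<And>i. i \<in> I \<Longrightarrow> h2 (Fv i) = h (Fv i)" and k: "k \<in> I" for h2 k
  proof -
    let ?K = "I - {k}" and ?\<beta> = "\<lambda>S. \<alpha> (h (Fv k) # S)"
    have finK: "finite ?K" using fin by simp
    have FlK: "F_list h2 J = F_list h J" if "J \<subseteq> I" for J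
      using h2(3) that by (intro F_list_cong) auto
    have altK: "alt_form s (card ?K) ?\<beta>"
      by (rule alt_form_Cons) (simp only: ck[OF k] alt)
    have puK: "pure ?K h2 ?\<beta>"
      using pu h2 k unfolding contractions_pure_def by metis
    have nzK: "?\<beta> (F_list h2 ?K) \<noteq> 0" using a[OF k] FlK[of ?K] by (auto simp: a_def)
    obtain u where u: "\<And>i. i \<in> ?K \<Longrightarrow> u i \<in> hspan ?K h2"
      "\<And>i x. i \<in> ?K \<Longrightarrow> x \<in> hspan ?K h2 \<Longrightarrow>
         ?\<beta> (x # F_list h2 (?K - {i})) = ?\<beta> (h2 (Fv i) # F_list h2 (?K - {i})) * B (u i) x"
      "\<And>i j. i \<in> ?K \<Longrightarrow> j \<in> ?K \<Longrightarrow> B (u i) (u j) = 0"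
      "\<And>x S. x \<in> hspan ?K h2 \<Longrightarrow> (\<And>i. i \<in> ?K \<Longrightarrow> B (u i) x = 0) \<Longrightarrow> length S = card ?K \<Longrightarrow>
         set S \<subseteq> hspan ?K h2 \<Longrightarrow> x \<in> set S \<Longrightarrow> ?\<beta> S = 0"
      by (rule pure_frame[OF hyp_mono[OF h2(1)] finK altK puK nzK]) auto
    have ue: "B (u i) x = B (e i) x" if i: "i \<in> ?K" and x: "x \<in> hspan ?K h2" for i x
    proof -
      have iI: "i \<in> I" and kn: "k \<in> I - {i}" using i k by auto
      have m: "mset (F_list h (I - {i})) = mset (h (Fv k) # F_list h (?K - {i}))"
        using mset_F_list_remove[of "I - {i}" k h] fin kn by (simp add: Diff_insert2[symmetric] insert_commute)
      obtain \<epsilon> where \<epsilon>: "\<epsilon> \<in> {1,-1}" "\<And>\<phi>. alt_form s (card (I - {i})) \<phi> \<Longrightarrow>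
          \<phi> (F_list h (I - {i})) = \<epsilon> * \<phi> (h (Fv k) # F_list h (?K - {i}))"
        using alt_form_perm[OF m length_F_list, of s] by blast
      \<comment> \<open>Moving f_k to the front turns the formula for \<open>e i\<close> into the
        one for \<open>u i\<close>; the same sign occurs in numerator and denominator.\<close>
      have \<epsilon>': "\<alpha> (y # F_list h (I - {i})) = - \<epsilon> * ?\<beta> (y # F_list h (?K - {i}))" for y
      proof -
        have "alt_form s (card (I - {i})) (\<lambda>zs. \<alpha> (y # zs))"
          by (rule alt_form_Cons) (simp only: ck[OF iI] alt)
        from \<epsilon>(2)[OF this] have "\<alpha> (y # F_list h (I - {i})) = \<epsilon> * \<alpha> (y # h (Fv k) # F_list h (?K - {i}))" .
        moreover have "Suc (Suc (length (F_list h (?K - {i})))) = card I"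
          using i finK ck[OF k] by (metis card.remove length_F_list)
        from alt_snd(4)[OF alt this] have "\<alpha> (y # h (Fv k) # F_list h (?K - {i})) = - ?\<beta> (y # F_list h (?K - {i}))" .
        ultimately show ?thesis by simp
      qed
      have xU: "x \<in> hspan I h" using x hspan_mono[of ?K I h2] h2(2) by auto
      have FK: "F_list h2 (?K - {i}) = F_list h (?K - {i})" by (rule FlK) auto
      have "?\<beta> (x # F_list h (?K - {i})) = ?\<beta> (h (Fv i) # F_list h (?K - {i})) * B (u i) x"
        using u(2)[OF i x] FK h2(3)[OF iI] by simp
      moreover have "?\<beta> (x # F_list h (?K - {i})) = ?\<beta> (h (Fv i) # F_list h (?K - {i})) * B (e i) x"
        using e[OF iI xU] a[OF iI] \<epsilon>(1) unfolding a_def \<epsilon>' by auto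
      moreover have "?\<beta> (h (Fv i) # F_list h (?K - {i})) \<noteq> 0"
        using a[OF iI] unfolding a_def \<epsilon>' by auto
      ultimately show ?thesis by simp
    qed
    show ?thesis
    proof (rule exI[of _ u], intro conjI ballI allI impI)
      fix x S assume "x \<in> hspan ?K h2" "\<forall>i\<in>?K. B (e i) x = 0" "length S = card ?K"
        "set S \<subseteq> hspan ?K h2" "x \<in> set S"
      then show "\<alpha> (h (Fv k) # S) = 0" using ue by (intro u(4)[of x]) auto
    qed (use u ue in auto)
  qed
  have iso: "B (e i) (e j) = 0" if ij: "i \<in> I" "j \<in> I" for i j
  proof -
    \<comment> \<open>Three indices are needed: the contraction with f_k sees both e_i and e_j only
      if k differs from i and j.\<close>
    have "card {i,j} < card I" using c3 by (cases "i = j") auto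
    then have "\<not> I \<subseteq> {i,j}" by (metis card_mono finite.emptyI finite.insertI not_less)
    then obtain k where k: "k \<in> I" "k \<noteq> i" "k \<noteq> j" by auto
    obtain u where u: "\<And>i. i \<in> I - {k} \<Longrightarrow> u i \<in> hspan (I - {k}) h"
      "\<And>i x. i \<in> I - {k} \<Longrightarrow> x \<in> hspan (I - {k}) h \<Longrightarrow> B (u i) x = B (e i) x"
      "\<And>i j. i \<in> I - {k} \<Longrightarrow> j \<in> I - {k} \<Longrightarrow> B (u i) (u j) = 0"
      using frame[OF h order_refl refl k(1)] by blast
    \<comment> \<open>The difference is orthogonal to the span of all other pairs and to f_k, which
      leaves a multiple of f_k. Such multiples do not disturb the products computed below.\<close>
    have d: "e l - u l = s (B (e l - u l) (h (Ev k))) (h (Fv k))"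
      if l: "l \<in> I" "l \<noteq> k" for l
    proof -
      have lK: "l \<in> I - {k}" using l by simp
      have z: "B (e l - u l) x = 0" if "x \<in> hspan (I - {k}) h" for x
        using u(2)[OF lK that] by (simp add: B_simps)
      have zF: "B (e l - u l) (h (Fv k)) = 0"
        using eF[OF l(1) k(1)] l(2) hspan_perp(4)[OF h k(1) u(1)[OF lK]] by (simp add: B_simps)
      have "e l - u l \<in> hspan I h"
        using eU[OF l(1)] u(1)[OF lK] hspan_mono[of "I - {k}" I h] by (auto intro!: hspan_closed)
      then have "e l - u l = hproj I \<gamma> h h s (e l - u l)" by (rule hproj_id[OF h fin, symmetric])
      also have "\<dots> = (\<Sum>i\<in>I. if i = k then s (B (e l - u l) (h (Ev k))) (h (Fv k)) else 0)"
        unfolding hproj_def using z[OF mem_hspan(3)] z[OF mem_hspan(1)] z[OF mem_hspan(2)] zF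
        by (simp, intro sum.cong) auto
      also have "\<dots> = s (B (e l - u l) (h (Ev k))) (h (Fv k))" using k(1) fin by simp
      finally show ?thesis .
    qed
    have K: "i \<in> I - {k}" "j \<in> I - {k}" using ij k by auto
    have "B (e i - u i) (e j - u j) = 0"
      using d[of i] d[of j] ij k hypD(2)[OF h k(1) k(1)] by (metis B_scale_left B_scale_right mult_zero_right)
    moreover have "B (u i) (e j) = 0"
      using u(2)[OF K(2) u(1)[OF K(1)]] u(3)[OF K(2) K(1)] B_sym by metis
    moreover have "B (e i) (u j) = 0" using u(2)[OF K(1) u(1)[OF K(2)]] u(3)[OF K] by simp
    ultimately show ?thesis using u(3)[OF K] by (simp add: B_simps)
  qed
  \<comment> \<open>The vector g is corrected by multiples of the f_i to become orthogonal to the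
    new e_i; its norm stays the same because the f_i are isotropic and orthogonal to g.\<close>
  define h' where "h' c = (case c of Ev i \<Rightarrow> e i | Fv i \<Rightarrow> h (Fv i)
     | Gv \<Rightarrow> h Gv - (\<Sum>i\<in>I. s (B (h Gv) (e i)) (h (Fv i))))" for c
  have h's: "h' (Ev i) = e i" "h' (Fv i) = h (Fv i)" for i by (auto simp: h'_def)
  have eG: "B (e i) (h' Gv) = 0" if "i \<in> I" for i
  proof -
    have "(\<Sum>j\<in>I. B (h Gv) (e j) * B (e i) (h (Fv j))) = (\<Sum>j\<in>I. if i = j then B (h Gv) (e i) else 0)"
      using eF[OF that] by (intro sum.cong) auto
    then show ?thesis using fin that by (simp add: h'_def B_simps B_sym[of "e i" "h Gv"])
  qed
  have hyperbolic': "hyperbolic I \<gamma> h'"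
    unfolding hyperbolic_def
  proof (intro conjI ballI impI)
    show "B (h' (Fv i)) (h' Gv) = 0" if "i \<in> I" for i
      using that by (simp add: h'_def B_simps hypD[OF h] hypD_G[OF h])
    show "B (h' Gv) (h' Gv) = \<gamma>"
      by (simp add: h'_def B_simps hypD[OF h] hypD_G[OF h])
    show "h' Gv = 0" if "\<gamma> = 0"
      using hyp_G_eq_0[of I h] h that by (simp add: h'_def)
  qed (auto simp: h's iso eF eG hypD[OF h])
  have sub: "hspan I h' \<subseteq> hspan I h"
    by (rule hspan_subsetI) (auto simp: h'_def eU mem_hspan elim!: hix_cases intro!: hspan_closed subspace_sum[OF subspace_hspan])
  show ?thesis
  proof
    show "hyperbolic I \<gamma> h'" by fact
    show "hspan I h' = hspan I h" by (rule hspan_eq[OF h hyperbolic' fin sub])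
    show "F_list h' I = F_list h I" by (rule F_list_cong) (simp add: h's)
    show "normal I h' \<alpha>"
      unfolding normal_def
    proof (intro ballI allI impI)
      fix k S x assume k: "k \<in> I" and S: "length S = card I - 1" "set S \<subseteq> hspan (I - {k}) h'" "x \<in> set S"
        and x: "x \<in> EG_span (I - {k}) h'"
      have "B (e i) x = 0" if "i \<in> I - {k}" for i
        using x unfolding EG_span_def
        by (rule B_span_eq_0') (use that eG iso in \<open>auto simp: h's\<close>)
      moreover have "length S = card (I - {k})" using S(1) ck[OF k] by simp
      moreover have "x \<in> hspan (I - {k}) h'" using S by auto
      ultimately show "\<alpha> (h' (Fv k) # S) = 0"
        using frame[OF hyperbolic' sub h's(2) k] S unfolding h's by blast
    qed
  qed
qed

text \<open>
  Any value that has to vanish for \<open>h2\<close> involves only \<open>J\<close> and two further indices, so it contains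
  an untouched \<open>f\<^sub>k\<close> and is covered by the normal form for \<open>h\<close>.
\<close>

lemma normal_move:
  assumes fin: "finite I" and h: "hyperbolic I \<gamma> h" and alt: "alt_form s (card I) \<alpha>"
    and pu: "contractions_pure I \<gamma> h \<alpha>" and no: "normal I h \<alpha>"
    and h2: "hyperbolic I \<gamma> h2" "hspan I h2 \<subseteq> hspan I h" and nz: "\<alpha> (F_list h2 I) \<noteq> 0"
    and J: "J \<subseteq> I" "i \<in> J" "card J + 3 \<le> card I"
    and c: "\<And>k. k \<in> I - J \<Longrightarrow> h2 (Fv k) = h (Fv k)"
      "\<And>k a. k \<in> I - J \<Longrightarrow> a \<in> hix (I - {k}) \<Longrightarrow> h2 a \<in> hspan (I - {k}) h"
      "\<And>k l. k \<in> I - J \<Longrightarrow> l \<in> I - {k} \<Longrightarrow> h2 (Ev l) \<in> EG_span (I - {k}) h"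
      "\<And>k. k \<in> I - J \<Longrightarrow> h2 Gv \<in> EG_span (I - {k}) h"
    and S: "length S = card I - 1" "set S \<subseteq> hspan (I - {i}) h2" "x \<in> set S" "x \<in> EG_span (I - {i}) h2"
  shows "\<alpha> (h2 (Fv i) # S) = 0"
proof -
  let ?K = "I - {i}" and ?\<beta> = "\<lambda>S. \<alpha> (h2 (Fv i) # S)"
  have i: "i \<in> I" using J by auto
  have ck: "Suc (card (A - {k})) = card A" if "k \<in> A" "A \<subseteq> I" for k A
    using fin that by (metis card.remove finite_subset)
  have altK: "alt_form s (card ?K) ?\<beta>"
    by (rule alt_form_Cons) (simp only: ck[OF i order_refl] alt)
  have finK: "finite ?K" using fin by simp
  have puK: "pure ?K h2 ?\<beta>" using pu h2 i unfolding contractions_pure_def by blast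
  have nzK: "?\<beta> (F_list h2 ?K) \<noteq> 0" by (rule F_list_front_neq_0[OF alt fin nz i])
  obtain u where u: "\<And>i. i \<in> ?K \<Longrightarrow> u i \<in> hspan ?K h2"
    "\<And>i x. i \<in> ?K \<Longrightarrow> x \<in> hspan ?K h2 \<Longrightarrow>
       ?\<beta> (x # F_list h2 (?K - {i})) = ?\<beta> (h2 (Fv i) # F_list h2 (?K - {i})) * B (u i) x"
    "\<And>i j. i \<in> ?K \<Longrightarrow> j \<in> ?K \<Longrightarrow> B (u i) (u j) = 0"
    "\<And>x S. x \<in> hspan ?K h2 \<Longrightarrow> (\<And>i. i \<in> ?K \<Longrightarrow> B (u i) x = 0) \<Longrightarrow> length S = card ?K \<Longrightarrow>
       set S \<subseteq> hspan ?K h2 \<Longrightarrow> x \<in> set S \<Longrightarrow> ?\<beta> S = 0"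
    by (rule pure_frame[OF hyp_mono[OF h2(1)] finK altK puK nzK]) auto
  have z: "B (u l) (h2 a) = 0" if l: "l \<in> ?K" and a: "a \<in> Ev ` ?K \<union> {Gv}" for l a
  proof -
    \<comment> \<open>For \<open>a = Gv\<close> any \<open>l'\<close> in \<open>I\<close> will do.
      The count below then provides an index \<open>k\<close> that neither the move nor this
      coordinate uses.\<close>
    obtain l' where l': "a = Ev l' \<or> a = Gv" "l' \<in> I" using a i by blast
    have "card (J \<union> {l,l'}) \<le> card J + card {l,l'}" by (rule card_Un_le)
    also have "card {l,l'} \<le> 2" by (simp add: card_insert_if)
    finally have "card (J \<union> {l,l'}) < card I" using J(3) by simp
    then have "\<not> I \<subseteq> J \<union> {l,l'}"
      using fin J(1) by (metis card_mono finite.emptyI finite.insertI finite_UnI finite_subset not_less)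
    then obtain k where k: "k \<in> I" "k \<notin> J" "k \<noteq> l" "k \<noteq> l'" by auto
    with J have ki: "k \<noteq> i" by auto
    have kJ: "k \<in> I - J" using k by simp
    \<comment> \<open>Up to a nonzero factor this is the product of \<open>u l\<close> and
      \<open>h2 a\<close>. The list contains the untouched f_k, and its entry \<open>h2 a\<close>
      lies in \<open>EG_span (I - {k}) h\<close>.\<close>
    have "\<alpha> (h2 (Fv i) # h2 a # F_list h2 (?K - {l})) = 0"
    proof (rule normalD[OF no alt, of _ k "h2 (Fv i) # h2 a # F_list h2 (?K - {l} - {k})" "h2 a"])
      have "mset (F_list h2 (?K - {l})) = mset (h2 (Fv k) # F_list h2 (?K - {l} - {k}))"
        by (rule mset_F_list_remove) (use finK k ki in auto)
      then show "mset (h2 (Fv i) # h2 a # F_list h2 (?K - {l})) = mset (h (Fv k) # h2 (Fv i) # h2 a # F_list h2 (?K - {l} - {k}))"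
        using c(1)[OF kJ] by simp
      show "length (h2 (Fv i) # h2 a # F_list h2 (?K - {l})) = card I"
        using ck[OF i order_refl] ck[OF l] by simp
      have "h2 ` hix (I - {k}) \<subseteq> hspan (I - {k}) h" using c(2)[OF kJ] by auto
      moreover have "set (h2 (Fv i) # h2 a # F_list h2 (?K - {l} - {k})) \<subseteq> h2 ` hix (I - {k})"
        using finK i ki k l' by (auto simp: hix_def)
      ultimately show "set (h2 (Fv i) # h2 a # F_list h2 (?K - {l} - {k})) \<subseteq> hspan (I - {k}) h" by blast
      show "h2 a \<in> EG_span (I - {k}) h" using l' k c(3)[OF kJ, of l'] c(4)[OF kJ] by auto
    qed (use k in auto)
    moreover have "?\<beta> (h2 (Fv l) # F_list h2 (?K - {l})) \<noteq> 0" by (rule F_list_front_neq_0[OF altK finK nzK l])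
    moreover have "h2 a \<in> hspan ?K h2" using a by (auto intro!: mem_hspan)
    ultimately show ?thesis using u(2)[OF l, of "h2 a"] by simp
  qed
  have "B (u l) x = 0" if "l \<in> ?K" for l
    using S(4) unfolding EG_span_def by (rule B_span_eq_0') (use z[OF that] in auto)
  then show ?thesis using S ck[OF i order_refl] by (intro u(4)[of x S]) auto
qed

section \<open>Purity from coordinates\<close>

text \<open>The zero form is a wedge of zero vectors, except in degree 0, where the empty wedge
  pairs to 1.\<close>

lemma pure_zero:
  assumes "finite K" "K \<noteq> {}" "\<And>y. length y = card K \<Longrightarrow> set y \<subseteq> hspan K h \<Longrightarrow> \<beta> y = 0"
  shows "pure K h \<beta>"
proof -
  have c: "card K > 0" using assms by (simp add: card_gt_0_iff)
  have "\<beta> y = gram B (replicate (card K) 0) y" if "length y = card K" "set y \<subseteq> hspan K h" for y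
    using c that assms(3)[OF that] gram_eq_0_row[of 0 "replicate (card K) 0" y B] by simp
  then show ?thesis
    unfolding pure_def
    by (intro exI[of _ "replicate (card K) 0"]) (use c in \<open>auto simp: isotropic_def hspan_closed\<close>)
qed

lemma gram_dual:
  assumes "distinct is" "\<And>i j. i \<in> set is \<Longrightarrow> j \<in> set is \<Longrightarrow> B (b i) (d j) = (if i = j then 1 else 0)"
  shows "gram B (map b is) (map d is) = 1"
  using assms
proof (induction "is")
  case (Cons i "is")
  have "gram B (b i # map b is) (d i # map d is) = B (b i) (d i) * gram B (map b is) (map d is)"
    by (rule gram_Cons_Cons) (use Cons.prems in \<open>auto\<close>)
  then show ?case using Cons by simp
qed simp

text \<open>With a single coordinate left, the form is the pairing with a scalar multiple of the
  wedge of all e_i. The scalar is put into the first factor, so there has to be one.\<close>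

lemma pure_of_basis:
  assumes fin: "finite I" and ne: "I \<noteq> {}" and h: "hyperbolic I \<gamma> h" and alt: "alt_form s (card I) \<alpha>"
    and z: "\<And>is. distinct is \<Longrightarrow> set is \<subseteq> hix I \<Longrightarrow> length is = card I \<Longrightarrow> \<not> set is \<subseteq> Fv ` I \<Longrightarrow>
      \<alpha> (map h is) = 0"
  shows "pure I h \<alpha>"
proof -
  let ?a = "\<alpha> (F_list h I)"
  obtain i0 r where r: "sorted_list_of_set I = i0 # r"
    using ne fin by (cases "sorted_list_of_set I") auto
  have sr: "set (i0 # r) = I" "distinct (i0 # r)" "length (i0 # r) = card I"
    using fin unfolding r[symmetric] by auto
  let ?E = "\<lambda>i. h (Ev i)"
  define l where "l = s ?a (?E i0) # map ?E r"
  have len: "length l = card I" using sr(3) by (simp add: l_def)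
  have sl: "\<exists>i\<in>I. \<exists>c. v = s c (?E i)" if v: "v \<in> set l" for v
  proof -
    consider "v = s ?a (?E i0)" | i where "i \<in> set r" "v = s 1 (?E i)"
      using v unfolding l_def by auto
    then show ?thesis
    proof cases
      case 1
      then show ?thesis using sr(1) by auto
    next
      case (2 i)
      then show ?thesis using sr(1) by (intro bexI[of _ i] exI[of _ 1]) auto
    qed
  qed
  have lU: "set l \<subseteq> hspan I h" using sl by (force intro!: hspan_closed mem_hspan)
  have liso: "isotropic B (set l)"
    unfolding isotropic_def
  proof (intro ballI)
    fix u w assume "u \<in> set l" "w \<in> set l"
    with sl[of u] sl[of w] show "B u w = 0" by (auto simp: B_simps hypD[OF h])
  qed
  have g1: "gram B l (F_list h I) = ?a"
  proof -
    have "gram B (map ?E (i0 # r)) (map (\<lambda>i. h (Fv i)) (i0 # r)) = 1"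
      by (rule gram_dual) (use sr hypD[OF h] in auto)
    then have "gram B (?E i0 # map ?E r) (F_list h I) = 1" by (simp add: F_list_def r)
    moreover have "gram B (s ?a (?E i0) # map ?E r) (F_list h I) = ?a * gram B (?E i0 # map ?E r) (F_list h I)"
      by (rule alt_head(2)[OF alt_form_gram_left]) (use sr(3) in simp)
    ultimately show ?thesis by (simp add: l_def)
  qed
  have altg: "alt_form s (card I) (gram B l)" using alt_form_gram[of l] len by simp
  note altd = alt_form_diff[OF alt altg]
  have "\<alpha> y - gram B l y = 0" if y: "length y = card I" "set y \<subseteq> hspan I h" for y
  proof (rule alt_form_eq_0_on_span[OF altd])
    fix "is" assume d: "distinct is" and sub: "set is \<subseteq> hix I" and li: "length is = card I"
    show "\<alpha> (map h is) - gram B l (map h is) = 0"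
    proof (cases "set is \<subseteq> Fv ` I")
      case True
      have "card (set is) = card (Fv ` I)"
        using d li by (simp add: distinct_card card_image inj_on_def)
      then have "set is = Fv ` I" using True fin by (intro card_subset_eq) auto
      also have "\<dots> = set (map Fv (i0 # r))" using sr(1) by auto
      finally have "mset is = mset (map Fv (i0 # r))"
        using d sr(2) by (subst set_eq_iff_mset_eq_distinct[symmetric]) (auto simp: distinct_map inj_on_def)
      then have "mset (map h is) = mset (map h (map Fv (i0 # r)))" unfolding mset_map[of h] by simp
      also have "map h (map Fv (i0 # r)) = F_list h I" unfolding F_list_def r by simp
      finally have "mset (map h is) = mset (F_list h I)" .
      then show ?thesis
        by (rule alt_form_perm_eq_0[OF altd, of "F_list h I", rotated]) (use g1 li in simp_all)
    next
      case False
      then obtain a where a: "a \<in> set is" "a \<notin> Fv ` I" by auto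
      then have a': "a \<in> Ev ` I \<union> {Gv}" using sub by (auto simp: hix_def)
      have "gram B l (map h is) = 0"
      proof (rule gram_eq_0_col[of "h a"])
        fix v assume "v \<in> set l"
        with sl[of v] a' show "B v (h a) = 0" by (auto simp: B_simps hypD[OF h] hypD_G[OF h])
      qed (use a len li in auto)
      then show ?thesis using z[OF d sub li False] by simp
    qed
  qed (use y in \<open>auto simp: hspan_def\<close>)
  then have "\<forall>y. length y = card I \<longrightarrow> set y \<subseteq> hspan I h \<longrightarrow> \<alpha> y = gram B l y" by simp
  then show ?thesis unfolding pure_def using len lU liso by blast
qed

text \<open>Some f_k with k outside \<open>A\<close> survives the replacement, and normality applies
  to it. This shows that a move does not change the value on the frame of the f_i.\<close>

lemma normal_F_list_replace:
  assumes fin: "finite I" and h: "hyperbolic I \<gamma> h" and alt: "alt_form s (card I) \<alpha>" and no: "normal I h \<alpha>"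
    and A: "A \<subseteq> I" "k \<in> I - A" and ys: "length ys = card A" "set ys \<subseteq> hspan (I - {k}) h"
    and x: "x \<in> set ys" "x \<in> EG_span (I - {k}) h"
  shows "\<alpha> (ys @ F_list h (I - A)) = 0"
proof (rule normalD[OF no alt, of _ k "ys @ F_list h (I - A - {k})" x])
  show "mset (ys @ F_list h (I - A)) = mset (h (Fv k) # ys @ F_list h (I - A - {k}))"
    using mset_F_list_remove[of "I - A" k h] A fin by auto
  show "length (ys @ F_list h (I - A)) = card I"
    using ys A fin by (simp add: card_Diff_subset finite_subset card_mono)
  show "set (ys @ F_list h (I - A - {k})) \<subseteq> hspan (I - {k}) h"
    using ys(2) fin by (auto intro!: mem_hspan)
qed (use A x in auto)

section \<open>Odd dimension\<close>

text \<open>A coordinate with g, or with e_i but not f_i, can be written as g or e_i followed by a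
  list that avoids a whole pair \<open>i\<close>; these are settled by \<open>one\<close>. Otherwise
  both e_i and f_i occur, and the move of g itself is used.\<close>

lemma pure_normal_odd:
  assumes fin: "finite I" and c4: "card I \<ge> 4" and h: "hyperbolic I \<gamma> h" and g: "\<gamma> \<noteq> 0"
    and alt: "alt_form s (card I) \<alpha>"
    and pu: "contractions_pure I \<gamma> h \<alpha>" and no: "normal I h \<alpha>" and nz: "\<alpha> (F_list h I) \<noteq> 0"
  shows "pure I h \<alpha>"
proof (rule pure_of_basis[OF fin _ h alt])
  show "I \<noteq> {}" using c4 by auto
  let ?e = "\<lambda>i. h (Ev i)" and ?f = "\<lambda>i. h (Fv i)" and ?g = "h Gv"
  have cc: "Suc (card (I - {i})) = card I" if "i \<in> I" for i using fin that by (metis card.remove)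
  have ex_other: "\<exists>k\<in>I. k \<noteq> i" for i
  proof (rule ccontr)
    assume "\<not> ?thesis"
    then have "card I \<le> card {i}" by (intro card_mono) auto
    then show False using c4 by simp
  qed
  have move: "\<alpha> ((?f i + (s t ?g - s (\<gamma> / 2 * t\<^sup>2) (?e i))) # S) = 0"
    if i: "i \<in> I" and S: "length S = card I - 1" "set S \<subseteq> hspan (I - {i}) (shear_G \<gamma> h i t)" "x \<in> set S"
      "x \<in> EG_span (I - {i}) (shear_G \<gamma> h i t)" for i t S x
  proof -
    let ?h2 = "shear_G \<gamma> h i t"
    \<comment> \<open>In the expansion of the new f_i, the terms with g and e_i vanish by normality,
      so the nonzero value on the frame is kept.\<close>
    have nz2: "\<alpha> (F_list ?h2 I) \<noteq> 0"
    proof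
      assume "\<alpha> (F_list ?h2 I) = 0"
      then have "\<alpha> (?h2 (Fv i) # F_list ?h2 (I - {i})) = 0"
        by (rule alt_form_perm_eq_0[OF alt _ mset_F_list_remove[OF fin i, symmetric]]) (use cc[OF i] in simp)
      moreover have "F_list ?h2 (I - {i}) = F_list h (I - {i})" by (rule F_list_cong) (auto simp: shear_G_def)
      ultimately have "\<alpha> ((?f i + (s t ?g - s (\<gamma> / 2 * t\<^sup>2) (?e i))) # F_list h (I - {i})) = 0"
        by (simp add: shear_G_def)
      moreover obtain k where k: "k \<in> I" "k \<noteq> i" using ex_other by blast
      have "\<alpha> ([y] @ F_list h (I - {i})) = 0" if "y = ?g \<or> y = ?e i" for y
        by (rule normal_F_list_replace[OF fin h alt no, of _ k _ y]) (use that i k in \<open>auto intro!: mem_hspan mem_EG_span\<close>)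
      then have "\<alpha> ([?g] @ F_list h (I - {i})) = 0" "\<alpha> ([?e i] @ F_list h (I - {i})) = 0" by blast+
      ultimately have "\<alpha> (?f i # F_list h (I - {i})) = 0"
        using cc[OF i] by (simp add: alt_head[OF alt])
      then show False using F_list_front_neq_0[OF alt fin nz i] by simp
    qed
    have "\<alpha> (?h2 (Fv i) # S) = 0"
    proof (rule normal_move[OF fin h alt pu no hyp_shear_G[OF h i] hspan_shear_G[OF i] nz2, of "{i}"])
      fix k assume k: "k \<in> I - {i}"
      then show "?h2 (Fv k) = h (Fv k)" by (auto simp: shear_G_def)
      show "?h2 a \<in> hspan (I - {k}) h" if "a \<in> hix (I - {k})" for a
        using that i k by (cases rule: hix_cases) (auto simp: shear_G_def intro!: hspan_closed mem_hspan)
      show "?h2 (Ev l) \<in> EG_span (I - {k}) h" if "l \<in> I - {k}" for l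
        using mem_EG_span(1)[OF that] by (simp add: shear_G_def)
      show "?h2 Gv \<in> EG_span (I - {k}) h"
        using i k by (auto simp: shear_G_def intro!: EG_span_closed mem_EG_span)
    qed (use i c4 S in auto)
    then show ?thesis by (simp add: shear_G_def)
  qed
  have U2: "set (map h R) \<subseteq> hspan (I - {i}) (shear_G \<gamma> h i t)" and U3: "map (shear_G \<gamma> h i t) R = map h R"
    if "set R \<subseteq> Ev ` (I - {i}) \<union> Fv ` (I - {i})" for R i t
  proof -
    show eq: "map (shear_G \<gamma> h i t) R = map h R"
      by (rule map_cong[OF refl]) (use that in \<open>auto simp: shear_G_def\<close>)
    show "set (map h R) \<subseteq> hspan (I - {i}) (shear_G \<gamma> h i t)"
      unfolding eq[symmetric] hspan_def using that by (auto simp: hix_def intro!: span_base)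
  qed
  have one: "\<alpha> (?g # map h R) = 0 \<and> \<alpha> (?e i # map h R) = 0"
    if i: "i \<in> I" and R: "distinct R" "length R = card I - 1" "set R \<subseteq> Ev ` (I - {i}) \<union> Fv ` (I - {i})" for i R
  proof (cases "\<exists>l. Ev l \<in> set R")
    case True
    then obtain l where l: "Ev l \<in> set R" "l \<in> I - {i}" using R(3) by auto
    have len: "Suc (length (map h R)) = card I" using R(2) c4 by simp
    have f0: "\<alpha> (?f i # map h R) = 0"
    proof (rule normalD[OF no alt refl _ i, of _ "h (Ev l)"])
      show "set (map h R) \<subseteq> hspan (I - {i}) h"
        unfolding hspan_def using R(3) by (auto simp: hix_def intro!: span_base)
    qed (use len l mem_EG_span(1)[OF l(2)] in auto)
    have m: "\<alpha> ((?f i + (s t ?g - s (\<gamma> / 2 * t\<^sup>2) (?e i))) # map h R) = 0" for t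
    proof (rule move[OF i _ U2[OF R(3)]])
      show "h (Ev l) \<in> EG_span (I - {i}) (shear_G \<gamma> h i t)"
        using mem_EG_span(1)[OF l(2), of "shear_G \<gamma> h i t"] by (simp add: shear_G_def)
    qed (use l len in auto)
    \<comment> \<open>One side is odd in t, the other even, so t = 1 and t = -1 make both vanish;
      \<open>\<gamma> \<noteq> 0\<close> then yields the value on e_i.\<close>
    have "t * \<alpha> (?g # map h R) = \<gamma> / 2 * t\<^sup>2 * \<alpha> (?e i # map h R)" for t
      using m[of t] f0 by (simp add: alt_head[OF alt len])
    from this[of 1] this[of "-1"] have "\<alpha> (?g # map h R) = \<gamma> / 2 * \<alpha> (?e i # map h R)"
      "- \<alpha> (?g # map h R) = \<gamma> / 2 * \<alpha> (?e i # map h R)" by simp_all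
    then have "\<alpha> (?g # map h R) + \<alpha> (?g # map h R) = 0" by (metis add.right_inverse)
    then have "2 * \<alpha> (?g # map h R) = 0" by (simp only: mult_2)
    then have "\<alpha> (?g # map h R) = 0" using two_neq_0 by simp
    with \<open>\<alpha> (?g # map h R) = \<gamma> / 2 * \<alpha> (?e i # map h R)\<close> show ?thesis
      using g two_neq_0 by simp
  next
    case False
    \<comment> \<open>Here \<open>R\<close> contains only f's and is nonempty, so normality applies
      directly: some f_k is present without e_k, next to an entry g or e_i.\<close>
    have "length R > 0" using R(2) c4 by simp
    then obtain a where a: "a \<in> set R" using nth_mem by blast
    then have "a \<in> Ev ` (I - {i}) \<union> Fv ` (I - {i})" using R(3) by blast
    then obtain k where k: "Fv k \<in> set R" "k \<in> I - {i}" using False a by blast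
    have "\<alpha> (h a # map h R) = 0" if a: "a = Gv \<or> a = Ev i" for a
    proof -
      have an: "a \<notin> set R" using a R(3) by auto
      have m: "mset (h a # map h R) = mset (?f k # h a # map h (remove1 (Fv k) R))"
      proof -
        have "mset R = mset (Fv k # remove1 (Fv k) R)" using k by simp
        then have "mset (map h R) = mset (map h (Fv k # remove1 (Fv k) R))" unfolding mset_map by simp
        then show ?thesis by simp
      qed
      show ?thesis
      proof (rule normalD[OF no alt m, of "h a"])
        have "set (remove1 (Fv k) R) \<subseteq> hix (I - {k})"
        proof
          fix b assume "b \<in> set (remove1 (Fv k) R)"
          then have b: "b \<in> set R" "b \<noteq> Fv k" using R(1) by (auto simp: set_remove1_eq)
          then have "b \<in> Ev ` (I - {i}) \<union> Fv ` (I - {i})" using R(3) by blast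
          then obtain j where "b = Fv j" "j \<in> I" using False b(1) by blast
          then show "b \<in> hix (I - {k})" using b by (auto simp: hix_def)
        qed
        moreover have "a \<in> hix (I - {k})" using a k i by (auto simp: hix_def)
        ultimately show "set (h a # map h (remove1 (Fv k) R)) \<subseteq> hspan (I - {k}) h"
          unfolding hspan_def by (auto intro!: span_base)
        show "h a \<in> EG_span (I - {k}) h" using a k i by (auto intro!: mem_EG_span)
        show "length (h a # map h R) = card I" using R(2) c4 by simp
      qed (use k in auto)
    qed
    then show ?thesis by blast
  qed
  fix "is" assume d: "distinct is" and sub: "set is \<subseteq> hix I" and li: "length is = card I"
    and nF: "\<not> set is \<subseteq> Fv ` I"
  show "\<alpha> (map h is) = 0"
  proof (cases "Gv \<in> set is")
    case True
    let ?R = "remove1 Gv is"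
    have lR: "length ?R = card I - 1" using True li by (simp add: length_remove1)
    have dR: "distinct ?R" using d by simp
    have "card (set ?R) < card I" using lR dR c4 by (simp add: distinct_card)
    then obtain i where i: "i \<in> I" "Ev i \<notin> set ?R" "Fv i \<notin> set ?R"
      using exists_missing_index[of "set ?R" I] by auto
    have "set ?R \<subseteq> Ev ` (I - {i}) \<union> Fv ` (I - {i})"
    proof
      fix a assume a: "a \<in> set ?R"
      then have "a \<in> hix I" "a \<noteq> Gv" using sub d by (auto simp: set_remove1_eq)
      then show "a \<in> Ev ` (I - {i}) \<union> Fv ` (I - {i})" using a i by (cases rule: hix_cases) auto
    qed
    from one[OF i(1) dR lR this] show ?thesis
      by (intro alt_map_front[OF alt True li]) auto
  next
    case False
    obtain a where a: "a \<in> set is" "a \<notin> Fv ` I" using nF by blast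
    then have "a \<in> Ev ` I" using False sub unfolding hix_def by blast
    then obtain i where i: "i \<in> I" "Ev i \<in> set is" using a(1) by blast
    show ?thesis
    proof (cases "Fv i \<in> set is")
      case Fi: True
      let ?R = "remove1 (Ev i) (remove1 (Fv i) is)"
      have R: "set ?R \<subseteq> Ev ` (I - {i}) \<union> Fv ` (I - {i})"
      proof
        fix a assume a: "a \<in> set ?R"
        then have "a \<in> hix I" "a \<noteq> Gv" "a \<noteq> Ev i" "a \<noteq> Fv i"
          using sub d False by (auto simp: set_remove1_eq)
        then show "a \<in> Ev ` (I - {i}) \<union> Fv ` (I - {i})" by (cases rule: hix_cases) auto
      qed
      have "Ev i \<in> set (remove1 (Fv i) is)" using i by (simp add: in_set_remove1)
      then have "length ?R = card I - 2" using Fi li by (simp add: length_remove1)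
      then have len: "Suc (Suc (length (map h ?R))) = card I" using c4 by simp
      let ?M = "map h ?R"
      \<comment> \<open>The moved g is an entry from \<open>EG_span\<close> by itself, so
        \<open>?R\<close> need not contain any e_l. In the expansion only the value on f_i, e_i is
        odd in t.\<close>
      have m: "\<alpha> ((?f i + (s t ?g - s (\<gamma> / 2 * t\<^sup>2) (?e i))) # (?g - s (\<gamma> * t) (?e i)) # ?M) = 0" for t
      proof (rule move[OF i(1)])
        have "shear_G \<gamma> h i t Gv = ?g - s (\<gamma> * t) (?e i)" by (simp add: shear_G_def)
        then show "set ((?g - s (\<gamma> * t) (?e i)) # ?M) \<subseteq> hspan (I - {i}) (shear_G \<gamma> h i t)"
          "?g - s (\<gamma> * t) (?e i) \<in> EG_span (I - {i}) (shear_G \<gamma> h i t)"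
          using U2[OF R] mem_hspan(3)[of "shear_G \<gamma> h i t" "I - {i}"] mem_EG_span(2)[of "shear_G \<gamma> h i t" "I - {i}"] by auto
      qed (use len in auto)
      note A = alt_head[OF alt] alt_snd(1,2,3,5)[OF alt]
      have len1: "Suc (length (x # ?M)) = card I" for x using len by simp
      have "\<alpha> (?e i # ?g # ?M) = - \<alpha> (?g # ?e i # ?M)" by (rule alt_snd(4)[OF alt len])
      then have eq: "\<alpha> (?f i # ?g # ?M) - \<gamma> * t * \<alpha> (?f i # ?e i # ?M) - (\<gamma> * t * t - \<gamma> / 2 * t\<^sup>2) * \<alpha> (?g # ?e i # ?M) = 0" for t
        using m[of t] by (simp add: alt_head[OF alt len1] alt_snd(1,2,3,5)[OF alt len] algebra_simps)
      define c where "c = (\<gamma> - \<gamma> / 2) * \<alpha> (?g # ?e i # ?M)"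
      have "\<alpha> (?f i # ?g # ?M) - c = \<gamma> * \<alpha> (?f i # ?e i # ?M)"
        using eq[of 1] unfolding c_def by (simp add: algebra_simps)
      moreover have "\<alpha> (?f i # ?g # ?M) - c = - (\<gamma> * \<alpha> (?f i # ?e i # ?M))"
        using eq[of "-1"] unfolding c_def by (simp add: algebra_simps eq_neg_iff_add_eq_0)
      ultimately have "\<gamma> * \<alpha> (?f i # ?e i # ?M) + \<gamma> * \<alpha> (?f i # ?e i # ?M) = 0"
        by (metis add.right_inverse)
      then have "2 * (\<gamma> * \<alpha> (?f i # ?e i # ?M)) = 0" by (simp only: mult_2)
      then have "\<alpha> (?f i # ?e i # ?M) = 0" using two_neq_0 g by simp
      then show ?thesis using Fi i li by (intro alt_map_front2[OF alt, of "Fv i" "is" "Ev i"]) auto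
    next
      case nFi: False
      let ?R = "remove1 (Ev i) is"
      have lR: "length ?R = card I - 1" using i li by (simp add: length_remove1)
      have dR: "distinct ?R" using d by simp
      have "set ?R \<subseteq> Ev ` (I - {i}) \<union> Fv ` (I - {i})"
      proof
        fix a assume a: "a \<in> set ?R"
        then have "a \<in> hix I" "a \<noteq> Gv" "a \<noteq> Ev i" "a \<noteq> Fv i"
          using sub d False nFi by (auto simp: set_remove1_eq)
        then show "a \<in> Ev ` (I - {i}) \<union> Fv ` (I - {i})" by (cases rule: hix_cases) auto
      qed
      from one[OF i(1) dR lR this] show ?thesis
        by (intro alt_map_front[OF alt i(2) li]) auto
    qed
  qed
qed

section \<open>Even dimension\<close>

text \<open>A coordinate with some f_k but not e_k is covered by normality. In the others every f_k
  comes with e_k; those with a full pair need both kinds of shears, those with e's only need just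
  \<open>shear_EF\<close>.\<close>

lemma pure_normal_even:
  assumes fin: "finite I" and c5: "card I \<ge> 5" and h: "hyperbolic I 0 h"
    and alt: "alt_form s (card I) \<alpha>"
    and pu: "contractions_pure I 0 h \<alpha>" and no: "normal I h \<alpha>" and nz: "\<alpha> (F_list h I) \<noteq> 0"
  shows "pure I h \<alpha>"
proof (rule pure_of_basis[OF fin _ h alt])
  show "I \<noteq> {}" using c5 by auto
  let ?e = "\<lambda>i. h (Ev i)" and ?f = "\<lambda>i. h (Fv i)"
  have cc: "Suc (card (A - {i})) = card A" if "i \<in> A" "A \<subseteq> I" for i A
    using fin that by (metis card.remove finite_subset)
  have ex_other: "\<exists>k\<in>I. k \<notin> {i,j}" for i j
  proof (rule ccontr)
    assume "\<not> ?thesis"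
    then have "card I \<le> card {i,j}" by (intro card_mono) auto
    also have "\<dots> \<le> 2" by (simp add: card_insert_if)
    finally show False using c5 by simp
  qed
  \<comment> \<open>Used for the terms that appear when the sheared f_i and f_j are expanded: all
    but the original one contain some e and leave an index \<open>k\<close> free.\<close>
  have zero: "\<alpha> (ys @ F_list h (I - A)) = 0"
    if "A \<subseteq> I" "k \<in> I" "k \<notin> A" "length ys = card A" "set ys \<subseteq> h ` hix (I - {k})" "x \<in> set ys" "x \<in> h ` Ev ` (I - {k})" for A k ys x
    by (rule normal_F_list_replace[OF fin h alt no, of A k ys x])
      (use that in \<open>auto simp: hspan_def EG_span_def intro: span_base\<close>)
  have FlA: "F_list h2 (I - {i,j}) = F_list h (I - {i,j})" if "\<And>k. k \<notin> {i,j} \<Longrightarrow> h2 (Fv k) = h (Fv k)" for h2 i j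
    by (rule F_list_cong) (use that in auto)
  have front2: "mset (F_list h2 I) = mset (h2 (Fv i) # h2 (Fv j) # F_list h2 (I - {i,j}))"
    if "i \<in> I" "j \<in> I" "i \<noteq> j" for h2 :: "hyp_index \<Rightarrow> 'v" and i j
    using mset_F_list_remove[of I i h2] mset_F_list_remove[of "I - {i}" j h2] that fin
    by (simp add: Diff_insert2[symmetric] insert_commute)
  have len2: "Suc (Suc (length (F_list h (I - {i,j})))) = card I"
    if "i \<in> I" "j \<in> I" "i \<noteq> j" for i j
    using cc[of i I] cc[of j "I - {i}"] that by (simp add: Diff_insert2[symmetric] insert_commute)
  have nz0: "\<alpha> (?f i # ?f j # F_list h (I - {i,j})) \<noteq> 0" if "i \<in> I" "j \<in> I" "i \<noteq> j" for i j
    using alt_form_perm_eq_0[OF alt _ front2[OF that, of h] length_F_list] nz by blast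
  have moveEF: "\<alpha> ((?f i + s t (?e j)) # S) = 0"
    if ij: "i \<in> I" "j \<in> I" "i \<noteq> j" and S: "length S = card I - 1" "set S \<subseteq> hspan (I - {i}) (shear_EF h i j t)"
      "x \<in> set S" "x \<in> EG_span (I - {i}) (shear_EF h i j t)" for i j t S x
  proof -
    let ?h2 = "shear_EF h i j t"
    have nz2: "\<alpha> (F_list ?h2 I) \<noteq> 0"
    proof
      assume "\<alpha> (F_list ?h2 I) = 0"
      then have "\<alpha> (?h2 (Fv i) # ?h2 (Fv j) # F_list ?h2 (I - {i,j})) = 0"
        by (rule alt_form_perm_eq_0[OF alt _ front2[OF ij, symmetric]]) (use front2[OF ij, of ?h2] in \<open>metis length_F_list mset_eq_length\<close>)
      then have z: "\<alpha> ((?f i + s t (?e j)) # (?f j - s t (?e i)) # F_list h (I - {i,j})) = 0"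
        using ij by (subst (asm) FlA) (auto simp: shear_EF_def)
      obtain k where k: "k \<in> I" "k \<notin> {i,j}" using ex_other by blast
      have "\<alpha> (ys @ F_list h (I - {i,j})) = 0" if "ys = [?f i, ?e i] \<or> ys = [?e j, ?f j] \<or> ys = [?e j, ?e i]" for ys
        by (rule zero[of "{i,j}" k ys "if ys = [?f i, ?e i] then ?e i else ?e j"])
          (use that ij k in \<open>auto simp: hix_def\<close>)
      then have "\<alpha> (?f i # ?e i # F_list h (I - {i,j})) = 0" "\<alpha> (?e j # ?f j # F_list h (I - {i,j})) = 0"
        "\<alpha> (?e j # ?e i # F_list h (I - {i,j})) = 0" by fastforce+
      with z have "\<alpha> (?f i # ?f j # F_list h (I - {i,j})) = 0"
        using len2[OF ij] by (simp add: alt_head[OF alt] alt_snd(1,2,3,5)[OF alt])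
      then show False using nz0[OF ij] by simp
    qed
    have "\<alpha> (?h2 (Fv i) # S) = 0"
    proof (rule normal_move[OF fin h alt pu no hyp_shear_EF[OF h ij] hspan_shear_EF[OF ij(1,2)] nz2, of "{i,j}"])
      fix k assume k: "k \<in> I - {i,j}"
      then show "?h2 (Fv k) = h (Fv k)" by (auto simp: shear_EF_def)
      show "?h2 a \<in> hspan (I - {k}) h" if "a \<in> hix (I - {k})" for a
        using that ij k by (cases rule: hix_cases) (auto simp: shear_EF_def intro!: hspan_closed mem_hspan)
      show "?h2 (Ev l) \<in> EG_span (I - {k}) h" if "l \<in> I - {k}" for l
        using mem_EG_span(1)[OF that] by (simp add: shear_EF_def)
      show "?h2 Gv \<in> EG_span (I - {k}) h"
        by (simp add: shear_EF_def mem_EG_span)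
    qed (use ij c5 S in auto)
    then show ?thesis using ij by (simp add: shear_EF_def)
  qed
  have moveFF: "\<alpha> ((?f i + ?f j) # S) = 0"
    if ij: "i \<in> I" "j \<in> I" "i \<noteq> j" and S: "length S = card I - 1" "set S \<subseteq> hspan (I - {i}) (shear_FF h i j)"
      "x \<in> set S" "x \<in> EG_span (I - {i}) (shear_FF h i j)" for i j S x
  proof -
    let ?h2 = "shear_FF h i j"
    have nz2: "\<alpha> (F_list ?h2 I) \<noteq> 0"
    proof
      assume "\<alpha> (F_list ?h2 I) = 0"
      then have "\<alpha> (?h2 (Fv i) # ?h2 (Fv j) # F_list ?h2 (I - {i,j})) = 0"
        by (rule alt_form_perm_eq_0[OF alt _ front2[OF ij, symmetric]]) (use front2[OF ij, of ?h2] in \<open>metis length_F_list mset_eq_length\<close>)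
      then have z: "\<alpha> ((?f i + ?f j) # ?f j # F_list h (I - {i,j})) = 0"
        using ij by (subst (asm) FlA) (auto simp: shear_FF_def)
      then have "\<alpha> (?f i # ?f j # F_list h (I - {i,j})) = 0"
        using len2[OF ij] by (simp add: alt_head[OF alt] alt_snd(1,2,3,5)[OF alt])
      then show False using nz0[OF ij] by simp
    qed
    have "\<alpha> (?h2 (Fv i) # S) = 0"
    proof (rule normal_move[OF fin h alt pu no hyp_shear_FF[OF h ij] hspan_shear_FF[OF ij(1,2)] nz2, of "{i,j}"])
      fix k assume k: "k \<in> I - {i,j}"
      then show "?h2 (Fv k) = h (Fv k)" by (auto simp: shear_FF_def)
      show "?h2 a \<in> hspan (I - {k}) h" if "a \<in> hix (I - {k})" for a
        using that ij k by (cases rule: hix_cases) (auto simp: shear_FF_def intro!: hspan_closed mem_hspan)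
      show "?h2 (Ev l) \<in> EG_span (I - {k}) h" if "l \<in> I - {k}" for l
        using that ij k by (auto simp: shear_FF_def intro!: EG_span_closed mem_EG_span)
      show "?h2 Gv \<in> EG_span (I - {k}) h"
        by (simp add: shear_FF_def mem_EG_span)
    qed (use ij c5 S in auto)
    then show ?thesis using ij by (simp add: shear_FF_def)
  qed
  \<comment> \<open>Neither sheared entry lies in \<open>EG_span\<close>, so the rest of the list
    has to supply some e_l.\<close>
  have eqEF: "\<alpha> (?f i # ?f j # map h R) - t * \<alpha> (?f i # ?e i # map h R) + t * \<alpha> (?e j # ?f j # map h R)
      - t * t * \<alpha> (?e j # ?e i # map h R) = 0"
    if ij: "i \<in> I" "j \<in> I" "i \<noteq> j" and R: "Suc (Suc (length R)) = card I" "set R \<subseteq> hix (I - {i,j})" "Ev l \<in> set R"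
    for i j t R l
  proof -
    have len: "Suc (Suc (length (map h R))) = card I" using R(1) by simp
    then have len1: "Suc (length (x # map h R)) = card I" for x by simp
    let ?h2 = "shear_EF h i j t"
    have hR: "map h R = map ?h2 R" using R(2) by (intro map_cong refl) (auto simp: shear_EF_def hix_def)
    have l: "l \<in> I - {i,j}" using R(2,3) by (auto simp: hix_def)
    have "\<alpha> ((?f i + s t (?e j)) # (?f j - s t (?e i)) # map h R) = 0"
    proof (rule moveEF[OF ij, of _ _ "h (Ev l)"])
      have "set (map ?h2 R) \<subseteq> hspan (I - {i,j}) ?h2"
        unfolding hspan_def using R(2) by (auto intro!: span_base)
      moreover have "?f j - s t (?e i) = ?h2 (Fv j)" by (simp add: shear_EF_def)
      ultimately show "set ((?f j - s t (?e i)) # map h R) \<subseteq> hspan (I - {i}) ?h2"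
        unfolding hR using hspan_mono[of "I - {i,j}" "I - {i}" ?h2] mem_hspan(2)[of j "I - {i}" ?h2] ij by auto
      show "h (Ev l) \<in> EG_span (I - {i}) ?h2"
        using mem_EG_span(1)[of l "I - {i}" ?h2] l by (simp add: shear_EF_def)
    qed (use R in auto)
    then show ?thesis
      by (simp add: alt_head[OF alt len1] alt_snd(1,2,3,5)[OF alt len] algebra_simps)
  qed
  \<comment> \<open>Here the second entry e_j - e_i is the new e_j, so the rest of the list may be
    arbitrary.\<close>
  have eqFF: "\<alpha> (?f i # ?e j # map h R) - \<alpha> (?f i # ?e i # map h R) + \<alpha> (?f j # ?e j # map h R)
      - \<alpha> (?f j # ?e i # map h R) = 0"
    if ij: "i \<in> I" "j \<in> I" "i \<noteq> j" and R: "Suc (Suc (length R)) = card I" "set R \<subseteq> hix (I - {i,j})"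
    for i j R
  proof -
    have len: "Suc (Suc (length (map h R))) = card I" using R(1) by simp
    then have len1: "Suc (length (x # map h R)) = card I" for x by simp
    let ?h2 = "shear_FF h i j"
    have hR: "map h R = map ?h2 R" using R(2) by (intro map_cong refl) (auto simp: shear_FF_def hix_def)
    have "\<alpha> ((?f i + ?f j) # (?e j - ?e i) # map h R) = 0"
    proof (rule moveFF[OF ij, of _ "?e j - ?e i"])
      have "set (map ?h2 R) \<subseteq> hspan (I - {i,j}) ?h2"
        unfolding hspan_def using R(2) by (auto intro!: span_base)
      moreover have e: "?e j - ?e i = ?h2 (Ev j)" using ij by (simp add: shear_FF_def)
      ultimately show "set ((?e j - ?e i) # map h R) \<subseteq> hspan (I - {i}) ?h2"
        unfolding hR using hspan_mono[of "I - {i,j}" "I - {i}" ?h2] mem_hspan(1)[of j "I - {i}" ?h2] ij by auto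
      show "?e j - ?e i \<in> EG_span (I - {i}) ?h2"
        unfolding e using ij by (auto intro!: mem_EG_span)
    qed (use R in auto)
    then show ?thesis
      by (simp add: alt_head[OF alt len1] alt_snd(1,2,3,5)[OF alt len] algebra_simps)
  qed
  have fz: "\<alpha> (h (Fv k) # map h R) = 0"
    if "k \<in> I" "Suc (length R) = card I" "set R \<subseteq> hix (I - {k})" "Ev l \<in> set R" for k R l
  proof (rule normalD[OF no alt refl _ that(1), where x = "h (Ev l)"])
    have l: "l \<in> I - {k}" using that by (auto simp: hix_def)
    then show "h (Ev l) \<in> EG_span (I - {k}) h" by (rule mem_EG_span)
    show "set (map h R) \<subseteq> hspan (I - {k}) h" unfolding hspan_def using that by (auto intro!: span_base)
  qed (use that in auto)
  fix "is" assume d: "distinct is" and sub: "set is \<subseteq> hix I" and li: "length is = card I"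
    and nF: "\<not> set is \<subseteq> Fv ` I"
  have len: "length (remove1 a is) = card I - 1" if "a \<in> set is" for a
    using that li by (simp add: length_remove1)
  have len': "Suc (Suc (length (remove1 b (remove1 a is)))) = card I" if "a \<in> set is" "b \<in> set is" "a \<noteq> b" for a b
    using that len[of a] c5 by (simp add: length_remove1 in_set_remove1)
  show "\<alpha> (map h is) = 0"
  proof (cases "Gv \<in> set is")
    case True
    have "\<alpha> (h Gv # map h (remove1 Gv is)) = 0"
      using hyp_G_eq_0[OF h] len[OF True] c5 by (simp add: alt_head(4)[OF alt])
    then show ?thesis by (rule alt_map_front[OF alt True li])
  next
    case nG: False
    obtain a where a: "a \<in> set is" "a \<notin> Fv ` I" using nF by blast
    then have "a \<in> Ev ` I" using nG sub unfolding hix_def by blast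
    then obtain i where i: "i \<in> I" "Ev i \<in> set is" using a(1) by blast
    have inI: "a \<in> hix (I - A)" if "a \<in> set is" "\<And>i. i \<in> A \<Longrightarrow> a \<noteq> Ev i \<and> a \<noteq> Fv i" for a A
    proof -
      have "a \<in> hix I" using that(1) sub by blast
      then show ?thesis using that(2) by (cases rule: hix_cases) (auto simp: hix_def)
    qed
    show ?thesis
    proof (cases "\<exists>k\<in>I. Fv k \<in> set is \<and> Ev k \<notin> set is")
      case True
      then obtain k where k: "k \<in> I" "Fv k \<in> set is" "Ev k \<notin> set is" by blast
      have "\<alpha> (h (Fv k) # map h (remove1 (Fv k) is)) = 0"
      proof (rule fz[OF k(1)])
        show "set (remove1 (Fv k) is) \<subseteq> hix (I - {k})"
          using d k by (auto simp: set_remove1_eq intro!: inI)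
        show "Ev i \<in> set (remove1 (Fv k) is)" using i by (simp add: in_set_remove1)
      qed (use len[OF k(2)] c5 in simp)
      then show ?thesis by (rule alt_map_front[OF alt k(2) li])
    next
      case pairs: False
      show ?thesis
      proof (cases "\<exists>k\<in>I. Fv k \<in> set is")
        case True
        then obtain i where i: "i \<in> I" "Fv i \<in> set is" "Ev i \<in> set is" using pairs by blast
        have "card (set is - {Ev i}) < card I"
          using d li i c5 by (simp add: distinct_card)
        then obtain j where j: "j \<in> I" "Ev j \<notin> set is - {Ev i}" "Fv j \<notin> set is - {Ev i}"
          using exists_missing_index[of "set is - {Ev i}" I] by auto
        then have ij: "i \<noteq> j" using i by auto
        define R where "R = remove1 (Ev i) (remove1 (Fv i) is)"
        have sR: "set R = set is - {Ev i, Fv i}" unfolding R_def using d by (auto simp: set_remove1_eq)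
        have R: "Suc (Suc (length R)) = card I" unfolding R_def by (rule len') (use i in auto)
        have RI: "set R \<subseteq> hix (I - {i,j})" unfolding sR using j ij by (auto intro!: inI)
        have "R \<noteq> []" using R c5 by auto
        then obtain a where a: "a \<in> set R" by (cases R) auto
        then have "a \<in> hix (I - {i,j})" "a \<noteq> Gv" "a \<in> set is" using RI sR nG by auto
        then obtain l where l: "l \<in> I - {i,j}" "a = Ev l \<or> a = Fv l" by (cases rule: hix_cases) auto
        then have lR: "Ev l \<in> set R" using pairs \<open>a \<in> set is\<close> unfolding sR by auto
        have Rij: "set R \<subseteq> hix (I - {i})" "set R \<subseteq> hix (I - {j})" "Ev j \<in> hix (I - {i})"
            "Fv j \<in> hix (I - {i})" "Ev i \<in> hix (I - {j})"
          using RI hix_mono[of "I - {i,j}" "I - {i}"] hix_mono[of "I - {i,j}" "I - {j}"] i(1) j(1) ij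
          by (auto simp: hix_def)
        note e = eqEF[OF i(1) j(1) ij R RI lR]
        let ?M = "map h R"
        have f1: "\<alpha> (?f i # ?e j # ?M) = 0" and f2: "\<alpha> (?f j # ?e i # ?M) = 0"
          using fz[OF i(1), of "Ev j # R" j] fz[OF j(1), of "Ev i # R" i] R Rij by simp_all
        have "\<alpha> (?f i # ?f j # ?M) = 0"
          using fz[OF i(1), of "Fv j # R" l] R Rij lR by simp
        \<comment> \<open>The even part in t kills the value on (e_j, e_i), the odd part equates
          (e_j, f_j) with (f_i, e_i). Since \<open>eqFF\<close> equates (f_j, e_j) with (f_i, e_i),
          the common value is its own negative.\<close>
        with e[of 1] e[of "-1"] have e12: "\<alpha> (?e j # ?f j # ?M) - \<alpha> (?f i # ?e i # ?M) = \<alpha> (?e j # ?e i # ?M)"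
          "- (\<alpha> (?e j # ?f j # ?M) - \<alpha> (?f i # ?e i # ?M)) = \<alpha> (?e j # ?e i # ?M)"
          by (simp_all add: algebra_simps)
        then have "\<alpha> (?e j # ?e i # ?M) + \<alpha> (?e j # ?e i # ?M) = 0" by (metis add.right_inverse)
        then have "2 * \<alpha> (?e j # ?e i # ?M) = 0" by (simp only: mult_2)
        then have "\<alpha> (?e j # ?e i # ?M) = 0" using two_neq_0 by simp
        with e12(1) have x1: "\<alpha> (?e j # ?f j # ?M) = \<alpha> (?f i # ?e i # ?M)" by simp
        have "\<alpha> (?f j # ?e j # ?M) = \<alpha> (?f i # ?e i # ?M)"
          using eqFF[OF i(1) j(1) ij R RI] f1 f2 by simp
        moreover have "\<alpha> (?e j # ?f j # ?M) = - \<alpha> (?f j # ?e j # ?M)"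
          by (rule alt_snd(4)[OF alt]) (use R in simp)
        ultimately have "\<alpha> (?f i # ?e i # ?M) + \<alpha> (?f i # ?e i # ?M) = 0" using x1 by (metis add.right_inverse)
        then have "2 * \<alpha> (?f i # ?e i # ?M) = 0" by (simp only: mult_2)
        then have "\<alpha> (?f i # ?e i # ?M) = 0" using two_neq_0 by simp
        then show ?thesis using i li unfolding R_def by (intro alt_map_front2[OF alt, of "Fv i" "is" "Ev i"]) auto
      next
        case noF: False
        have sE: "set is \<subseteq> Ev ` I" using noF sub nG unfolding hix_def by blast
        have "length (remove1 (Ev i) is) > 0" using len[OF i(2)] c5 by simp
        then obtain b where b: "b \<in> set (remove1 (Ev i) is)" using nth_mem by blast
        then have "b \<in> set is" "b \<noteq> Ev i" using d by (auto simp: set_remove1_eq)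
        then obtain j where j: "j \<in> I" "Ev j \<in> set is" "i \<noteq> j" using sE by auto
        define R where "R = remove1 (Ev i) (remove1 (Ev j) is)"
        have sR: "set R = set is - {Ev i, Ev j}" unfolding R_def using d by (auto simp: set_remove1_eq)
        have R: "Suc (Suc (length R)) = card I" unfolding R_def by (rule len') (use i j in auto)
        have RI: "set R \<subseteq> hix (I - {i,j})" unfolding sR using sE by (auto simp: hix_def)
        have "R \<noteq> []" using R c5 by auto
        then obtain a where "a \<in> set R" by (cases R) auto
        then obtain l where lR: "Ev l \<in> set R" using sE sR by auto
        have Rij: "set R \<subseteq> hix (I - {i})" "set R \<subseteq> hix (I - {j})" "Ev j \<in> hix (I - {i})"
            "Fv j \<in> hix (I - {i})" "Ev i \<in> hix (I - {j})"
          using RI hix_mono[of "I - {i,j}" "I - {i}"] hix_mono[of "I - {i,j}" "I - {j}"] i(1) j(1) j(3)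
          by (auto simp: hix_def)
        note e = eqEF[OF i(1) j(1,3) R RI lR]
        let ?M = "map h R"
        \<comment> \<open>The coordinate to be killed contains e_i and e_j but none of the f's; f_i
          and f_j enter only through the move, and the even part in t of \<open>eqEF\<close> is the
          wanted value.\<close>
        have "\<alpha> (?f i # ?f j # ?M) = 0"
          using fz[OF i(1), of "Fv j # R" l] R Rij lR by simp
        with e[of 1] e[of "-1"] have e12: "\<alpha> (?e j # ?f j # ?M) - \<alpha> (?f i # ?e i # ?M) = \<alpha> (?e j # ?e i # ?M)"
          "- (\<alpha> (?e j # ?f j # ?M) - \<alpha> (?f i # ?e i # ?M)) = \<alpha> (?e j # ?e i # ?M)"
          by (simp_all add: algebra_simps)
        then have "\<alpha> (?e j # ?e i # ?M) + \<alpha> (?e j # ?e i # ?M) = 0" by (metis add.right_inverse)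
        then have "2 * \<alpha> (?e j # ?e i # ?M) = 0" by (simp only: mult_2)
        then have "\<alpha> (?e j # ?e i # ?M) = 0" using two_neq_0 by simp
        then show ?thesis using i j li unfolding R_def by (intro alt_map_front2[OF alt, of "Ev j" "is" "Ev i"]) auto
      qed
    qed
  qed
qed

section \<open>Induction on the degree\<close>

lemma pure_step:
  assumes fin: "finite I" and c: "card I \<ge> (if \<gamma> = 0 then 5 else 4)" and h: "hyperbolic I \<gamma> h"
    and alt: "alt_form s (card I) \<alpha>" and pu: "contractions_pure I \<gamma> h \<alpha>"
  shows "pure I h \<alpha>"
proof (cases "\<exists>h'. hyperbolic I \<gamma> h' \<and> hspan I h' \<subseteq> hspan I h \<and> \<alpha> (F_list h' I) \<noteq> 0")
  case False
  have "card I \<noteq> 0" using c by (auto split: if_splits)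
  then show ?thesis
    using alt_form_eq_0_if_frames[OF fin h alt] False by (intro pure_zero[OF fin]) auto
next
  case True
  then obtain h1 where h1: "hyperbolic I \<gamma> h1" "hspan I h1 \<subseteq> hspan I h" "\<alpha> (F_list h1 I) \<noteq> 0" by blast
  have c3: "card I \<ge> 3" using c by (auto split: if_splits)
  obtain h2 where h2: "hyperbolic I \<gamma> h2" "hspan I h2 = hspan I h1" "F_list h2 I = F_list h1 I" "normal I h2 \<alpha>"
    by (rule normalize[OF fin h1(1) c3 alt contractions_pure_mono[OF pu h1(2)] h1(3)])
  have hspan: "hspan I h2 = hspan I h" using hspan_eq[OF h h1(1) fin h1(2)] h2(2) by simp
  then have pu2: "contractions_pure I \<gamma> h2 \<alpha>" by (intro contractions_pure_mono[OF pu]) auto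
  have "pure I h2 \<alpha>"
  proof (cases "\<gamma> = 0")
    case True
    then show ?thesis using pure_normal_even[OF fin _ _ alt _ h2(4)] c h2(1,3) pu2 h1(3) by simp
  next
    case False
    then show ?thesis using pure_normal_odd[OF fin _ h2(1) False alt pu2 h2(4)] c h2(3) h1(3) by simp
  qed
  then show ?thesis unfolding pure_def hspan .
qed

text \<open>Applies \<open>pure_step\<close> repeatedly, descending to degree \<open>q\<close>. The
  bound on \<open>q\<close> guarantees that each degree above it is large enough for the
  step.\<close>

theorem pure_if_contractions_pure:
  assumes "finite I" "hyperbolic I \<gamma> h" "alt_form s (card I) \<alpha>" "q \<ge> (if \<gamma> = 0 then 4 else 3)" "card I \<ge> q"
    and "\<And>h' ks. hyperbolic I \<gamma> h' \<Longrightarrow> hspan I h' \<subseteq> hspan I h \<Longrightarrow> distinct ks \<Longrightarrow> set ks \<subseteq> I \<Longrightarrow> length ks + q = card I \<Longrightarrow>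
       pure (I - set ks) h' (\<lambda>S. \<alpha> (map (\<lambda>k. h' (Fv k)) ks @ S))"
  shows "pure I h \<alpha>"
  using assms
proof (induction "card I - q" arbitrary: I h \<alpha>)
  case 0
  then have "card I = q" by simp
  then show ?case using 0(7)[of h "[]"] 0(3) by simp
next
  case (Suc n)
  note fin = Suc.prems(1) and h = Suc.prems(2) and alt = Suc.prems(3)
  show ?case
  proof (rule pure_step[OF fin _ h alt])
    show "card I \<ge> (if \<gamma> = 0 then 5 else 4)" using Suc.hyps(2) Suc.prems(4) by (auto split: if_splits)
    show "contractions_pure I \<gamma> h \<alpha>"
      unfolding contractions_pure_def
    proof (intro allI impI)
      fix h' k assume h': "hyperbolic I \<gamma> h'" "hspan I h' \<subseteq> hspan I h" and k: "k \<in> I"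
      have ck: "Suc (card (I - {k})) = card I" using fin k by (metis card.remove)
      show "pure (I - {k}) h' (\<lambda>S. \<alpha> (h' (Fv k) # S))"
      proof (rule Suc.hyps(1))
        show "n = card (I - {k}) - q" "q \<le> card (I - {k})" using ck Suc.hyps(2) by linarith+
        show "finite (I - {k})" using fin by simp
        show "hyperbolic (I - {k}) \<gamma> h'" by (rule hyp_mono[OF h'(1)]) auto
        show "alt_form s (card (I - {k})) (\<lambda>S. \<alpha> (h' (Fv k) # S))"
          by (rule alt_form_Cons) (simp only: ck alt)
        show "(if \<gamma> = 0 then 4 else 3) \<le> q" by (rule Suc.prems(4))
        fix h1 ks assume h1: "hyperbolic (I - {k}) \<gamma> h1" "hspan (I - {k}) h1 \<subseteq> hspan (I - {k}) h'"
          and ks: "distinct ks" "set ks \<subseteq> I - {k}" "length ks + q = card (I - {k})"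
        \<comment> \<open>Completing \<open>h1\<close> by the pair \<open>k\<close> turns the
          contraction of a contraction into a contraction of \<open>\<alpha>\<close> along
          \<open>k # ks\<close>.\<close>
        let ?h2 = "h1(Ev k := h' (Ev k), Fv k := h' (Fv k))"
        note e = hyp_extend[OF h'(1) k h1]
        have "pure (I - set (k # ks)) ?h2 (\<lambda>S. \<alpha> (map (\<lambda>k. ?h2 (Fv k)) (k # ks) @ S))"
          by (rule Suc.prems(6)) (use e h' k ks ck in auto)
        moreover have "map (\<lambda>k. ?h2 (Fv k)) (k # ks) = h' (Fv k) # map (\<lambda>k. h1 (Fv k)) ks"
          using ks(2) by auto
        moreover have "I - set (k # ks) = I - {k} - set ks" by auto
        ultimately have "pure (I - {k} - set ks) ?h2 (\<lambda>S. \<alpha> (h' (Fv k) # map (\<lambda>k. h1 (Fv k)) ks @ S))"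
          by (simp only: append_Cons)
        moreover have "?h2 a = h1 a" if "a \<in> hix (I - {k} - set ks)" for a
          using that by (auto simp: hix_def)
        ultimately show "pure (I - {k} - set ks) h1 (\<lambda>S. \<alpha> (h' (Fv k) # map (\<lambda>k. h1 (Fv k)) ks @ S))"
          using pure_cong[of "I - {k} - set ks" ?h2 h1] by blast
      qed
    qed
  qed
qed

end

section \<open>Exterior powers and alternating forms\<close>

definition ext_eval :: "('v list \<Rightarrow> 'k) \<Rightarrow> ('v list \<Rightarrow>\<^sub>0 'k::field) \<Rightarrow> 'k" where
  "ext_eval \<phi> x = (\<Sum>vs\<in>Poly_Mapping.keys x. Poly_Mapping.lookup x vs * \<phi> vs)"

text \<open>The linear extension of a map on lists. Since \<open>f\<close> may involve choices, it
  descends to exterior powers only under extra conditions.\<close>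

definition ext_push :: "('v list \<Rightarrow> 'w list) \<Rightarrow> ('v list \<Rightarrow>\<^sub>0 'k::field) \<Rightarrow> ('w list \<Rightarrow>\<^sub>0 'k)" where
  "ext_push f x = (\<Sum>vs\<in>Poly_Mapping.keys x. Poly_Mapping.single (f vs) (Poly_Mapping.lookup x vs))"

lemma sum_keys_superset:
  fixes F :: "'a \<Rightarrow> 'k::zero \<Rightarrow> 'b::comm_monoid_add"
  assumes "finite A" "Poly_Mapping.keys x \<subseteq> A" "\<And>a. F a 0 = 0"
  shows "(\<Sum>a\<in>Poly_Mapping.keys x. F a (Poly_Mapping.lookup x a)) = (\<Sum>a\<in>A. F a (Poly_Mapping.lookup x a))"
  using assms by (intro sum.mono_neutral_left) (auto simp: in_keys_iff)

lemma sum_keys_add: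
  fixes F :: "'a \<Rightarrow> 'k::monoid_add \<Rightarrow> 'b::comm_monoid_add"
  assumes "\<And>a. F a 0 = 0" "\<And>a c d. F a (c + d) = F a c + F a d"
  shows "(\<Sum>a\<in>Poly_Mapping.keys (x + y). F a (Poly_Mapping.lookup (x + y) a)) =
    (\<Sum>a\<in>Poly_Mapping.keys x. F a (Poly_Mapping.lookup x a)) + (\<Sum>a\<in>Poly_Mapping.keys y. F a (Poly_Mapping.lookup y a))"
proof -
  let ?A = "Poly_Mapping.keys x \<union> Poly_Mapping.keys y"
  have "finite ?A" "Poly_Mapping.keys (x + y) \<subseteq> ?A" by (auto simp: keys_add)
  moreover have "Poly_Mapping.keys x \<subseteq> ?A" "Poly_Mapping.keys y \<subseteq> ?A" by auto
  ultimately show ?thesis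
    using sum_keys_superset[of ?A "x + y" F] sum_keys_superset[of ?A x F] sum_keys_superset[of ?A y F] assms
    by (simp add: lookup_add sum.distrib)
qed

lemma sum_keys_scale:
  fixes F :: "'a \<Rightarrow> 'k::field \<Rightarrow> 'b::comm_monoid_add"
  assumes "\<And>a. F a 0 = 0"
  shows "(\<Sum>a\<in>Poly_Mapping.keys (free_scale c x). F a (Poly_Mapping.lookup (free_scale c x) a)) =
    (\<Sum>a\<in>Poly_Mapping.keys x. F a (c * Poly_Mapping.lookup x a))"
proof -
  have "Poly_Mapping.keys (free_scale c x) \<subseteq> Poly_Mapping.keys x" by (auto simp: in_keys_iff)
  then show ?thesis
    using sum_keys_superset[of "Poly_Mapping.keys x" "free_scale c x" F] assms by simp
qed

lemma ext_eval_add: "ext_eval \<phi> (x + y) = ext_eval \<phi> x + ext_eval \<phi> y"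
  unfolding ext_eval_def by (rule sum_keys_add) (auto simp: distrib_right)

lemma ext_eval_scale: "ext_eval \<phi> (free_scale c x) = c * ext_eval \<phi> x"
  unfolding ext_eval_def sum_distrib_left
  using sum_keys_scale[of "\<lambda>a d. d * \<phi> a" c x] by (simp add: mult.assoc)

lemma ext_eval_zero [simp]: "ext_eval \<phi> 0 = 0"
  by (simp add: ext_eval_def)

lemma ext_eval_diff: "ext_eval \<phi> (x - y) = ext_eval \<phi> x - ext_eval \<phi> y"
  using ext_eval_add[of \<phi> "x - y" y] by simp

lemma ext_eval_single [simp]: "ext_eval \<phi> (Poly_Mapping.single vs c) = c * \<phi> vs"
  by (cases "c = 0") (auto simp: ext_eval_def)

lemma ext_eval_sum_fun: "ext_eval (\<lambda>vs. \<Sum>a\<in>A. c a * \<phi> a vs) x = (\<Sum>a\<in>A. c a * ext_eval (\<phi> a) x)"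
  unfolding ext_eval_def sum_distrib_left
  by (subst sum.swap) (simp add: sum_distrib_left mult.left_commute)

lemma ext_eval_cong:
  "x \<in> ext_free k \<Longrightarrow> (\<And>vs. length vs = k \<Longrightarrow> \<phi> vs = \<psi> vs) \<Longrightarrow> ext_eval \<phi> x = ext_eval \<psi> x"
  unfolding ext_eval_def ext_free_def by (intro sum.cong) auto

lemma alt_form_ext_eval:
  assumes "x \<in> ext_free k" "\<And>vs. length vs = k \<Longrightarrow> alt_form s n (\<phi> vs)"
  shows "alt_form s n (\<lambda>ys. ext_eval (\<lambda>vs. \<phi> vs ys) x)"
  unfolding ext_eval_def
  by (intro alt_form_sum alt_form_cmult assms(2)) (use assms(1) in \<open>simp add: ext_free_def\<close>)

lemma ext_eval_ext_push: "ext_eval \<psi> (ext_push f x) = ext_eval (\<lambda>vs. \<psi> (f vs)) x"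
proof -
  have "ext_eval \<psi> (\<Sum>vs\<in>A. Poly_Mapping.single (f vs) (c vs)) = (\<Sum>vs\<in>A. c vs * \<psi> (f vs))" for A c
    by (induction A rule: infinite_finite_induct) (simp_all add: ext_eval_add)
  then show ?thesis by (simp add: ext_push_def ext_eval_def[of _ x])
qed

lemma ext_push_add: "ext_push f (x + y) = ext_push f x + ext_push f y"
  unfolding ext_push_def by (rule sum_keys_add) (auto simp: single_add)

lemma free_scale_single: "free_scale c (Poly_Mapping.single a d) = Poly_Mapping.single a (c * d)"
  by (rule poly_mapping_eqI) (simp add: lookup_single when_def)

lemma ext_push_scale: "ext_push f (free_scale c x) = free_scale c (ext_push f x)"
  unfolding ext_push_def free_vs.scale_sum_right free_scale_single
  by (rule sum_keys_scale) simp

lemma ext_free_closed: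
  "0 \<in> ext_free k" "x \<in> ext_free k \<Longrightarrow> y \<in> ext_free k \<Longrightarrow> x + y \<in> ext_free k"
  "x \<in> ext_free k \<Longrightarrow> free_scale c x \<in> ext_free k"
  "length vs = k \<Longrightarrow> Poly_Mapping.single vs c \<in> ext_free k"
proof -
  show "x \<in> ext_free k \<Longrightarrow> y \<in> ext_free k \<Longrightarrow> x + y \<in> ext_free k"
    unfolding ext_free_def using keys_add[of x y] by blast
  show "x \<in> ext_free k \<Longrightarrow> free_scale c x \<in> ext_free k"
    unfolding ext_free_def by (auto simp: in_keys_iff)
qed (auto simp: ext_free_def)

lemma ext_push_ext_free:
  fixes x :: "'v list \<Rightarrow>\<^sub>0 'k::field"
  assumes "x \<in> ext_free p" "\<And>vs. length vs = p \<Longrightarrow> length (f vs) = q"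
  shows "ext_push f x \<in> ext_free q"
proof -
  have "(\<Sum>vs\<in>A. Poly_Mapping.single (f vs) (c vs)) \<in> ext_free q"
    if "\<And>vs. vs \<in> A \<Longrightarrow> length (f vs) = q" for A and c :: "'v list \<Rightarrow> 'k"
    using that by (induction A rule: infinite_finite_induct) (auto intro: ext_free_closed)
  then show ?thesis unfolding ext_push_def using assms by (auto simp: ext_free_def)
qed

section \<open>Relations of the exterior power and alternating forms\<close>

text \<open>The three clauses of \<open>alt_form\<close> correspond to the three families of
  \<open>ext_relators\<close>, so an alternating form is a functional on the quotient.\<close>

lemma ext_eval_null:
  assumes "alt_form s k \<phi>" "x \<in> ext_null s k"
  shows "ext_eval \<phi> x = 0"
  using assms(2) unfolding ext_null_def
proof (induction rule: free_vs.span_induct)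
  case base
  show ?case by (rule free_vs.subspaceI) (auto simp: ext_eval_add ext_eval_scale)
next
  case (step x)
  then show ?case unfolding ext_relators_def
    by (auto simp: ext_eval_diff ext_eval_scale alt_form_add[OF assms(1)] alt_form_scale[OF assms(1)]
        alt_form_not_distinct[OF assms(1)])
qed

lemma (in vector_space) separating_functional:
  assumes "x \<notin> span R"
  obtains f where "Vector_Spaces.linear scale (*) f" "\<And>y. y \<in> span R \<Longrightarrow> f y = 0" "f x = 1"
proof -
  interpret vp: vector_space_pair scale "(*) :: 'a \<Rightarrow> 'a \<Rightarrow> 'a" ..
  obtain C where C: "C \<subseteq> R" "independent C" "R \<subseteq> span C"
    using maximal_independent_subset[of R] by blast
  have "span C = span R"
    using C by (metis span_mono span_span subset_antisym)
  then have xC: "x \<notin> span C" using assms by simp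
  then have ind: "independent (insert x C)" "x \<notin> C"
    using independent_insertI[OF xC C(2)] span_base[of x C] by blast+
  obtain g where g: "Vector_Spaces.linear scale (*) g" "\<forall>y\<in>insert x C. g y = (if y = x then 1 else 0)"
    using vp.linear_independent_extend[OF ind(1), of "\<lambda>y. if y = x then 1 else 0"] by blast
  show ?thesis
  proof
    show "Vector_Spaces.linear scale (*) g" by fact
    show "g x = 1" using g(2) by simp
    fix y assume "y \<in> span R"
    then have "y \<in> span C" using \<open>span C = span R\<close> by simp
    then show "g y = 0"
      by (rule vp.linear_eq_0_on_span[OF g(1), rotated]) (use g(2) ind(2) in auto)
  qed
qed

lemma alt_form_functional:
  fixes s :: "'k::field \<Rightarrow> 'v::ab_group_add \<Rightarrow> 'v"
  assumes "Vector_Spaces.linear free_scale (*) f" "\<And>y. y \<in> ext_null s k \<Longrightarrow> f y = 0"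
  shows "alt_form s k (\<lambda>vs. f (Poly_Mapping.single vs 1))"
proof (rule alt_formI)
  interpret f: Vector_Spaces.linear free_scale "(*)" f by fact
  have rel: "f r = 0" if "r \<in> ext_relators s k" for r
    using assms(2)[of r] that unfolding ext_null_def by (auto intro: free_vs.span_base)
  let ?s = "\<lambda>vs :: 'v list. Poly_Mapping.single vs (1::'k)"
  fix xs ys :: "'v list" and u v c assume l: "length xs + 1 + length ys = k"
  have "?s (xs @ (u + v) # ys) - ?s (xs @ u # ys) - ?s (xs @ v # ys) \<in> ext_relators s k"
    unfolding ext_relators_def using l by blast
  from rel[OF this] show "f (?s (xs @ (u + v) # ys)) = f (?s (xs @ u # ys)) + f (?s (xs @ v # ys))"
    unfolding f.diff by (simp add: diff_eq_eq add.commute)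
  have "?s (xs @ s c u # ys) - free_scale c (?s (xs @ u # ys)) \<in> ext_relators s k"
    unfolding ext_relators_def using l by blast
  from rel[OF this] show "f (?s (xs @ s c u # ys)) = c * f (?s (xs @ u # ys))"
    by (simp add: f.diff f.scale)
next
  fix vs :: "'v list" assume "length vs = k" "\<not> distinct vs"
  then have "Poly_Mapping.single vs 1 \<in> ext_relators s k" unfolding ext_relators_def by blast
  then show "f (Poly_Mapping.single vs 1) = 0"
    using assms(2) unfolding ext_null_def by (auto intro: free_vs.span_base)
qed

lemma functional_eq_ext_eval:
  assumes "Vector_Spaces.linear free_scale (*) f"
  shows "f x = ext_eval (\<lambda>vs. f (Poly_Mapping.single vs 1)) x"
proof -
  interpret f: Vector_Spaces.linear free_scale "(*)" f by fact
  have "x = (\<Sum>vs\<in>Poly_Mapping.keys x. free_scale (Poly_Mapping.lookup x vs) (Poly_Mapping.single vs 1))"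
  proof (rule poly_mapping_eqI)
    fix a
    have "(\<Sum>vs\<in>Poly_Mapping.keys x. Poly_Mapping.lookup (Poly_Mapping.single vs (Poly_Mapping.lookup x vs)) a)
      = (\<Sum>vs\<in>Poly_Mapping.keys x. if vs = a then Poly_Mapping.lookup x a else 0)"
      by (intro sum.cong) (auto simp: lookup_single when_def)
    then show "Poly_Mapping.lookup x a = Poly_Mapping.lookup (\<Sum>vs\<in>Poly_Mapping.keys x.
        free_scale (Poly_Mapping.lookup x vs) (Poly_Mapping.single vs 1)) a"
      by (simp add: free_scale_single lookup_sum in_keys_iff)
  qed
  then have "f x = f (\<Sum>vs\<in>Poly_Mapping.keys x. free_scale (Poly_Mapping.lookup x vs) (Poly_Mapping.single vs 1))"
    by simp
  also have "\<dots> = ext_eval (\<lambda>vs. f (Poly_Mapping.single vs 1)) x"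
    by (simp add: f.sum f.scale ext_eval_def)
  finally show ?thesis .
qed

context quad_space
begin

text \<open>Nondegeneracy of the pairing on the exterior power. Outside the relations, some
  functional separates \<open>x\<close>; it is an alternating form, hence a combination of Gram
  forms, and these all vanish on \<open>x\<close>.\<close>

lemma ext_null_if_gram_0:
  assumes h: "hyperbolic I \<gamma> h" and fin: "finite I" and full: "hspan I h = UNIV" and x: "x \<in> ext_free k"
    and z: "\<And>z. length z = k \<Longrightarrow> ext_eval (\<lambda>vs. gram B vs z) x = 0"
  shows "x \<in> ext_null s k"
proof (rule ccontr)
  assume "x \<notin> ext_null s k"
  then obtain f where f: "Vector_Spaces.linear free_scale (*) f" "\<And>y. y \<in> ext_null s k \<Longrightarrow> f y = 0" "f x = 1"
    unfolding ext_null_def by (rule free_vs.separating_functional) auto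
  define \<phi> where "\<phi> vs = f (Poly_Mapping.single vs 1)" for vs
  have alt: "alt_form s k \<phi>" unfolding \<phi>_def by (rule alt_form_functional[OF f(1,2)])
  let ?J = "hixg I \<gamma>" and ?d = "hdual \<gamma> h"
  define A where "A = {X. X \<subseteq> ?J \<and> card X = k}"
  have finA: "finite A" unfolding A_def using finite_hixg[OF fin] by simp
  \<comment> \<open>One enumeration for each set of k basis indices, that is, one representative of
    each basis wedge.\<close>
  define c where "c X = (SOME is. distinct is \<and> set is = X)" for X :: "hyp_index set"
  have c: "distinct (c X)" "set (c X) = X" "length (c X) = k" if "X \<in> A" for X
  proof -
    have "finite X" using that finite_hixg[OF fin] unfolding A_def by (auto intro: finite_subset)
    then have "\<exists>is. distinct is \<and> set is = X" using finite_distinct_list by blast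
    from someI_ex[OF this] show 1: "distinct (c X)" "set (c X) = X" unfolding c_def by auto
    then show "length (c X) = k" using that unfolding A_def by (metis (mono_tags, lifting) distinct_card mem_Collect_eq)
  qed
  \<comment> \<open>The expansion of \<open>\<phi>\<close> in the Gram forms of the dual basis
    wedges; both agree on basis wedges by \<open>dia\<close>.\<close>
  define \<psi> where "\<psi> vs = (\<Sum>X\<in>A. \<phi> (map h (c X)) * gram B vs (map ?d (c X)))" for vs
  have altp: "alt_form s k \<psi>"
    unfolding \<psi>_def
  proof (intro alt_form_sum alt_form_cmult)
    fix X assume "X \<in> A"
    then show "alt_form s k (\<lambda>vs. gram B vs (map ?d (c X)))"
      using alt_form_gram_left[of "map ?d (c X)"] c(3) by simp
  qed
  note altd = alt_form_diff[OF alt altp]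
  have dia: "gram B (map h (c X)) (map ?d (c Y)) = (if X = Y then 1 else 0)" if XY: "X \<in> A" "Y \<in> A" for X Y
  proof (cases "X = Y")
    case True
    then show ?thesis
      using gram_dual[OF c(1)[OF XY(1)], of h ?d] B_hdual[OF h] c(2)[OF XY(1)] XY(1)
      unfolding A_def by auto
  next
    case False
    have "finite Y" "card X = card Y" using XY finite_hixg[OF fin] unfolding A_def by (auto intro: finite_subset)
    then have "\<not> X \<subseteq> Y" using False by (metis card_subset_eq)
    then obtain a where a: "a \<in> X" "a \<notin> Y" by auto
    have "gram B (map h (c X)) (map ?d (c Y)) = 0"
    proof (rule gram_eq_0_row[of "h a"])
      show "h a \<in> set (map h (c X))" using a c(2)[OF XY(1)] by simp
      fix y assume "y \<in> set (map ?d (c Y))"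
      then obtain b where b: "b \<in> Y" "y = ?d b" using c(2)[OF XY(2)] by auto
      moreover have "a \<in> ?J" "b \<in> ?J" using a(1) b(1) XY unfolding A_def by auto
      moreover have "a \<noteq> b" using a(2) b(1) by auto
      ultimately show "B (h a) y = 0" using B_hdual[OF h, of a b] by simp
    qed (use c(3) XY in simp)
    then show ?thesis using False by simp
  qed
  have "\<phi> vs - \<psi> vs = 0" if "length vs = k" for vs
  proof (rule alt_form_eq_0_on_span[OF altd])
    show "set vs \<subseteq> span (h ` ?J)" using hspan_hixg[OF h] full by simp
    fix "is" assume i: "distinct is" "set is \<subseteq> ?J" "length is = k"
    then have X: "set is \<in> A" unfolding A_def by (simp add: distinct_card)
    have "mset is = mset (c (set is))"
      using c[OF X] i(1) by (simp add: set_eq_iff_mset_eq_distinct[symmetric])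
    then have m: "mset (map h is) = mset (map h (c (set is)))" unfolding mset_map by simp
    have "\<psi> (map h (c (set is))) = (\<Sum>Y\<in>A. if set is = Y then \<phi> (map h (c (set is))) else 0)"
      unfolding \<psi>_def by (intro sum.cong) (auto simp: dia[OF X])
    then have "\<phi> (map h (c (set is))) - \<psi> (map h (c (set is))) = 0" using finA X by simp
    from alt_form_perm_eq_0[OF altd this m] i(3) show "\<phi> (map h is) - \<psi> (map h is) = 0" by simp
  qed (use that in simp)
  then have "ext_eval \<phi> x = ext_eval \<psi> x" by (intro ext_eval_cong[OF x]) simp
  also have "\<dots> = (\<Sum>X\<in>A. \<phi> (map h (c X)) * ext_eval (\<lambda>vs. gram B vs (map ?d (c X))) x)"
    unfolding \<psi>_def by (rule ext_eval_sum_fun)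
  also have "\<dots> = 0" using z c(3) by (intro sum.neutral) simp
  finally show False using functional_eq_ext_eval[OF f(1), of x] f(3) unfolding \<phi>_def by simp
qed

section \<open>Contraction of decomposable elements\<close>

lemma alt_form_row_ops:
  assumes "alt_form s n \<phi>" "Suc (length xs + length ws) = n"
  shows "\<phi> (v # xs @ map (\<lambda>w. w - s (c w) v) ws) = \<phi> (v # xs @ ws)"
  using assms(2)
proof (induction ws arbitrary: xs)
  case (Cons w ws)
  have l: "length (v # xs) + 1 + length ws = n" using Cons.prems by simp
  have "\<phi> ((v # xs) @ v # ws) = 0" using l by (intro alt_form_not_distinct[OF assms(1)]) auto
  then have "\<phi> ((v # xs) @ (w - s (c w) v) # ws) = \<phi> ((v # xs) @ w # ws)"
    using alt_form_add[OF assms(1) l, of "w - s (c w) v" "s (c w) v"] alt_form_scale[OF assms(1) l, of "c w" v] by simp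
  with Cons.IH[of "xs @ [w - s (c w) v]"] Cons.prems show ?case by simp
qed simp

text \<open>Gaussian elimination: multiples of a pivot \<open>v\<close> with
  \<open>B v x \<noteq> 0\<close> are subtracted to make the other factors orthogonal to
  \<open>x\<close>, after which only the pivot meets the column of \<open>x\<close>. Without a pivot
  the contraction is 0.\<close>

lemma gram_contract1:
  assumes "length vs = Suc n" "n \<ge> 1"
  shows "\<exists>us. length us = n \<and> set us \<subseteq> span (set vs) \<and> (\<forall>u\<in>set us. B u x = 0) \<and>
    (\<forall>ys. length ys = n \<longrightarrow> gram B vs (x # ys) = gram B us ys)"
proof (cases "\<exists>v\<in>set vs. B v x \<noteq> 0")
  case False
  have "gram B vs (x # ys) = gram B (replicate n 0) ys" if "length ys = n" for ys
    using that assms False gram_eq_0_col[of x "x # ys" vs] gram_eq_0_row[of 0 "replicate n 0" ys B] by simp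
  then show ?thesis
    by (intro exI[of _ "replicate n 0"]) (auto simp: span_zero)
next
  case True
  then obtain v where v: "v \<in> set vs" "B v x \<noteq> 0" by blast
  define ws where "ws = remove1 v vs"
  have lw: "length ws = n" using v assms by (simp add: ws_def length_remove1)
  have "mset vs = mset (v # ws)" using v by (simp add: ws_def)
  then obtain \<epsilon> where \<epsilon>: "\<And>\<phi>. alt_form s (Suc n) \<phi> \<Longrightarrow> \<phi> vs = \<epsilon> * \<phi> (v # ws)"
    using alt_form_perm[of vs "v # ws" "Suc n" s] assms by blast
  define ws' where "ws' = map (\<lambda>w. w - s (B w x / B v x) v) ws"
  have lw': "length ws' = n" using lw by (simp add: ws'_def)
  have sw: "set ws' \<subseteq> span (set vs)"
  proof
    fix u assume "u \<in> set ws'"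
    then obtain w where "w \<in> set vs" "u = w - s (B w x / B v x) v"
      using notin_set_remove1 unfolding ws'_def ws_def by fastforce
    then show "u \<in> span (set vs)" using v(1) by (simp only: span_diff span_scale span_base)
  qed
  have zw: "B w x = 0" if "w \<in> set ws'" for w
    using that v by (auto simp: ws'_def B_simps)
  obtain w0 wr where w0: "ws' = w0 # wr" using lw' assms(2) by (cases ws') auto
  \<comment> \<open>The sign of the reordering and the pivot are absorbed by one factor, which
    exists because \<open>n \<ge> 1\<close>.\<close>
  let ?us = "s (\<epsilon> * B v x) w0 # wr"
  have "gram B vs (x # ys) = gram B ?us ys" if ys: "length ys = n" for ys
  proof -
    have alt: "alt_form s (Suc n) (\<lambda>us. gram B us (x # ys))" using alt_form_gram_left[of "x # ys"] ys by simp
    have "gram B vs (x # ys) = \<epsilon> * gram B (v # ws) (x # ys)" by (rule \<epsilon>[OF alt])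
    also have "gram B (v # ws) (x # ys) = gram B (v # ws') (x # ys)"
      using alt_form_row_ops[OF alt, of "[]" ws v "\<lambda>w. B w x / B v x"] lw by (simp add: ws'_def)
    also have "\<dots> = B v x * gram B ws' ys" by (rule gram_Cons_Cons) (use lw' ys zw in auto)
    also have "\<epsilon> * (B v x * gram B ws' ys) = gram B ?us ys"
    proof -
      have "alt_form s n (\<lambda>us. gram B us ys)" using alt_form_gram_left[of ys] ys by simp
      from alt_form_scale[OF this, of "[]" wr "\<epsilon> * B v x" w0] show ?thesis
        using w0 lw' by simp
    qed
    finally show ?thesis .
  qed
  then show ?thesis
    using sw zw lw' w0 by (intro exI[of _ ?us]) (auto simp: B_simps span_scale)
qed

text \<open>As the new factors stay in the span of the old ones, the contraction of an isotropic
  wedge is isotropic. Their orthogonality to \<open>xs\<close> later makes the projection to the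
  remaining pairs preserve products.\<close>

lemma gram_contract:
  assumes "length vs = length xs + n" "n \<ge> 1"
  shows "\<exists>us. length us = n \<and> set us \<subseteq> span (set vs) \<and> (\<forall>u\<in>set us. \<forall>x\<in>set xs. B u x = 0) \<and>
    (\<forall>ys. length ys = n \<longrightarrow> gram B vs (xs @ ys) = gram B us ys)"
  using assms(1)
proof (induction xs arbitrary: vs)
  case Nil
  then show ?case by (intro exI[of _ vs]) (auto intro: span_base)
next
  case (Cons x xs)
  obtain vs1 where v1: "length vs1 = length xs + n" "set vs1 \<subseteq> span (set vs)" "\<And>u. u \<in> set vs1 \<Longrightarrow> B u x = 0"
    "\<And>ys. length ys = length xs + n \<Longrightarrow> gram B vs (x # ys) = gram B vs1 ys"
    using gram_contract1[of vs "length xs + n" x] Cons.prems assms(2) by auto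
  obtain us where u: "length us = n" "set us \<subseteq> span (set vs1)" "\<And>u y. u \<in> set us \<Longrightarrow> y \<in> set xs \<Longrightarrow> B u y = 0"
    "\<And>ys. length ys = n \<Longrightarrow> gram B vs1 (xs @ ys) = gram B us ys"
    using Cons.IH[OF v1(1)] by blast
  have "span (set vs1) \<subseteq> span (set vs)" using v1(2) by (intro span_minimal) (auto simp: subspace_span)
  moreover have "B u x = 0" if "u \<in> set us" for u
    using u(2) that by (intro B_span_eq_0[of u "set vs1"] v1(3)) auto
  ultimately show ?case using u v1(4) by (intro exI[of _ us]) auto
qed

end

section \<open>Quadratic spaces and existence of hyperbolic bases\<close>

lemma quad_spaceI:
  fixes s :: "'k::field \<Rightarrow> 'v::ab_group_add \<Rightarrow> 'v"
  assumes "finite_dimensional_vector_space s C" "nondegenerate_symmetric_form s B" "(2::'k) \<noteq> 0"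
  shows "quad_space s B C"
proof -
  interpret finite_dimensional_vector_space s C by fact
  show ?thesis
  proof
    fix u v w c
    have "Vector_Spaces.linear s (*) (\<lambda>u. B u w)"
      using assms(2) by (simp add: nondegenerate_symmetric_form_def)
    then show "B (u + v) w = B u w + B v w" "B (s c u) w = c * B u w"
      by (simp_all add: Vector_Spaces.linear_iff)
    show "B u w = B w u" using assms(2) by (simp add: nondegenerate_symmetric_form_def)
    show "u = 0" if "\<And>w. B u w = 0"
      using assms(2) that by (simp add: nondegenerate_symmetric_form_def)
  qed fact
qed

lemma two_neq_0_if_CHAR:
  assumes "CHAR('k::field) \<noteq> 2"
  shows "(2::'k) \<noteq> 0"
proof
  assume "(2::'k) = 0"
  then have "of_nat 2 = (0::'k)" by simp
  then have d: "CHAR('k) dvd 2" by (simp only: of_nat_eq_0_iff_char_dvd)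
  then have "CHAR('k) \<le> 2" by (rule dvd_imp_le) simp
  moreover have "CHAR('k) \<noteq> 1" by (metis of_nat_1 of_nat_CHAR zero_neq_one)
  moreover have "CHAR('k) \<noteq> 0" using d by (metis dvd_0_left_iff zero_neq_numeral)
  ultimately show False using assms by simp
qed

lemma iso_grassmann_cone_scaled_form:
  fixes r :: "'k::field"
  assumes "r \<noteq> 0"
  shows "iso_grassmann_cone s (\<lambda>u w. r * B u w) k = iso_grassmann_cone s B k"
proof -
  have "isotropic (\<lambda>u w. r * B u w) L = isotropic B L" for L
    using assms by (simp add: isotropic_def)
  then show ?thesis by (simp add: iso_grassmann_cone_def)
qed

context quad_space
begin

lemma nondegenerate_form: "nondegenerate_symmetric_form s B"
  unfolding nondegenerate_symmetric_form_def Vector_Spaces.linear_iff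
  using nondegenerate B_sym by (simp add: vector_space_axioms vector_space_over_itself.vector_space_axioms B_simps)

lemma quad_space_scaled_form: "r \<noteq> 0 \<Longrightarrow> quad_space s (\<lambda>u w. r * B u w) Basis"
proof
  fix u v w c assume r: "r \<noteq> 0"
  show "r * B (u + v) w = r * B u w + r * B v w" "r * B (s c u) w = c * (r * B u w)" "r * B u w = r * B w u"
    by (simp_all add: B_simps distrib_left B_sym[of w u])
  show "u = 0" if "\<And>w. r * B u w = 0" using nondegenerate[of u] that r by simp
qed (rule two_neq_0)

text \<open>A finite span is its own double orthogonal complement. The induction removes
  \<open>w\<close> from \<open>x\<close> by means of a vector \<open>v0\<close> that detects
  \<open>w\<close>, and afterwards corrects the separating vector by \<open>v0\<close>.\<close>

lemma nondeg_separate: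
  "x \<notin> span (set xs) \<Longrightarrow> \<exists>v. (\<forall>a\<in>set xs. B v a = 0) \<and> B v x \<noteq> 0"
proof (induction xs arbitrary: x)
  case Nil
  then have "x \<noteq> 0" by auto
  then obtain w where "B x w \<noteq> 0" using nondegenerate by blast
  then show ?case using B_sym[of x w] by auto
next
  case (Cons w xs)
  show ?case
  proof (cases "w \<in> span (set xs)")
    case True
    then have "x \<notin> span (set xs)" using Cons.prems by (simp add: span_redundant)
    then obtain v where v: "\<forall>a\<in>set xs. B v a = 0" "B v x \<noteq> 0" using Cons.IH by blast
    then have "B v w = 0" using B_span_eq_0'[OF True] by blast
    then show ?thesis using v by auto
  next
    case False
    then obtain v0 where v0: "\<forall>a\<in>set xs. B v0 a = 0" "B v0 w \<noteq> 0" using Cons.IH by blast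
    define x' where "x' = x - s (B v0 x / B v0 w) w"
    have "x' \<notin> span (set xs)"
    proof
      assume "x' \<in> span (set xs)"
      then have "x' \<in> span (set (w # xs))" using span_mono[of "set xs" "set (w # xs)"] by auto
      moreover have "s (B v0 x / B v0 w) w \<in> span (set (w # xs))" by (intro span_scale span_base) simp
      ultimately have "x' + s (B v0 x / B v0 w) w \<in> span (set (w # xs))" by (rule span_add)
      then show False using Cons.prems by (simp add: x'_def)
    qed
    then obtain v1 where v1: "\<forall>a\<in>set xs. B v1 a = 0" "B v1 x' \<noteq> 0" using Cons.IH by blast
    let ?v = "v1 - s (B v1 w / B v0 w) v0"
    have "B ?v w = 0" using v0 by (simp add: B_simps)
    moreover have "B ?v x = B v1 x'" by (simp add: x'_def B_simps)
    moreover have "\<forall>a\<in>set xs. B ?v a = 0" using v0 v1 by (simp add: B_simps)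
    ultimately show ?thesis using v1(2) by (intro exI[of _ ?v]) auto
  qed
qed

lemma hyp_exists_isotropic:
  assumes L: "independent L" "card L = p" "finite L" "isotropic B L"
  shows "\<exists>h. hyperbolic {..<p} 0 h"
proof -
  obtain f where f: "bij_betw f {..<p} L"
    using ex_bij_betw_nat_finite[OF L(3)] L(2) by (auto simp: atLeast0LessThan)
  then have fL: "i < p \<Longrightarrow> f i \<in> L" for i by (auto simp: bij_betw_def)
  have "\<exists>v. \<forall>j<p. B v (f j) = (if i = j then 1 else 0)" if i: "i < p" for i
  proof -
    have "f i \<notin> span (L - {f i})" using L(1) fL[OF i] by (auto simp: dependent_def)
    moreover obtain xs where xs: "set xs = L - {f i}" using finite_list[of "L - {f i}"] L(3) by auto
    ultimately obtain v where v: "\<forall>a\<in>L - {f i}. B v a = 0" "B v (f i) \<noteq> 0"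
      using nondeg_separate[of "f i" xs] by auto
    have "B (s (1 / B v (f i)) v) (f j) = (if i = j then 1 else 0)" if "j < p" for j
    proof (cases "i = j")
      case False
      then have "f j \<in> L - {f i}" using f i that by (auto simp: bij_betw_def inj_on_def)
      then show ?thesis using v False by (simp add: B_simps)
    qed (use v in \<open>simp add: B_simps\<close>)
    then show ?thesis by blast
  qed
  then obtain d where d: "\<And>i j. i < p \<Longrightarrow> j < p \<Longrightarrow> B (d i) (f j) = (if i = j then 1 else 0)" by metis
  have ff: "B (f i) (f j) = 0" if "i < p" "j < p" for i j
    using L(4) fL that by (simp add: isotropic_def)
  \<comment> \<open>Half of the Gram matrix of the \<open>d i\<close> is subtracted along the
    isotropic \<open>f j\<close>: this leaves the duality intact and makes the e's
    isotropic.\<close>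
  define e where "e i = d i - (\<Sum>j<p. s (B (d i) (d j) / 2) (f j))" for i
  have ef: "B (e i) (f j) = (if i = j then 1 else 0)" if "i < p" "j < p" for i j
    using that by (simp add: e_def B_simps d ff)
  have ed: "B (e i) (d j) = B (d i) (d j) / 2" if "i < p" "j < p" for i j
  proof -
    have "(\<Sum>k<p. B (d i) (d k) / 2 * B (f k) (d j)) = (\<Sum>k<p. if k = j then B (d i) (d j) / 2 else 0)"
      using that d[of j] by (intro sum.cong) (auto simp: B_sym[of _ "d j"])
    then have "B (e i) (d j) = B (d i) (d j) - B (d i) (d j) / 2"
      using that by (simp add: e_def B_simps)
    then show ?thesis using two_neq_0 by (simp add: field_simps)
  qed
  have ee: "B (e i) (e j) = 0" if ij: "i < p" "j < p" for i j
  proof -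
    have "B (e i) (e j) = B (e i) (d j) - (\<Sum>k<p. B (d j) (d k) / 2 * B (e i) (f k))"
      by (simp add: e_def[of j] B_simps)
    also have "(\<Sum>k<p. B (d j) (d k) / 2 * B (e i) (f k)) = (\<Sum>k<p. if k = i then B (d j) (d i) / 2 else 0)"
      using ij ef by (intro sum.cong) auto
    finally show ?thesis using ij ed[OF ij] by (simp add: B_sym[of "d j" "d i"])
  qed
  define h where "h a = (case a of Ev i \<Rightarrow> e i | Fv i \<Rightarrow> f i | Gv \<Rightarrow> 0)" for a
  have "hyperbolic {..<p} 0 h"
    unfolding hyperbolic_def by (auto simp: h_def ee ff ef)
  then show ?thesis by blast
qed

lemma hyp_exists:
  assumes wi: "has_witt_index s B p" and dm: "dim UNIV = 2 * p \<or> dim UNIV = 2 * p + 1"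
  shows "\<exists>\<gamma> h. hyperbolic {..<p} \<gamma> h \<and> hspan {..<p} h = UNIV \<and> (\<gamma> = 0 \<longleftrightarrow> dim UNIV = 2 * p)"
proof -
  have "p \<in> {dim L | L. maximal_isotropic_subspace s B L}"
    using wi unfolding has_witt_index_def by simp
  then obtain L where L: "maximal_isotropic_subspace s B L" "dim L = p" by blast
  obtain C where C: "C \<subseteq> L" "independent C" "L \<subseteq> span C" "card C = dim L"
    using basis_exists[of L] by blast
  have "isotropic B C"
    using L(1) C(1) unfolding maximal_isotropic_subspace_def isotropic_def by blast
  then obtain h where h: "hyperbolic {..<p} 0 h"
    using hyp_exists_isotropic[OF C(2) _ finiteI_independent[OF C(2)]] C(4) L(2) by auto
  let ?I = "{..<p}"
  have dU: "dim (hspan ?I h) = 2 * p" using dim_hspan[OF h] by simp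
  show ?thesis
  proof (cases "dim UNIV = 2 * p")
    case True
    have "hspan ?I h = UNIV"
      by (rule subspace_dim_equal[OF subspace_hspan subspace_UNIV]) (use dU True in auto)
    then show ?thesis using h True by blast
  next
    case False
    then have d1: "dim UNIV = 2 * p + 1" using dm by simp
    have "hspan ?I h \<noteq> UNIV" using dU d1 by auto
    then obtain v where v: "v \<notin> hspan ?I h" by blast
    define g where "g = v - hproj ?I 0 h h s v"
    have gU: "g \<notin> hspan ?I h"
    proof
      assume "g \<in> hspan ?I h"
      then have "g + hproj ?I 0 h h s v \<in> hspan ?I h" by (intro hspan_closed hproj_in_hspan)
      then show False using v by (simp add: g_def)
    qed
    have gp: "B g y = 0" if "y \<in> hspan ?I h" for y
      using B_hproj[OF h _ that] by (simp add: g_def B_simps)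
    define h' where "h' = h(Gv := g)"
    have gnz: "B g g \<noteq> 0"
    \<comment> \<open>An isotropic g would be orthogonal to the span of the pairs and to itself,
      hence to the whole space.\<close>
    proof
      assume gg: "B g g = 0"
      let ?S = "span (insert g (hspan ?I h))"
      have "dim (hspan ?I h) < dim (insert g (hspan ?I h))"
      proof (rule dim_psubset)
        have "g \<in> ?S" by (simp add: span_base)
        moreover have "span (hspan ?I h) \<subseteq> ?S" by (intro span_mono) auto
        moreover have "g \<notin> span (hspan ?I h)"
          using gU unfolding span_eq_iff[THEN iffD2, OF subspace_hspan] .
        ultimately show "span (hspan ?I h) \<subset> ?S" by blast
      qed
      then have "dim UNIV \<le> dim ?S" using dU d1 by simp
      then have "?S = UNIV"
        by (intro subspace_dim_equal[OF subspace_span subspace_UNIV]) auto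
      then have "B g w = 0" for w
        using B_span_eq_0'[of w "insert g (hspan ?I h)" g] gp gg by auto
      then have "g = 0" by (rule nondegenerate)
      then show False using gU hspan_closed(4) by simp
    qed
    have h': "hyperbolic ?I (B g g) h'"
    proof -
      have "B y g = 0" if "y \<in> hspan ?I h" for y using gp[OF that] B_sym[of y g] by simp
      then have "B (h (Ev i)) g = 0" "B (h (Fv i)) g = 0" if "i \<in> ?I" for i
        using mem_hspan(1,2)[OF that] by blast+
      then show ?thesis unfolding hyperbolic_def using gnz by (auto simp: h'_def hypD[OF h])
    qed
    have "hspan ?I h' = UNIV"
      by (rule subspace_dim_equal[OF subspace_hspan subspace_UNIV]) (use dim_hspan[OF h'] gnz d1 in auto)
    then show ?thesis using h' gnz False by blast
  qed
qed

lemma hyp_reindex: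
  assumes "hyperbolic I \<gamma> h" "finite I" "finite K" "card K = card I"
  shows "\<exists>h'. hyperbolic K \<gamma> h' \<and> hspan K h' = hspan I h"
proof -
  obtain b where b: "bij_betw b K I" using finite_same_card_bij assms(2-4) by blast
  then have bI: "i \<in> K \<Longrightarrow> b i \<in> I" and bi: "i \<in> K \<Longrightarrow> j \<in> K \<Longrightarrow> b i = b j \<longleftrightarrow> i = j"
    and im: "b ` K = I" for i j
    by (auto simp: bij_betw_def inj_on_def)
  define h' where "h' a = (case a of Ev i \<Rightarrow> h (Ev (b i)) | Fv i \<Rightarrow> h (Fv (b i)) | Gv \<Rightarrow> h Gv)" for a
  have "hyperbolic K \<gamma> h'"
    unfolding hyperbolic_def using hyp_G_eq_0[of I h] assms(1)
    by (auto simp: h'_def hypD[OF assms(1)] hypD_G[OF assms(1)] bI bi)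
  moreover have "h' ` hix K = h ` hix I"
    unfolding hix_def image_Un image_image im[symmetric] by (simp add: h'_def)
  ultimately show ?thesis unfolding hspan_def by auto
qed

text \<open>Dividing the f_i by \<open>r\<close> restores the products of the pairs, while the norm
  of g is multiplied by \<open>r\<close>.\<close>

lemma hyp_scaled_form:
  assumes "hyperbolic I \<gamma> h" "r \<noteq> 0"
  shows "\<exists>h'. quad_space.hyperbolic (\<lambda>u w. r * B u w) I (r * \<gamma>) h' \<and> quad_space.hspan s I h' = hspan I h"
proof -
  interpret R: quad_space s "\<lambda>u w. r * B u w" Basis by (rule quad_space_scaled_form) fact
  define h' where "h' a = (case a of Ev i \<Rightarrow> h (Ev i) | Fv i \<Rightarrow> s (1 / r) (h (Fv i)) | Gv \<Rightarrow> h Gv)" for a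
  have "R.hyperbolic I (r * \<gamma>) h'"
    unfolding R.hyperbolic_def using hyp_G_eq_0[of I h] assms
    by (auto simp: h'_def B_simps hypD[OF assms(1)] hypD_G[OF assms(1)])
  moreover have "hspan I h' = hspan I h"
  proof (rule antisym)
    show "hspan I h' \<subseteq> hspan I h"
      by (rule hspan_subsetI) (auto simp: h'_def mem_hspan elim!: hix_cases intro!: hspan_closed)
    show "hspan I h \<subseteq> hspan I h'"
    proof (rule hspan_subsetI)
      fix a assume "a \<in> hix I"
      then show "h a \<in> hspan I h'"
      proof (cases rule: hix_cases)
        case (2 i)
        then have "s r (h' (Fv i)) \<in> hspan I h'" by (intro hspan_closed mem_hspan)
        then show ?thesis using 2 assms(2) by (simp add: h'_def)
      qed (use mem_hspan(1)[of _ I h'] mem_hspan(3)[of h' I] in \<open>auto simp: h'_def\<close>)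
    qed
  qed
  ultimately show ?thesis by blast
qed

end

lemma ext_powerE:
  assumes "X \<in> ext_power s k"
  obtains x where "x \<in> ext_free k" "X = ext_class s k x"
  using assms unfolding ext_power_def by blast

lemma alt_form_map:
  assumes f: "Vector_Spaces.linear s t f" and alt: "alt_form t n \<phi>"
  shows "alt_form s n (\<lambda>vs. \<phi> (map f vs))"
proof (rule alt_formI)
  interpret f: Vector_Spaces.linear s t f by fact
  show "\<phi> (map f (xs @ (u + v) # ys)) = \<phi> (map f (xs @ u # ys)) + \<phi> (map f (xs @ v # ys))"
    if "length xs + 1 + length ys = n" for xs u v ys
    using alt_form_add[OF alt, of "map f xs" "map f ys"] that by (simp add: f.add)
  show "\<phi> (map f (xs @ s c u # ys)) = c * \<phi> (map f (xs @ u # ys))"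
    if "length xs + 1 + length ys = n" for xs c u ys
    using alt_form_scale[OF alt, of "map f xs" "map f ys"] that by (simp add: f.scale)
  show "\<phi> (map f vs) = 0" if "length vs = n" "\<not> distinct vs" for vs
    using that by (intro alt_form_not_distinct[OF alt]) (auto simp: distinct_map)
qed

section \<open>Isotropic Grassmann cone preserving maps\<close>

locale quad_pair = V: quad_space s B BV + W: quad_space t C BW
  for s :: "'k::field \<Rightarrow> 'v::ab_group_add \<Rightarrow> 'v" and B and BV :: "'v set"
    and t :: "'k \<Rightarrow> 'w::ab_group_add \<Rightarrow> 'w" and C and BW :: "'w set"
begin

text \<open>A map on lists of factors induces an IGCP map. It need not be multilinear itself; only
  its Gram pairings have to be alternating, and nondegeneracy in the target does the rest. The
  hypothesis on \<omega> then turns into a decomposable isotropic representation of the paired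
  values.\<close>

lemma igcp_from_lists:
  assumes hW: "W.hyperbolic I \<gamma> h" "finite I" "W.hspan I h = UNIV" and p: "p > 0" and q: "q > 0"
    and len: "\<And>vs. length vs = p \<Longrightarrow> length (f vs) = q"
    and alt: "\<And>z. length z = q \<Longrightarrow> alt_form s p (\<lambda>vs. gram C (f vs) z)"
    and iso: "\<And>vs. length vs = p \<Longrightarrow> isotropic B (set vs) \<Longrightarrow> isotropic C (set (f vs))"
    and H: "\<And>\<Phi>. igcp s B p t C q \<Phi> \<Longrightarrow> \<Phi> (ext_class s p x) \<in> iso_grassmann_cone t C q"
    and x: "x \<in> ext_free p"
  shows "\<exists>us. length us = q \<and> isotropic C (set us) \<and>
    (\<forall>z. length z = q \<longrightarrow> ext_eval (\<lambda>vs. gram C (f vs) z) x = gram C us z)"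
proof -
  \<comment> \<open>A representative of the class is chosen; \<open>null\<close> makes the result
    independent of the choice.\<close>
  define \<Phi> where "\<Phi> X = ext_class t q (ext_push f (SOME x. x \<in> ext_free p \<and> X = ext_class s p x))" for X
  have push: "ext_push f y \<in> ext_free q" if "y \<in> ext_free p" for y
    using that len by (rule ext_push_ext_free)
  have null: "ext_push f y \<in> ext_null t q" if "y \<in> ext_free p" "y \<in> ext_null s p" for y
  proof (rule W.ext_null_if_gram_0[OF hW push[OF that(1)]])
    fix z :: "'w list" assume "length z = q"
    from ext_eval_null[OF alt[OF this] that(2)]
    show "ext_eval (\<lambda>vs. gram C vs z) (ext_push f y) = 0" by (simp add: ext_eval_ext_push)
  qed
  have \<Phi>: "\<Phi> (ext_class s p y) = ext_class t q (ext_push f y)" if y: "y \<in> ext_free p" for y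
  proof -
    let ?y = "SOME y'. y' \<in> ext_free p \<and> ext_class s p y = ext_class s p y'"
    have "\<exists>y'. y' \<in> ext_free p \<and> ext_class s p y = ext_class s p y'" using y by blast
    from someI_ex[OF this] have y': "?y \<in> ext_free p" "ext_class s p y = ext_class s p ?y" by auto
    define d where "d = ?y + free_scale (-1) y"
    have d: "?y = d + y" unfolding d_def by (simp add: free_vs.scale_minus_left)
    have "?y - y \<in> ext_null s p" using y'(2) ext_class_eq_iff by metis
    then have "d \<in> ext_null s p" using d by (metis add_diff_cancel_right')
    moreover have "d \<in> ext_free p" unfolding d_def using y' y by (intro ext_free_closed)
    ultimately have "ext_push f d \<in> ext_null t q" by (intro null)
    moreover have "ext_push f ?y = ext_push f d + ext_push f y" by (subst d) (rule ext_push_add)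
    ultimately have "ext_push f ?y - ext_push f y \<in> ext_null t q" by simp
    then show ?thesis unfolding \<Phi>_def by (simp only: ext_class_eq_iff)
  qed
  have ig: "igcp s B p t C q \<Phi>"
    unfolding igcp_def ext_linear_def
  proof (intro conjI ballI allI)
    show "\<Phi> ` ext_power s p \<subseteq> ext_power t q"
    proof
      fix Y assume "Y \<in> \<Phi> ` ext_power s p"
      then obtain y where "y \<in> ext_free p" "Y = \<Phi> (ext_class s p y)" by (auto elim: ext_powerE)
      then show "Y \<in> ext_power t q" using push \<Phi> unfolding ext_power_def by auto
    qed
    fix X assume "X \<in> ext_power s p"
    then obtain y where y: "y \<in> ext_free p" "X = ext_class s p y" by (rule ext_powerE)
    show "\<Phi> (ext_scale s p c X) = ext_scale t q c (\<Phi> X)" for c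
      using y ext_free_closed(3)[OF y(1)] by (simp add: ext_scale_class \<Phi> ext_push_scale)
    fix Y assume "Y \<in> ext_power s p"
    then obtain z where z: "z \<in> ext_free p" "Y = ext_class s p z" by (rule ext_powerE)
    show "\<Phi> (ext_add X Y) = ext_add (\<Phi> X) (\<Phi> Y)"
      using y z ext_free_closed(2)[OF y(1) z(1)] by (simp add: ext_add_class \<Phi> ext_push_add)
  next
    show "\<Phi> ` iso_grassmann_cone s B p \<subseteq> iso_grassmann_cone t C q"
    proof
      fix Y assume "Y \<in> \<Phi> ` iso_grassmann_cone s B p"
      then obtain vs where vs: "length vs = p" "isotropic B (set vs)" "Y = \<Phi> (wedge s vs)"
        using iso_grassmann_cone_pos[OF V.vector_space_axioms V.nondegenerate_form p] by auto
      have "Y = wedge t (f vs)"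
        using vs len[OF vs(1)] by (simp add: wedge_def \<Phi> ext_free_closed ext_push_def)
      then show "Y \<in> iso_grassmann_cone t C q"
        using iso_grassmann_cone_pos[OF W.vector_space_axioms W.nondegenerate_form q]
          len[OF vs(1)] iso[OF vs(1,2)] by auto
    qed
  qed
  from H[OF ig] obtain us where us: "length us = q" "isotropic C (set us)" "\<Phi> (ext_class s p x) = wedge t us"
    using iso_grassmann_cone_pos[OF W.vector_space_axioms W.nondegenerate_form q] by auto
  then have n: "ext_push f x - Poly_Mapping.single us 1 \<in> ext_null t q"
    using \<Phi>[OF x] by (simp add: wedge_def ext_class_eq_iff)
  have "ext_eval (\<lambda>vs. gram C (f vs) z) x = gram C us z" if "length z = q" for z
  proof -
    have "alt_form t q (\<lambda>vs. gram C vs z)" using W.alt_form_gram_left[of z] that by simp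
    from ext_eval_null[OF this n] show ?thesis by (simp add: ext_eval_diff ext_eval_ext_push)
  qed
  then show ?thesis using us by blast
qed

context
  fixes K I \<gamma> hV hW
  assumes hV: "V.hyperbolic K \<gamma> hV" and hW: "W.hyperbolic I \<gamma> hW" and fin: "finite I" and KI: "K \<subseteq> I"
    and fullV: "V.hspan K hV = UNIV" and fullW: "W.hspan I hW = UNIV"
begin

section \<open>Isometric embedding of the smaller space and its adjoint\<close>

abbreviation "emb \<equiv> V.hproj K \<gamma> hV hW t"
abbreviation "prj \<equiv> W.hproj K \<gamma> hW hV s"

lemma finK: "finite K" using fin KI by (rule finite_subset[rotated])

lemma hWK: "W.hyperbolic K \<gamma> hW" using hW KI by (rule W.hyp_mono)

lemma emb_basis: "a \<in> hix K \<Longrightarrow> emb (hV a) = hW a"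
  using V.hproj_basis[OF hV finK W.vector_space_axioms] hWK W.hyp_G_eq_0 by blast

lemma prj_basis: "a \<in> hix K \<Longrightarrow> prj (hW a) = hV a"
  using W.hproj_basis[OF hWK finK V.vector_space_axioms] hV V.hyp_G_eq_0 by blast

lemma linear_emb: "Vector_Spaces.linear s t emb"
  unfolding Vector_Spaces.linear_iff
  using V.vector_space_axioms W.vector_space_axioms V.hproj_add V.hproj_scale by blast

lemma B_prj: "B (prj w) v = C w (emb v)"
  unfolding V.hproj_def W.hproj_def
  by (simp add: V.B_simps W.B_simps V.B_sym[of v] mult.commute sum.distrib add.commute)

lemma prj_emb: "prj (emb v) = v"
proof -
  have "C (emb v) (hW a) = B v (hV a)" if "a \<in> hix K" for a
    using B_prj[of "hW a" v] prj_basis[OF that] by (simp add: W.B_sym[of "emb v"] V.B_sym[of v])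
  then have "prj (emb v) = V.hproj K \<gamma> hV hV s v"
    unfolding W.hproj_def[of _ _ _ _ _ "emb v"] V.hproj_def[of _ _ _ _ s v] by (simp add: hix_def cong: sum.cong)
  then show ?thesis using V.hproj_id[OF hV finK] fullV by simp
qed

lemma emb_prj: "emb (prj w) = W.hproj K \<gamma> hW hW t w"
proof -
  have "B (prj w) (hV a) = C w (hW a)" if "a \<in> hix K" for a
    using B_prj[of w "hV a"] emb_basis[OF that] by simp
  then show ?thesis
    unfolding V.hproj_def[of _ _ _ _ _ "prj w"] W.hproj_def[of _ _ _ _ t w] by (simp add: hix_def cong: sum.cong)
qed

lemma emb_in_hspan: "emb v \<in> W.hspan K hW"
  unfolding V.hproj_def by (intro W.hspan_closed W.subspace_sum[OF W.subspace_hspan] W.mem_hspan)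

lemma C_emb: "C (emb u) (emb v) = B u v"
  using B_prj[of "emb u" v] prj_emb by simp

text \<open>Orthogonality to the f_k outside \<open>K\<close> excludes components along e_k. What
  remains outside \<open>hspan K hW\<close> are multiples of f_k, which contribute nothing to the
  product.\<close>

lemma B_prj_prj:
  assumes "\<And>k. k \<in> I - K \<Longrightarrow> C w (hW (Fv k)) = 0" "\<And>k. k \<in> I - K \<Longrightarrow> C w' (hW (Fv k)) = 0"
  shows "B (prj w) (prj w') = C w w'"
proof -
  have "w' = W.hproj I \<gamma> hW hW t w'" using W.hproj_id[OF hW fin] fullW by simp
  also have "\<dots> = W.hproj K \<gamma> hW hW t w' + (\<Sum>k\<in>I - K. t (C w' (hW (Fv k))) (hW (Ev k)) + t (C w' (hW (Ev k))) (hW (Fv k)))"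
    unfolding W.hproj_def using sum.subset_diff[OF KI fin] by (simp add: algebra_simps)
  finally have "C w w' = C w (W.hproj K \<gamma> hW hW t w' + (\<Sum>k\<in>I - K. t (C w' (hW (Fv k))) (hW (Ev k)) + t (C w' (hW (Ev k))) (hW (Fv k))))"
    by (rule arg_cong)
  also have "\<dots> = C w (W.hproj K \<gamma> hW hW t w')"
    by (simp add: W.B_add_right[of w] W.B_sum_right W.B_scale_right assms)
  finally show ?thesis by (simp only: B_prj emb_prj)
qed

lemma isotropic_prj:
  assumes "isotropic C A" "\<And>w k. w \<in> A \<Longrightarrow> k \<in> I - K \<Longrightarrow> C w (hW (Fv k)) = 0"
  shows "isotropic B (prj ` A)"
  using assms B_prj_prj unfolding isotropic_def by auto

end

end

lemma (in quad_space) ext_class_in_cone: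
  assumes h: "hyperbolic I \<gamma> h" "finite I" "hspan I h = UNIV" and x: "x \<in> ext_free p" and p: "p > 0"
    and l: "length l = p" "isotropic B (set l)"
    and eq: "\<And>y. length y = p \<Longrightarrow> ext_eval (\<lambda>vs. gram B vs y) x = gram B l y"
  shows "ext_class s p x \<in> iso_grassmann_cone s B p"
proof -
  define d where "d = x + free_scale (-1) (Poly_Mapping.single l 1)"
  have "d \<in> ext_free p" unfolding d_def using x l by (intro ext_free_closed)
  then have "d \<in> ext_null s p"
    by (rule ext_null_if_gram_0[OF h]) (simp add: d_def ext_eval_add ext_eval_diff ext_eval_scale eq)
  then have "x - Poly_Mapping.single l 1 \<in> ext_null s p" by (simp add: d_def free_vs.scale_minus_left)
  then have "ext_class s p x = wedge s l" using l by (simp add: wedge_def ext_class_eq_iff)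
  then show ?thesis
    using iso_grassmann_cone_pos[OF vector_space_axioms nondegenerate_form p] l by blast
qed

context quad_pair
begin

text \<open>The wedge with the frame of the e_k, p <= k < q, is undone by contracting with the dual
  f_k and projecting back.\<close>

lemma cone_if_igcp_lt:
  assumes hV: "V.hyperbolic {..<p} \<gamma> hV" and fullV: "V.hspan {..<p} hV = UNIV"
    and hW: "W.hyperbolic {..<q} \<gamma> hW" and fullW: "W.hspan {..<q} hW = UNIV"
    and p: "p > 0" and pq: "p < q" and x: "x \<in> ext_free p"
    and H: "\<And>\<Phi>. igcp s B p t C q \<Phi> \<Longrightarrow> \<Phi> (ext_class s p x) \<in> iso_grassmann_cone t C q"
  shows "ext_class s p x \<in> iso_grassmann_cone s B p"
proof -
  let ?K = "{..<p}" and ?I = "{..<q}"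
  have fin: "finite ?I" and KI: "?K \<subseteq> ?I" using pq by auto
  note pr = hV hW fin KI fullV fullW
  let ?emb = "V.hproj ?K \<gamma> hV hW t" and ?prj = "W.hproj ?K \<gamma> hW hV s"
  define hs where "hs = map (\<lambda>k. hW (Ev k)) [p..<q]"
  define xs where "xs = map (\<lambda>k. hW (Fv k)) [p..<q]"
  have lhs: "length hs + p = q" "length xs + p = q" using pq by (auto simp: hs_def xs_def)
  have perp: "C (hW (Ev k)) (?emb v) = 0" "C (hW (Fv k)) (?emb v) = 0"
    "C (?emb v) (hW (Ev k)) = 0" "C (?emb v) (hW (Fv k)) = 0" if "k \<in> ?I" "k \<notin> ?K" for k v
  proof -
    have "?K \<subseteq> ?I - {k}" using that KI by auto
    then have "?emb v \<in> W.hspan (?I - {k}) hW"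
      using emb_in_hspan[OF pr, of v] W.hspan_mono[of ?K "?I - {k}" hW] by blast
    from W.hspan_perp[OF hW that(1) this] show "C (hW (Ev k)) (?emb v) = 0" "C (hW (Fv k)) (?emb v) = 0"
      "C (?emb v) (hW (Ev k)) = 0" "C (?emb v) (hW (Fv k)) = 0" by auto
  qed
  let ?f = "\<lambda>vs. hs @ map ?emb vs"
  have "\<exists>us. length us = q \<and> isotropic C (set us) \<and>
    (\<forall>z. length z = q \<longrightarrow> ext_eval (\<lambda>vs. gram C (?f vs) z) x = gram C us z)"
  proof (rule igcp_from_lists[OF hW fin fullW p, where f = ?f])
    show "\<Phi> (ext_class s p x) \<in> iso_grassmann_cone t C q" if "igcp s B p t C q \<Phi>" for \<Phi>
      by (rule H[OF that])
    show "alt_form s p (\<lambda>vs. gram C (?f vs) z)" if "length z = q" for z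
    proof -
      have "alt_form t (length hs + p) (\<lambda>us. gram C us z)"
        using W.alt_form_gram_left[of z] that lhs by simp
      from alt_form_map[OF linear_emb[OF pr] alt_form_append[OF this]] show ?thesis .
    qed
    show "isotropic C (set (?f vs))" if "isotropic B (set vs)" for vs
      using that W.hypD(1)[OF hW] perp C_emb[OF pr]
      by (auto simp: isotropic_def hs_def)
  qed (use pq lhs x in auto)
  then obtain us where us: "length us = q" "isotropic C (set us)"
    "\<And>z. length z = q \<Longrightarrow> ext_eval (\<lambda>vs. gram C (?f vs) z) x = gram C us z" by blast
  \<comment> \<open>The contracted factors are orthogonal to the f_k, so
    \<open>isotropic_prj\<close> applies to them.\<close>
  obtain us' where us': "length us' = p" "set us' \<subseteq> W.span (set us)"
    "\<And>u y. u \<in> set us' \<Longrightarrow> y \<in> set xs \<Longrightarrow> C u y = 0"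
    "\<And>ys. length ys = p \<Longrightarrow> gram C us (xs @ ys) = gram C us' ys"
    using W.gram_contract[of us xs p] us(1) lhs p by auto
  have iso': "isotropic C (set us')"
    using W.isotropic_span[OF us(2)] us'(2) unfolding isotropic_def by blast
  \<comment> \<open>The Gram matrix is block diagonal: the extra pairs give an identity
    block.\<close>
  have red: "gram C (map (\<lambda>k. hW (Ev k)) ks @ map ?emb vs) (map (\<lambda>k. hW (Fv k)) ks @ map ?emb y) =
      gram C (map ?emb vs) (map ?emb y)"
    if "distinct ks" "set ks \<subseteq> ?I - ?K" "length vs = length y" for ks vs y
    using that
  proof (induction ks)
    case (Cons k ks)
    have k: "k \<in> ?I" "k \<notin> ?K" using Cons.prems by auto
    have "gram C (hW (Ev k) # (map (\<lambda>k. hW (Ev k)) ks @ map ?emb vs)) (hW (Fv k) # (map (\<lambda>k. hW (Fv k)) ks @ map ?emb y))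
      = C (hW (Ev k)) (hW (Fv k)) * gram C (map (\<lambda>k. hW (Ev k)) ks @ map ?emb vs) (map (\<lambda>k. hW (Fv k)) ks @ map ?emb y)"
    proof (rule gram_Cons_Cons)
      fix w assume "w \<in> set (map (\<lambda>k. hW (Ev k)) ks @ map ?emb vs)"
      then consider j where "j \<in> set ks" "w = hW (Ev j)" | v where "w = ?emb v" by auto
      then show "C w (hW (Fv k)) = 0"
      proof cases
        case (1 j)
        then have "j \<in> ?I" "j \<noteq> k" using Cons.prems by auto
        then show ?thesis using W.hypD(3)[OF hW _ k(1), of j] 1 by simp
      qed (use perp k in simp)
    qed (use Cons.prems in simp)
    then show ?case using Cons W.hypD(3)[OF hW k(1) k(1)] by simp
  qed simp
  have eq: "ext_eval (\<lambda>vs. gram B vs y) x = gram B (map ?prj us') y" if y: "length y = p" for y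
  proof -
    have "ext_eval (\<lambda>vs. gram B vs y) x = ext_eval (\<lambda>vs. gram C (?f vs) (xs @ map ?emb y)) x"
    proof (rule ext_eval_cong[OF x])
      fix vs :: "'v list" assume "length vs = p"
      then have "gram C (?f vs) (xs @ map ?emb y) = gram C (map ?emb vs) (map ?emb y)"
        unfolding hs_def xs_def by (intro red) (use y in auto)
      also have "\<dots> = gram B (map (\<lambda>v. v) vs) (map (\<lambda>v. v) y)"
        by (rule gram_map) (use C_emb[OF pr] y \<open>length vs = p\<close> in auto)
      finally show "gram B vs y = gram C (?f vs) (xs @ map ?emb y)" by simp
    qed
    also have "\<dots> = gram C us' (map ?emb y)" using us(3) us'(4) y lhs by simp
    also have "\<dots> = gram C (map (\<lambda>w. w) us') (map ?emb y)" by simp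
    also have "\<dots> = gram B (map ?prj us') (map (\<lambda>v. v) y)"
      by (rule gram_map) (use B_prj[OF pr] y us'(1) in auto)
    finally show ?thesis by simp
  qed
  have "isotropic B (?prj ` set us')"
    by (rule isotropic_prj[OF pr iso']) (use us'(3) in \<open>auto simp: xs_def\<close>)
  then show ?thesis
    by (intro V.ext_class_in_cone[OF hV _ fullV x p, of "map ?prj us'"]) (use us'(1) eq in auto)
qed

lemma cone_if_igcp_ge:
  assumes hV: "V.hyperbolic {..<p} \<gamma> hV" and fullV: "V.hspan {..<p} hV = UNIV"
    and hW: "W.hyperbolic {..<q} \<gamma> hW" and fullW: "W.hspan {..<q} hW = UNIV"
    and q: "q = (if \<gamma> = 0 then 4 else 3)" and pq: "q \<le> p" and x: "x \<in> ext_free p"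
    and H: "\<And>\<Phi>. igcp s B p t C q \<Phi> \<Longrightarrow> \<Phi> (ext_class s p x) \<in> iso_grassmann_cone t C q"
  shows "ext_class s p x \<in> iso_grassmann_cone s B p"
proof -
  \<comment> \<open>Now the target is the smaller space, so embedding and projection are used with
    the roles of V and W exchanged.\<close>
  interpret R: quad_pair t C BW s B BV ..
  let ?I = "{..<p}"
  have q1: "q \<ge> 1" and p: "p > 0" using q pq by (auto split: if_splits)
  define \<alpha> where "\<alpha> ys = ext_eval (\<lambda>vs. gram B vs ys) x" for ys
  have alt: "alt_form s (card ?I) \<alpha>"
    unfolding \<alpha>_def using alt_form_ext_eval[OF x, of s p "gram B"] V.alt_form_gram by auto
  have "V.pure ?I hV \<alpha>"
  proof (rule V.pure_if_contractions_pure[OF _ hV alt])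
    fix h' ks assume h': "V.hyperbolic ?I \<gamma> h'" "V.hspan ?I h' \<subseteq> V.hspan ?I hV"
      and ks: "distinct ks" "set ks \<subseteq> ?I" "length ks + q = card ?I"
    define K where "K = ?I - set ks"
    have KI: "K \<subseteq> ?I" and finK: "finite K" by (auto simp: K_def)
    have cK: "card K = q" using ks by (simp add: K_def card_Diff_subset distinct_card)
    obtain hK where hK: "W.hyperbolic K \<gamma> hK" "W.hspan K hK = UNIV"
      using W.hyp_reindex[OF hW _ finK] cK fullW by auto
    have fullh': "V.hspan ?I h' = UNIV" using V.hspan_eq[OF hV h'(1) _ h'(2)] fullV by simp
    note pr = hK(1) h'(1) finite_lessThan KI hK(2) fullh'
    let ?emb = "W.hproj K \<gamma> hK h' s" and ?prj = "V.hproj K \<gamma> h' hK t"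
    define xs where "xs = map (\<lambda>k. h' (Fv k)) ks"
    have lxs: "p = length xs + q" using ks(3) by (simp add: xs_def)
    have "\<exists>us. length us = q \<and> set us \<subseteq> V.span (set vs) \<and> (\<forall>u\<in>set us. \<forall>y\<in>set xs. B u y = 0) \<and>
      (\<forall>ys. length ys = q \<longrightarrow> gram B vs (xs @ ys) = gram B us ys)" if "length vs = p" for vs
      using V.gram_contract[of vs xs q] that lxs q1 by simp
    then have "\<forall>vs. \<exists>us. length vs = p \<longrightarrow> length us = q \<and> set us \<subseteq> V.span (set vs) \<and>
      (\<forall>u\<in>set us. \<forall>y\<in>set xs. B u y = 0) \<and>
      (\<forall>ys. length ys = q \<longrightarrow> gram B vs (xs @ ys) = gram B us ys)" by blast
    \<comment> \<open>The factors of a contraction are not unique; any choice will do, since only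
      their pairings enter.\<close>
    from choice[OF this] obtain c where c: "\<And>vs. length vs = p \<Longrightarrow> length (c vs) = q"
      "\<And>vs. length vs = p \<Longrightarrow> set (c vs) \<subseteq> V.span (set vs)"
      "\<And>vs u y. length vs = p \<Longrightarrow> u \<in> set (c vs) \<Longrightarrow> y \<in> set xs \<Longrightarrow> B u y = 0"
      "\<And>vs ys. length vs = p \<Longrightarrow> length ys = q \<Longrightarrow> gram B vs (xs @ ys) = gram B (c vs) ys"
      by blast
    let ?f = "\<lambda>vs. map ?prj (c vs)"
    have f: "gram C (?f vs) z = gram B vs (xs @ map ?emb z)" if "length vs = p" "length z = q" for vs z
    proof -
      have "gram C (map ?prj (c vs)) (map (\<lambda>w. w) z) = gram B (map (\<lambda>v. v) (c vs)) (map ?emb z)"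
        by (rule gram_map) (use R.B_prj[OF pr] c(1) that in auto)
      then show ?thesis using c(4) that by simp
    qed
    have "\<exists>us. length us = q \<and> isotropic C (set us) \<and>
      (\<forall>z. length z = q \<longrightarrow> ext_eval (\<lambda>vs. gram C (?f vs) z) x = gram C us z)"
    proof (rule igcp_from_lists[OF hW finite_lessThan fullW p, where f = ?f])
      show "\<Phi> (ext_class s p x) \<in> iso_grassmann_cone t C q" if "igcp s B p t C q \<Phi>" for \<Phi>
        by (rule H[OF that])
      show "alt_form s p (\<lambda>vs. gram C (?f vs) z)" if "length z = q" for z
      proof (rule alt_form_cong)
        show "alt_form s p (\<lambda>vs. gram B vs (xs @ map ?emb z))"
          using V.alt_form_gram_left[of "xs @ map ?emb z"] that lxs by simp
      qed (use f that in simp)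
      show "isotropic C (set (?f vs))" if vs: "length vs = p" "isotropic B (set vs)" for vs
      proof -
        have "isotropic B (set (c vs))"
          using V.isotropic_span[OF vs(2)] c(2)[OF vs(1)] unfolding isotropic_def by blast
        then have "isotropic C (?prj ` set (c vs))"
          by (rule R.isotropic_prj[OF pr]) (use c(3)[OF vs(1)] ks(2) in \<open>auto simp: K_def xs_def\<close>)
        then show ?thesis by simp
      qed
    qed (use q1 c(1) x in auto)
    then obtain us where us: "length us = q" "isotropic C (set us)"
      "\<And>z. length z = q \<Longrightarrow> ext_eval (\<lambda>vs. gram C (?f vs) z) x = gram C us z" by blast
    \<comment> \<open>On \<open>hspan K h'\<close> the two maps are inverse isometries, so the
      representation found in the target is transported back to V.\<close>
    have "V.pure K h' (\<lambda>S. \<alpha> (xs @ S))"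
      unfolding V.pure_def
    proof (intro exI[of _ "map ?emb us"] conjI allI impI)
      show "length (map ?emb us) = card K" using us cK by simp
      show "set (map ?emb us) \<subseteq> V.hspan K h'" using R.emb_in_hspan[OF pr] by auto
      show "isotropic B (set (map ?emb us))" using us(2) R.C_emb[OF pr] by (simp add: isotropic_def)
      fix y assume y: "length y = card K" "set y \<subseteq> V.hspan K h'"
      have "map ?emb (map ?prj y) = y"
        using y(2) R.emb_prj[OF pr] V.hproj_id[OF V.hyp_mono[OF h'(1) KI] finK]
        by (auto intro!: map_idI)
      then have "\<alpha> (xs @ y) = ext_eval (\<lambda>vs. gram B vs (xs @ map ?emb (map ?prj y))) x"
        unfolding \<alpha>_def by simp
      also have "\<dots> = ext_eval (\<lambda>vs. gram C (?f vs) (map ?prj y)) x"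
        by (rule ext_eval_cong[OF x]) (use f y cK in simp)
      also have "\<dots> = gram C us (map ?prj y)" using us(3) y cK by simp
      also have "\<dots> = gram C (map (\<lambda>w. w) us) (map (\<lambda>w. w) (map ?prj y))" by simp
      also have "\<dots> = gram B (map ?emb us) (map ?emb (map ?prj y))"
        by (rule gram_map) (use R.C_emb[OF pr] y us(1) cK in auto)
      finally show "\<alpha> (xs @ y) = gram B (map ?emb us) y"
        using \<open>map ?emb (map ?prj y) = y\<close> by simp
    qed
    then show "V.pure (?I - set ks) h' (\<lambda>S. \<alpha> (map (\<lambda>k. h' (Fv k)) ks @ S))"
      by (simp add: K_def xs_def)
  qed (use q pq in auto)
  then obtain l where l: "length l = p" "isotropic B (set l)" "\<And>y. length y = p \<Longrightarrow> \<alpha> y = gram B l y"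
    unfolding V.pure_def fullV by auto
  show ?thesis
    by (rule V.ext_class_in_cone[OF hV _ fullV x p l(1,2)]) (use l(3) in \<open>auto simp: \<alpha>_def\<close>)
qed

lemma cone_iff_igcp_aux:
  assumes hV: "V.hyperbolic {..<p} \<gamma> hV" "V.hspan {..<p} hV = UNIV"
    and hW: "W.hyperbolic {..<q} \<gamma> hW" "W.hspan {..<q} hW = UNIV"
    and q: "q = (if \<gamma> = 0 then 4 else 3)" and \<omega>: "\<omega> \<in> ext_power s p"
  shows "\<omega> \<in> iso_grassmann_cone s B p \<longleftrightarrow>
    (\<forall>\<Phi>. igcp s B p t C q \<Phi> \<longrightarrow> \<Phi> \<omega> \<in> iso_grassmann_cone t C q)"
proof
  assume "\<omega> \<in> iso_grassmann_cone s B p"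
  then show "\<forall>\<Phi>. igcp s B p t C q \<Phi> \<longrightarrow> \<Phi> \<omega> \<in> iso_grassmann_cone t C q"
    unfolding igcp_def by blast
next
  assume H: "\<forall>\<Phi>. igcp s B p t C q \<Phi> \<longrightarrow> \<Phi> \<omega> \<in> iso_grassmann_cone t C q"
  obtain x where x: "x \<in> ext_free p" "\<omega> = ext_class s p x" using \<omega> by (rule ext_powerE)
  consider "p = 0" | "0 < p" "p < q" | "q \<le> p" by linarith
  then show "\<omega> \<in> iso_grassmann_cone s B p"
  proof cases
    case 1
    define c where "c = Poly_Mapping.lookup x []"
    \<comment> \<open>In degree 0 every element is a multiple of the empty wedge, and the cone
      contains all of them.\<close>
    have "x = free_scale c (Poly_Mapping.single [] 1)"
    proof (rule poly_mapping_eqI)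
      fix a
      have "Poly_Mapping.lookup x a = 0" if "a \<noteq> []"
        using x(1) 1 that unfolding ext_free_def by (auto simp: in_keys_iff)
      then show "Poly_Mapping.lookup x a = Poly_Mapping.lookup (free_scale c (Poly_Mapping.single [] 1)) a"
        by (cases "a = []") (auto simp: c_def lookup_single when_def)
    qed
    then have "\<omega> = ext_scale s p c (wedge s [])" using x(2) 1 by (simp add: wedge_def ext_scale_class)
    moreover have "isotropic B (set [])" by (simp add: isotropic_def)
    ultimately show ?thesis unfolding iso_grassmann_cone_def using 1 by (metis (mono_tags, lifting) list.size(3) mem_Collect_eq)
  next
    case 2
    then show ?thesis using cone_if_igcp_lt[OF hV hW 2 x(1)] H x(2) by simp
  next
    case 3
    then show ?thesis using cone_if_igcp_ge[OF hV hW q 3 x(1)] H x(2) by simp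
  qed
qed

lemma cone_iff_igcp:
  assumes hV: "V.hyperbolic {..<p} \<gamma> hV" "V.hspan {..<p} hV = UNIV"
    and hW: "W.hyperbolic {..<q} \<delta> hW" "W.hspan {..<q} hW = UNIV"
    and \<delta>: "\<delta> = 0 \<longleftrightarrow> \<gamma> = 0" and q: "q = (if \<gamma> = 0 then 4 else 3)" and \<omega>: "\<omega> \<in> ext_power s p"
  shows "\<omega> \<in> iso_grassmann_cone s B p \<longleftrightarrow>
    (\<forall>\<Phi>. igcp s B p t C q \<Phi> \<longrightarrow> \<Phi> \<omega> \<in> iso_grassmann_cone t C q)"
proof -
  \<comment> \<open>Rescaling the target form by the quotient of the two norms of g equates them; in
    even dimension nothing has to be adjusted.\<close>
  define r where "r = (if \<gamma> = 0 then 1 else \<gamma> / \<delta>)"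
  have r: "r \<noteq> 0" "r * \<delta> = \<gamma>" using \<delta> by (auto simp: r_def)
  let ?C = "\<lambda>u w. r * C u w"
  interpret R: quad_space t ?C BW by (rule W.quad_space_scaled_form[OF r(1)])
  interpret P: quad_pair s B BV t ?C BW ..
  obtain h' where h': "R.hyperbolic {..<q} \<gamma> h'" "R.hspan {..<q} h' = UNIV"
    using W.hyp_scaled_form[OF hW(1) r(1)] r(2) hW(2) by auto
  have "\<omega> \<in> iso_grassmann_cone s B p \<longleftrightarrow>
    (\<forall>\<Phi>. igcp s B p t ?C q \<Phi> \<longrightarrow> \<Phi> \<omega> \<in> iso_grassmann_cone t ?C q)"
    by (rule P.cone_iff_igcp_aux[OF hV h' q \<omega>])
  then show ?thesis unfolding igcp_def iso_grassmann_cone_scaled_form[OF r(1)] .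
qed

end

theorem corollary4p2:
  fixes s :: "'k::field \<Rightarrow> 'v::ab_group_add \<Rightarrow> 'v"
    and Basis :: "'v set"
    and B :: "'v \<Rightarrow> 'v \<Rightarrow> 'k"
    and B7 :: "'k ^ 7 \<Rightarrow> 'k ^ 7 \<Rightarrow> 'k"
    and B8 :: "'k ^ 8 \<Rightarrow> 'k ^ 8 \<Rightarrow> 'k"
    and p :: nat
    and \<omega> :: "('v list \<Rightarrow>\<^sub>0 'k) set"
  assumes "CHAR('k) \<noteq> 2"
    and "finite_dimensional_vector_space s Basis"
    and "p = vector_space.dim s (UNIV :: 'v set) div 2"
    and "nondegenerate_symmetric_form s B" and "has_witt_index s B p"
    and "nondegenerate_symmetric_form (*s) B7" and "has_witt_index (*s) B7 3"
    and "nondegenerate_symmetric_form (*s) B8" and "has_witt_index (*s) B8 4"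
    and "\<omega> \<in> ext_power s p"
  shows "(vector_space.dim s (UNIV :: 'v set) = 2 * p + 1 \<longrightarrow>
            (\<omega> \<in> iso_grassmann_cone s B p \<longleftrightarrow>
              (\<forall>\<Phi>. igcp s B p (*s) B7 3 \<Phi> \<longrightarrow> \<Phi> \<omega> \<in> iso_grassmann_cone (*s) B7 3)))
       \<and> (vector_space.dim s (UNIV :: 'v set) = 2 * p \<longrightarrow>
            (\<omega> \<in> iso_grassmann_cone s B p \<longleftrightarrow>
              (\<forall>\<Phi>. igcp s B p (*s) B8 4 \<Phi> \<longrightarrow> \<Phi> \<omega> \<in> iso_grassmann_cone (*s) B8 4)))"
proof (intro conjI impI)
  note two = two_neq_0_if_CHAR[OF assms(1)]
  interpret V: quad_space s B Basis by (rule quad_spaceI[OF assms(2,4) two])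
  {
    assume d: "V.dim UNIV = 2 * p + 1"
    interpret W: quad_space "(*s)" B7 cart_basis
      by (rule quad_spaceI[OF vec.finite_dimensional_vector_space_axioms assms(6) two])
    interpret P: quad_pair s B Basis "(*s)" B7 cart_basis ..
    have d7: "vec.dim (UNIV :: ('k ^ 7) set) = 2 * 3 + 1" by (simp add: card_cart_basis)
    obtain \<gamma> h where h: "V.hyperbolic {..<p} \<gamma> h" "V.hspan {..<p} h = UNIV" "\<gamma> = 0 \<longleftrightarrow> V.dim UNIV = 2 * p"
      using V.hyp_exists[OF assms(5)] d by blast
    obtain \<delta> k where k: "W.hyperbolic {..<3} \<delta> k" "W.hspan {..<3} k = UNIV" "\<delta> = 0 \<longleftrightarrow> vec.dim (UNIV :: ('k ^ 7) set) = 2 * 3"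
      using W.hyp_exists[OF assms(7)] d7 by blast
    have "\<gamma> \<noteq> 0" "\<delta> \<noteq> 0" using h(3) k(3) d d7 by linarith+
    then show "\<omega> \<in> iso_grassmann_cone s B p \<longleftrightarrow>
        (\<forall>\<Phi>. igcp s B p (*s) B7 3 \<Phi> \<longrightarrow> \<Phi> \<omega> \<in> iso_grassmann_cone (*s) B7 3)"
      by (intro P.cone_iff_igcp[OF h(1,2) k(1,2) _ _ assms(10)]) auto
  next
    assume d: "V.dim UNIV = 2 * p"
    interpret W: quad_space "(*s)" B8 cart_basis
      by (rule quad_spaceI[OF vec.finite_dimensional_vector_space_axioms assms(8) two])
    interpret P: quad_pair s B Basis "(*s)" B8 cart_basis ..
    have d8: "vec.dim (UNIV :: ('k ^ 8) set) = 2 * 4" by (simp add: card_cart_basis)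
    obtain \<gamma> h where h: "V.hyperbolic {..<p} \<gamma> h" "V.hspan {..<p} h = UNIV" "\<gamma> = 0 \<longleftrightarrow> V.dim UNIV = 2 * p"
      using V.hyp_exists[OF assms(5)] d by blast
    obtain \<delta> k where k: "W.hyperbolic {..<4} \<delta> k" "W.hspan {..<4} k = UNIV" "\<delta> = 0 \<longleftrightarrow> vec.dim (UNIV :: ('k ^ 8) set) = 2 * 4"
      using W.hyp_exists[OF assms(9)] d8 by blast
    have "\<gamma> = 0" "\<delta> = 0" using h(3) k(3) d d8 by auto
    then show "\<omega> \<in> iso_grassmann_cone s B p \<longleftrightarrow>
        (\<forall>\<Phi>. igcp s B p (*s) B8 4 \<Phi> \<longrightarrow> \<Phi> \<omega> \<in> iso_grassmann_cone (*s) B8 4)"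
      by (intro P.cone_iff_igcp[OF h(1,2) k(1,2) _ _ assms(10)]) auto
  }
qed

end
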